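(* Let $\delta:\mathrm{B}_{\mathbb Z}(S_3,S_3)\to A$ be the injective ring morphism $$\delta(y)=c_3^{-1}\cdot c_2^{-1}\cdot c_1^{-1}\cdot\gamma^{-1}(y)\cdot c_1\cdot c_2\cdot c_3,$$ where $A$, $\gamma$ and the units $c_1,c_2,c_3$ of $A$ are as defined in the context. The image $\Lambda:=\delta(\mathrm{B}_{\mathbb Z}(S_3,S_3))$ is contained in $A_{\mathbb Z}$, and $\Lambda$ is the set of all $$\begin{bmatrix} s_{1,1}&s_{1,2}&s_{1,3}&0&0&t_1\\ s_{2,1}&s_{2,2}&s_{2,3}&0&0&t_2\\ s_{3,1}&s_{3,2}&s_{3,3}&0&0&t_3\\ 0&0&0&u&0&v\\ 0&0&0&0&w&0\\ x_1&x_2&x_3&y&0&z_1+z_2\bar\eta+z_3\bar\xi\end{bmatrix}\in A_{\mathbb Z}$$ (all of $s_{i,j},t_i,u,v,w,x_i,y,z_i$ being integers) that satisfy all of the following congruences: - $2w-2z_1\equiv z_2 \pmod 8$, $z_2\equiv z_3\pmod 4$, $z_3\equiv 0\pmod 4$; - $x_1\equiv x_2\equiv x_3\equiv 0\pmod 4$; - $y\equiv t_1\equiv t_2\equiv t_3\equiv v\equiv 0\pmod 2$; - $x_1\equiv x_2\equiv x_3\equiv z_2\equiv 0\pmod 3$. In particular, $\mathrm{B}_{\mathbb Z}(S_3,S_3)\cong\Lambda$ as rings.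
   Context: **Double Burnside algebra.** Let $G$ be a finite group and $R$ a commutative ring. A $(G,G)$-biset is a finite set with commuting left and right $G$-actions. For $(G,G)$-bisets $M,N$, the tensor product $M\times_G N$ is the set of $G$-orbits on $M\times N$ under $g(m,n)=(mg^{-1},gn)$, with the biset structure induced by $h(m,n)p=(hm,np)$. The double Burnside algebra $\mathrm{B}_R(G,G)$ is the $R$-module generated by the isomorphism classes $[M]$ of finite $(G,G)$-bisets modulo the relations $[M\sqcup N]=[M]+[N]$, with multiplication induced by $[M]\cdot[N]=[M\times_G N]$; its unit is $[G]$. $\mathrm{B}_{\mathbb Z}(S_3,S_3)$ is regarded as a subring of $\mathrm{B}_{\mathbb Q}(S_3,S_3)$. A left $(G\times G)$-set $Y$ is regarded as a $(G,G)$-biset via $h\cdot y\cdot g=(h,g^{-1})y$. **Basis.** In $S_3$ let $a=(1,2)$, $b=(1,2,3)$, $V_0=\{\mathrm{id}\}$, $V_1=\langle a\rangle$, $V_4=\langle b\rangle$, $V_5=S_3$. Put $H_{i,j}=[(S_3\times S_3)/(V_i\times V_j)]$ for $i,j\in\{0,1,4,5\}$; $H^\Delta_t=[(S_3\times S_3)/\{(x,x):x\in V_t\}]$ for $t\in\{1,4,5\}$; and $H_6,H_7,H_8$ the classes of $(S_3\times S_3)/U_s$ with $U_6=\langle(a,a),(1,b)\rangle$, $U_7=\langle(a,a),(b,1)\rangle$, $U_8=\langle(a,a),(b,1),(1,b)\rangle$ respectively. These $22$ elements form a $\mathbb Z$-basis of $\mathrm{B}_{\mathbb Z}(S_3,S_3)$.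 **Elements of $\mathrm{B}_{\mathbb Q}(S_3,S_3)$.** For $x=(x_0,x_1,x_4,x_5)$, $y=(y_0,y_1,y_4,y_5)\in\mathbb Q^4$ put $T(x,y)=\sum_{i,j\in\{0,1,4,5\}}x_iy_jH_{i,j}$. Let $l_e=(-\tfrac12,1,\tfrac12,0)$, $l_g=(-\tfrac43,2,1,0)$, $l_h=(-\tfrac13,0,1,0)$, $l_4=(\tfrac16,-\tfrac13,-\tfrac16,\tfrac13)$, $f_e=(1,0,0,0)$, $f_g=(-1,1,0,0)$, $f_h=(\tfrac14,-1,\tfrac34,0)$, $f_4=(\tfrac14,-\tfrac12,-\tfrac14,\tfrac12)$. Put $e=T(l_e,f_e)$, $g=T(l_g,f_g)$, $h=T(l_h,f_h)$; $b_{p,q}=T(l_p,f_q)$ for $p\neq q$ in $\{e,g,h\}$; $b_{p,\varepsilon_4}=T(l_p,f_4)$ and $b_{\varepsilon_4,p}=T(l_4,f_p)$ for $p\in\{e,g,h\}$; $b'_{\varepsilon_4,\varepsilon_4}=T(l_4,f_4)$. Further put $\varepsilon_2=-H_{0,0}+H_{1,0}+H_{0,1}+H^\Delta_1-2H_{1,1}$, $\varepsilon_3=-\tfrac14H_{0,0}+\tfrac14H_{4,0}+\tfrac14H_{0,4}+\tfrac12H^\Delta_4-\tfrac34H_{4,4}$, $\varepsilon_4=\tfrac12H_{0,0}-H^\Delta_1-\tfrac12H^\Delta_4+H^\Delta_5$, $b_{\varepsilon_2,\varepsilon_4}=-\tfrac12H_{0,0}+\tfrac12H_{1,0}+\tfrac12H_{0,1}+\tfrac12H^\Delta_1+\tfrac12H_{0,4}-H_{1,1}-\tfrac12H_{0,5}-\tfrac12H_6-\tfrac12H_{1,4}+H_{1,5}$,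 $b_{\varepsilon_4,\varepsilon_2}=-\tfrac12H_{0,0}+\tfrac12H_{1,0}+\tfrac12H_{0,1}+\tfrac12H^\Delta_1+\tfrac12H_{4,0}-H_{1,1}-\tfrac12H_{5,0}-\tfrac12H_{4,1}-\tfrac12H_7+H_{5,1}$, $b''_{\varepsilon_4,\varepsilon_4}=\tfrac14H_{0,0}-\tfrac34H_{1,0}-\tfrac34H_{0,1}+\tfrac14H^\Delta_1-\tfrac14H_{4,0}-\tfrac14H_{0,4}+\tfrac32H_{1,1}+\tfrac34H_{5,0}+\tfrac34H_{0,5}-\tfrac14H_6+\tfrac34H_{4,1}+\tfrac34H_{1,4}-\tfrac14H_7+\tfrac14H_{4,4}-\tfrac32H_{1,5}-\tfrac32H_{5,1}-\tfrac34H_{4,5}-\tfrac34H_{5,4}+\tfrac14H_8+\tfrac32H_{5,5}$. **The algebra $A$.** Let $\mathbb Q[\bar\eta,\bar\xi]=\mathbb Q[\eta,\xi]/(\eta^2,\eta\xi,\xi^2)$, with $\mathbb Q$-basis $1,\bar\eta,\bar\xi$. $A$ consists of arrays $[a_{i,j}]_{i,j\in\{1,2,3,4\}}$ with $a_{i,j}\in A_{i,j}$, where $A_{1,1}=\mathbb Q^{3\times3}$, $A_{1,4}=\mathbb Q^{3\times1}$, $A_{4,1}=\mathbb Q^{1\times3}$, $A_{2,2}=A_{2,4}=A_{3,3}=A_{4,2}=\mathbb Q$, $A_{4,4}=\mathbb Q[\bar\eta,\bar\xi]$, and all other $A_{i,j}=0$. Addition is entrywise; the product of $[a_{i,j}]$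 and $[a'_{i,j}]$ has $(i,j)$ entry $\sum_r\alpha_{i,r,j}(a_{i,r},a'_{r,j})$, where the bilinear maps $\alpha_{i,j,k}:A_{i,j}\times A_{j,k}\to A_{i,k}$ are: zero whenever one of $A_{i,j},A_{j,k},A_{i,k}$ is zero; $\alpha_{1,4,1}=0$, $\alpha_{2,4,2}=0$; $\alpha_{4,1,4}(x,y)=(xy)\bar\eta$ (row times column); $\alpha_{4,2,4}(x,y)=xy(\bar\xi-12\bar\eta)$; $\alpha_{4,4,4}$ is multiplication in $\mathbb Q[\bar\eta,\bar\xi]$; in $\alpha_{1,4,4},\alpha_{2,4,4},\alpha_{4,4,1},\alpha_{4,4,2}$ an element $a+b\bar\eta+c\bar\xi\in A_{4,4}$ acts as multiplication by its constant term $a$; and $\alpha_{1,1,1},\alpha_{1,1,4},\alpha_{4,1,1},\alpha_{2,2,2},\alpha_{2,2,4},\alpha_{4,2,2},\alpha_{3,3,3}$ are the usual (matrix) products. Elements of $A$ are written as $6\times6$ arrays with block sizes $3,1,1,1$. $A_{\mathbb Z}\subseteq A$ is the subring of arrays all of whose entries lie in $\mathbb Z$, except that the $(6,6)$ entry lies in $\mathbb Z[\bar\eta,\bar\xi]=\mathbb Z+\mathbb Z\bar\eta+\mathbb Z\bar\xi$. **The isomorphism $\gamma$.** $\gamma:A\to\mathrm{B}_{\mathbb Q}(S_3,S_3)$ is the $\mathbb Q$-algebra isomorphism sending the element with blocks $(r_{i,j})\in A_{1,1}$, $(u_1,u_2,u_3)^{t}\in A_{1,4}$, $u_{22}\in A_{2,2}$,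 $u_{24}\in A_{2,4}$, $u_{33}\in A_{3,3}$, $(v_1,v_2,v_3)\in A_{4,1}$, $u_{42}\in A_{4,2}$, $a+b\bar\eta+c\bar\xi\in A_{4,4}$ to $r_{1,1}e+r_{1,2}b_{e,g}+r_{1,3}b_{e,h}+r_{2,1}b_{g,e}+r_{2,2}g+r_{2,3}b_{g,h}+r_{3,1}b_{h,e}+r_{3,2}b_{h,g}+r_{3,3}h+u_1b_{e,\varepsilon_4}+u_2b_{g,\varepsilon_4}+u_3b_{h,\varepsilon_4}+u_{22}\varepsilon_2+u_{24}b_{\varepsilon_2,\varepsilon_4}+u_{33}\varepsilon_3+v_1b_{\varepsilon_4,e}+v_2b_{\varepsilon_4,g}+v_3b_{\varepsilon_4,h}+u_{42}b_{\varepsilon_4,\varepsilon_2}+a\varepsilon_4+b\,b'_{\varepsilon_4,\varepsilon_4}+c\,b''_{\varepsilon_4,\varepsilon_4}.$ **The units.** In $6\times 6$ array notation, $$c_1=\begin{bmatrix}0&-2&0&0&0&0\\6&6&-4&0&0&0\\0&0&1&0&0&0\\0&0&0&1&0&0\\0&0&0&0&1&0\\0&0&0&0&0&1\end{bmatrix},\quad c_2=\begin{bmatrix}1&0&0&0&0&0\\0&1&0&0&0&0\\0&7&1&0&0&0\\0&0&0&1&0&0\\0&0&0&0&1&0\\0&0&0&0&0&1\end{bmatrix},\quad c_3=\begin{bmatrix}1&0&0&0&0&0\\0&1&0&0&0&0\\0&0&1&0&0&1\\0&0&0&1&0&0\\0&0&0&0&1&0\\0&0&6&0&0&1\end{bmatrix}.$$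 Inverses and products are taken in $A$. *)

theory Defs
  imports
    "HOL-Library.Poly_Mapping"
    "HOL-Algebra.Sym_Groups"
    "HOL-Algebra.QuotRing"
    "HOL-Algebra.Left_Coset"
    "HOL-Number_Theory.Cong"
    "Jordan_Normal_Form.Matrix"
begin

section \<open>Finite bisets\<close>

record ('g, 'x) biset =
  bcarrier :: "'x set"
  lact :: "'g \<Rightarrow> 'x \<Rightarrow> 'x"
  ract :: "'x \<Rightarrow> 'g \<Rightarrow> 'x"

definition is_biset :: "('g, 'm) monoid_scheme \<Rightarrow> ('g, 'x) biset \<Rightarrow> bool" where
  "is_biset G M \<longleftrightarrow>
     finite (bcarrier M) \<and>
     (\<forall>h\<in>carrier G. \<forall>m\<in>bcarrier M. lact M h m \<in> bcarrier M \<and> ract M m h \<in> bcarrier M) \<and>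
     (\<forall>m\<in>bcarrier M. lact M \<one>\<^bsub>G\<^esub> m = m \<and> ract M m \<one>\<^bsub>G\<^esub> = m) \<and>
     (\<forall>h\<in>carrier G. \<forall>k\<in>carrier G. \<forall>m\<in>bcarrier M.
        lact M h (lact M k m) = lact M (h \<otimes>\<^bsub>G\<^esub> k) m \<and>
        ract M (ract M m h) k = ract M m (h \<otimes>\<^bsub>G\<^esub> k) \<and>
        ract M (lact M h m) k = lact M h (ract M m k))"

definition biset_isomorphic ::
  "('g, 'm) monoid_scheme \<Rightarrow> ('g, 'x) biset \<Rightarrow> ('g, 'y) biset \<Rightarrow> bool" where
  "biset_isomorphic G M N \<longleftrightarrow>
     (\<exists>f. bij_betw f (bcarrier M) (bcarrier N) \<and>
          (\<forall>h\<in>carrier G. \<forall>m\<in>bcarrier M.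
             f (lact M h m) = lact N h (f m) \<and> f (ract M m h) = ract N (f m) h))"

definition regular_biset :: "('g, 'm) monoid_scheme \<Rightarrow> ('g, 'g) biset" where
  "regular_biset G = \<lparr>bcarrier = carrier G, lact = mult G, ract = mult G\<rparr>"

definition biset_sum :: "('g, 'x) biset \<Rightarrow> ('g, 'y) biset \<Rightarrow> ('g, 'x + 'y) biset" where
  "biset_sum M N =
     \<lparr>bcarrier = bcarrier M <+> bcarrier N,
      lact = (\<lambda>h. map_sum (lact M h) (lact N h)),
      ract = (\<lambda>x g. map_sum (\<lambda>m. ract M m g) (\<lambda>n. ract N n g) x)\<rparr>"

definition tensor_orbit ::
  "('g, 'm) monoid_scheme \<Rightarrow> ('g, 'x) biset \<Rightarrow> ('g, 'y) biset \<Rightarrow> 'x \<Rightarrow> 'y \<Rightarrow> ('x \<times> 'y) set" where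
  "tensor_orbit G M N m n = (\<lambda>g. (ract M m (inv\<^bsub>G\<^esub> g), lact N g n)) ` carrier G"

definition biset_tensor ::
  "('g, 'm) monoid_scheme \<Rightarrow> ('g, 'x) biset \<Rightarrow> ('g, 'y) biset \<Rightarrow> ('g, ('x \<times> 'y) set) biset" where
  "biset_tensor G M N =
     \<lparr>bcarrier = {tensor_orbit G M N m n | m n. m \<in> bcarrier M \<and> n \<in> bcarrier N},
      lact = (\<lambda>h. image (\<lambda>(m, n). (lact M h m, n))),
      ract = (\<lambda>X p. (\<lambda>(m, n). (m, ract N n p)) ` X)\<rparr>"

text \<open>A left \<open>G \<times> G\<close>-set \<open>Y\<close> as a biset: \<open>h y g = (h, g\<inverse>) y\<close>.\<close>

definition biset_of_left_set ::
  "('g, 'm) monoid_scheme \<Rightarrow> 'x set \<Rightarrow> ('g \<times> 'g \<Rightarrow> 'x \<Rightarrow> 'x) \<Rightarrow> ('g, 'x) biset" where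
  "biset_of_left_set G Y act =
     \<lparr>bcarrier = Y,
      lact = (\<lambda>h y. act (h, \<one>\<^bsub>G\<^esub>) y),
      ract = (\<lambda>y g. act (\<one>\<^bsub>G\<^esub>, inv\<^bsub>G\<^esub> g) y)\<rparr>"

definition coset_biset ::
  "('g, 'm) monoid_scheme \<Rightarrow> ('g \<times> 'g) set \<Rightarrow> ('g, ('g \<times> 'g) set) biset" where
  "coset_biset G U =
     biset_of_left_set G (lcosets\<^bsub>G \<times>\<times> G\<^esub> U) (\<lambda>p C. p <#\<^bsub>G \<times>\<times> G\<^esub> C)"


section \<open>The double Burnside algebra\<close>

text \<open>
  The isomorphism class of a finite biset over an arbitrary type is represented by the set of
  all isomorphic bisets on subsets of \<^typ>\<open>nat\<close>; as every finite biset has such a copy,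
  two finite bisets are isomorphic iff their classes coincide.
\<close>

type_synonym 'g bclass = "('g, nat) biset set"

definition bclass :: "('g, 'm) monoid_scheme \<Rightarrow> ('g, 'x) biset \<Rightarrow> 'g bclass" where
  "bclass G M = {N. is_biset G N \<and> biset_isomorphic G M N}"

definition bclasses :: "('g, 'm) monoid_scheme \<Rightarrow> 'g bclass set" where
  "bclasses G = {bclass G (M :: ('g, nat) biset) | M. is_biset G M}"

text \<open>For classes \<open>C, D\<close> all members of the union below yield the same class.\<close>

definition bclass_tensor :: "('g, 'm) monoid_scheme \<Rightarrow> 'g bclass \<Rightarrow> 'g bclass \<Rightarrow> 'g bclass" where
  "bclass_tensor G C D = (\<Union>M\<in>C. \<Union>N\<in>D. bclass G (biset_tensor G M N))"

definition basis_elt ::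
  "('g, 'm) monoid_scheme \<Rightarrow> ('g, 'x) biset \<Rightarrow> 'g bclass \<Rightarrow>\<^sub>0 'r::comm_ring_1" where
  "basis_elt G M = Poly_Mapping.single (bclass G M) 1"

definition pm_scale :: "'r::comm_ring_1 \<Rightarrow> ('k \<Rightarrow>\<^sub>0 'r) \<Rightarrow> 'k \<Rightarrow>\<^sub>0 'r" (infixr \<open>*\<^sub>b\<close> 75) where
  "r *\<^sub>b f = Poly_Mapping.map ((*) r) f"

text \<open>The free module on the isomorphism classes with the bilinear extension of the tensor product.\<close>

definition free_burnside :: "('g, 'm) monoid_scheme \<Rightarrow> ('g bclass \<Rightarrow>\<^sub>0 'r::comm_ring_1) ring" where
  "free_burnside G =
     \<lparr>carrier = {f. Poly_Mapping.keys f \<subseteq> bclasses G},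
      mult = (\<lambda>f f'. \<Sum>C\<in>Poly_Mapping.keys f. \<Sum>D\<in>Poly_Mapping.keys f'.
                Poly_Mapping.single (bclass_tensor G C D)
                  (Poly_Mapping.lookup f C * Poly_Mapping.lookup f' D)),
      one = basis_elt G (regular_biset G),
      zero = 0,
      add = (+)\<rparr>"

definition burnside_rel :: "('g, 'm) monoid_scheme \<Rightarrow> ('g bclass \<Rightarrow>\<^sub>0 'r::comm_ring_1) set" where
  "burnside_rel G =
     Modules.module.span (*\<^sub>b)
       {basis_elt G (biset_sum M N) - basis_elt G M - basis_elt G N
        | (M :: ('g, nat) biset) (N :: ('g, nat) biset). is_biset G M \<and> is_biset G N}"

definition burnside :: "('g, 'm) monoid_scheme \<Rightarrow> ('g bclass \<Rightarrow>\<^sub>0 'r::comm_ring_1) set ring" where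
  "burnside G = free_burnside G Quot burnside_rel G"

definition burnside_proj ::
  "('g, 'm) monoid_scheme \<Rightarrow> ('g bclass \<Rightarrow>\<^sub>0 'r::comm_ring_1) \<Rightarrow> ('g bclass \<Rightarrow>\<^sub>0 'r) set" where
  "burnside_proj G f = burnside_rel G +>\<^bsub>free_burnside G\<^esub> f"

text \<open>
  The embedding of the integral into the rational algebra, \<open>[M] \<mapsto> [M]\<close>. The union is over
  the representatives of a coset, which all yield the same coset.
\<close>

definition burnside_incl ::
  "('g, 'm) monoid_scheme \<Rightarrow> ('g bclass \<Rightarrow>\<^sub>0 int) set \<Rightarrow> ('g bclass \<Rightarrow>\<^sub>0 rat) set" where
  "burnside_incl G X = (\<Union>f\<in>X. burnside_proj G (Poly_Mapping.map rat_of_int f))"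


section \<open>Elements of the double Burnside algebra of the symmetric group\<close>

abbreviation S3 :: "(nat \<Rightarrow> nat) monoid" where
  "S3 \<equiv> sym_group 3"

type_synonym s3_class = "(nat \<Rightarrow> nat) bclass"

definition perm_a :: "nat \<Rightarrow> nat" where "perm_a = cycle_of_list [1, 2]"
definition perm_b :: "nat \<Rightarrow> nat" where "perm_b = cycle_of_list [1, 2, 3]"

definition V :: "nat \<Rightarrow> (nat \<Rightarrow> nat) set" where
  "V i = (if i = 0 then {id}
          else if i = 1 then generate S3 {perm_a}
          else if i = 4 then generate S3 {perm_b}
          else carrier S3)"

text \<open>
  All elements of the rational algebra are written as combinations of isomorphism
  classes in the free module; \<^const>\<open>burnside_proj\<close> then passes to the quotient.
\<close>

definition trans_elt :: "((nat \<Rightarrow> nat) \<times> (nat \<Rightarrow> nat)) set \<Rightarrow> s3_class \<Rightarrow>\<^sub>0 rat" where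
  "trans_elt U = basis_elt S3 (coset_biset S3 U)"

definition H :: "nat \<Rightarrow> nat \<Rightarrow> s3_class \<Rightarrow>\<^sub>0 rat" where
  "H i j = trans_elt (V i \<times> V j)"

definition H\<Delta> :: "nat \<Rightarrow> s3_class \<Rightarrow>\<^sub>0 rat" where
  "H\<Delta> t = trans_elt {(x, x) | x. x \<in> V t}"

definition H6 :: "s3_class \<Rightarrow>\<^sub>0 rat" where
  "H6 = trans_elt (generate (S3 \<times>\<times> S3) {(perm_a, perm_a), (id, perm_b)})"

definition H7 :: "s3_class \<Rightarrow>\<^sub>0 rat" where
  "H7 = trans_elt (generate (S3 \<times>\<times> S3) {(perm_a, perm_a), (perm_b, id)})"

definition H8 :: "s3_class \<Rightarrow>\<^sub>0 rat" where
  "H8 = trans_elt (generate (S3 \<times>\<times> S3) {(perm_a, perm_a), (perm_b, id), (id, perm_b)})"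

definition quad :: "rat \<Rightarrow> rat \<Rightarrow> rat \<Rightarrow> rat \<Rightarrow> nat \<Rightarrow> rat" where
  "quad x0 x1 x4 x5 = (\<lambda>_. 0)(0 := x0, 1 := x1, 4 := x4, 5 := x5)"

definition T :: "(nat \<Rightarrow> rat) \<Rightarrow> (nat \<Rightarrow> rat) \<Rightarrow> s3_class \<Rightarrow>\<^sub>0 rat" where
  "T x y = (\<Sum>i\<in>{0, 1, 4, 5}. \<Sum>j\<in>{0, 1, 4, 5}. (x i * y j) *\<^sub>b H i j)"

definition l\<^sub>e :: "nat \<Rightarrow> rat" where "l\<^sub>e = quad (-1/2) 1 (1/2) 0"
definition l\<^sub>g :: "nat \<Rightarrow> rat" where "l\<^sub>g = quad (-4/3) 2 1 0"
definition l\<^sub>h :: "nat \<Rightarrow> rat" where "l\<^sub>h = quad (-1/3) 0 1 0"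
definition l\<^sub>4 :: "nat \<Rightarrow> rat" where "l\<^sub>4 = quad (1/6) (-1/3) (-1/6) (1/3)"

definition f\<^sub>e :: "nat \<Rightarrow> rat" where "f\<^sub>e = quad 1 0 0 0"
definition f\<^sub>g :: "nat \<Rightarrow> rat" where "f\<^sub>g = quad (-1) 1 0 0"
definition f\<^sub>h :: "nat \<Rightarrow> rat" where "f\<^sub>h = quad (1/4) (-1) (3/4) 0"
definition f\<^sub>4 :: "nat \<Rightarrow> rat" where "f\<^sub>4 = quad (1/4) (-1/2) (-1/4) (1/2)"

definition \<epsilon>\<^sub>2 :: "s3_class \<Rightarrow>\<^sub>0 rat" where
  "\<epsilon>\<^sub>2 = - H 0 0 + H 1 0 + H 0 1 + H\<Delta> 1 - 2 *\<^sub>b H 1 1"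

definition \<epsilon>\<^sub>3 :: "s3_class \<Rightarrow>\<^sub>0 rat" where
  "\<epsilon>\<^sub>3 = - ((1/4) *\<^sub>b H 0 0) + (1/4) *\<^sub>b H 4 0 + (1/4) *\<^sub>b H 0 4
        + (1/2) *\<^sub>b H\<Delta> 4 - (3/4) *\<^sub>b H 4 4"

definition \<epsilon>\<^sub>4 :: "s3_class \<Rightarrow>\<^sub>0 rat" where
  "\<epsilon>\<^sub>4 = (1/2) *\<^sub>b H 0 0 - H\<Delta> 1 - (1/2) *\<^sub>b H\<Delta> 4 + H\<Delta> 5"

definition b_\<epsilon>2_\<epsilon>4 :: "s3_class \<Rightarrow>\<^sub>0 rat" where
  "b_\<epsilon>2_\<epsilon>4 = - ((1/2) *\<^sub>b H 0 0) + (1/2) *\<^sub>b H 1 0 + (1/2) *\<^sub>b H 0 1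
        + (1/2) *\<^sub>b H\<Delta> 1 + (1/2) *\<^sub>b H 0 4 - H 1 1 - (1/2) *\<^sub>b H 0 5
        - (1/2) *\<^sub>b H6 - (1/2) *\<^sub>b H 1 4 + H 1 5"

definition b_\<epsilon>4_\<epsilon>2 :: "s3_class \<Rightarrow>\<^sub>0 rat" where
  "b_\<epsilon>4_\<epsilon>2 = - ((1/2) *\<^sub>b H 0 0) + (1/2) *\<^sub>b H 1 0 + (1/2) *\<^sub>b H 0 1
        + (1/2) *\<^sub>b H\<Delta> 1 + (1/2) *\<^sub>b H 4 0 - H 1 1 - (1/2) *\<^sub>b H 5 0
        - (1/2) *\<^sub>b H 4 1 - (1/2) *\<^sub>b H7 + H 5 1"

definition b''_\<epsilon>4_\<epsilon>4 :: "s3_class \<Rightarrow>\<^sub>0 rat" where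
  "b''_\<epsilon>4_\<epsilon>4 = (1/4) *\<^sub>b H 0 0 - (3/4) *\<^sub>b H 1 0 - (3/4) *\<^sub>b H 0 1
        + (1/4) *\<^sub>b H\<Delta> 1 - (1/4) *\<^sub>b H 4 0 - (1/4) *\<^sub>b H 0 4 + (3/2) *\<^sub>b H 1 1
        + (3/4) *\<^sub>b H 5 0 + (3/4) *\<^sub>b H 0 5 - (1/4) *\<^sub>b H6
        + (3/4) *\<^sub>b H 4 1 + (3/4) *\<^sub>b H 1 4 - (1/4) *\<^sub>b H7 + (1/4) *\<^sub>b H 4 4
        - (3/2) *\<^sub>b H 1 5 - (3/2) *\<^sub>b H 5 1 - (3/4) *\<^sub>b H 4 5 - (3/4) *\<^sub>b H 5 4
        + (1/4) *\<^sub>b H8 + (3/2) *\<^sub>b H 5 5"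


section \<open>The ring \<open>\<rat>[\<eta>, \<xi>]/(\<eta>\<^sup>2, \<eta>\<xi>, \<xi>\<^sup>2)\<close>\<close>

text \<open>\<open>Qex a b c\<close> stands for \<open>a + b \<eta> + c \<xi>\<close>.\<close>

datatype qex = Qex (const_part: rat) (eta_part: rat) (xi_part: rat)

instantiation qex :: comm_ring_1
begin

definition zero_qex :: qex where "0 = Qex 0 0 0"

definition one_qex :: qex where "1 = Qex 1 0 0"

definition plus_qex :: "qex \<Rightarrow> qex \<Rightarrow> qex" where
  "x + y = Qex (const_part x + const_part y) (eta_part x + eta_part y) (xi_part x + xi_part y)"

definition minus_qex :: "qex \<Rightarrow> qex \<Rightarrow> qex" where
  "x - y = Qex (const_part x - const_part y) (eta_part x - eta_part y) (xi_part x - xi_part y)"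

definition uminus_qex :: "qex \<Rightarrow> qex" where
  "- x = Qex (- const_part x) (- eta_part x) (- xi_part x)"

definition times_qex :: "qex \<Rightarrow> qex \<Rightarrow> qex" where
  "x * y = Qex (const_part x * const_part y)
               (const_part x * eta_part y + eta_part x * const_part y)
               (const_part x * xi_part y + xi_part x * const_part y)"

instance
  by standard
    (simp_all add: zero_qex_def one_qex_def plus_qex_def minus_qex_def uminus_qex_def
      times_qex_def qex.expand algebra_simps)

end

definition rat_qex :: "rat \<Rightarrow> qex" where "rat_qex r = Qex r 0 0"
definition \<eta> :: qex where "\<eta> = Qex 0 1 0"
definition \<xi> :: qex where "\<xi> = Qex 0 0 1"

lemma eta_xi_relations: "\<eta> * \<eta> = 0" "\<eta> * \<xi> = 0" "\<xi> * \<xi> = 0"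
  by (simp_all add: \<eta>_def \<xi>_def times_qex_def zero_qex_def)

lemma Qex_eq: "Qex a b c = rat_qex a + rat_qex b * \<eta> + rat_qex c * \<xi>"
  by (simp add: rat_qex_def \<eta>_def \<xi>_def times_qex_def plus_qex_def)


section \<open>The algebra \<open>A\<close>\<close>

text \<open>
  Elements are \<open>6 \<times> 6\<close> matrices; \<open>block p\<close> is the block index in \<open>{1, 2, 3, 4}\<close> of the row or
  column \<open>p\<close>, counted from \<open>0\<close>. All entries are taken from \<^typ>\<open>qex\<close>, the
  membership condition \<open>A_entries\<close> cutting them down to rationals outside the last block.
\<close>

definition block :: "nat \<Rightarrow> nat" where
  "block p = (if p < 3 then 1 else p - 1)"

definition A_support :: "(nat \<times> nat) set" where
  "A_support = {(1,1), (1,4), (2,2), (2,4), (3,3), (4,1), (4,2), (4,4)}"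

definition A_entries :: "nat \<Rightarrow> nat \<Rightarrow> qex set" where
  "A_entries i j = (if (i, j) = (4, 4) then UNIV
                    else if (i, j) \<in> A_support then {rat_qex r | r. True}
                    else {0})"

text \<open>
  The map \<open>\<alpha>\<^sub>i\<^sub>j\<^sub>k\<close> on single entries; for blocks that are vectors or matrices the bilinear map is
  the sum of these contributions over the inner index, as formed in \<open>A_mult\<close>.
\<close>

definition \<alpha> :: "nat \<Rightarrow> nat \<Rightarrow> nat \<Rightarrow> qex \<Rightarrow> qex \<Rightarrow> qex" where
  "\<alpha> i j k x y =
     (if (i, j) \<notin> A_support \<or> (j, k) \<notin> A_support \<or> (i, k) \<notin> A_support then 0
      else if (i, j, k) \<in> {(1,4,1), (2,4,2)} then 0
      else if (i, j, k) = (4,1,4) then (x * y) * \<eta>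
      else if (i, j, k) = (4,2,4) then (x * y) * (\<xi> - 12 * \<eta>)
      else if (i, j, k) \<in> {(1,4,4), (2,4,4)} then x * rat_qex (const_part y)
      else if (i, j, k) \<in> {(4,4,1), (4,4,2)} then rat_qex (const_part x) * y
      else x * y)"

definition A_mult :: "qex mat \<Rightarrow> qex mat \<Rightarrow> qex mat" where
  "A_mult X Y =
     mat 6 6 (\<lambda>(p, q). \<Sum>r<6. \<alpha> (block p) (block r) (block q) (X $$ (p, r)) (Y $$ (r, q)))"

definition A :: "qex mat ring" where
  "A = \<lparr>carrier = {X \<in> carrier_mat 6 6. \<forall>p<6. \<forall>q<6. X $$ (p, q) \<in> A_entries (block p) (block q)},
        mult = A_mult,
        one = 1\<^sub>m 6,
        zero = 0\<^sub>m 6 6,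
        add = (+)\<rparr>"

definition A\<^sub>Z :: "qex mat set" where
  "A\<^sub>Z = {X \<in> carrier A. \<forall>p<6. \<forall>q<6.
           X $$ (p, q) \<in> (if (p, q) = (5, 5)
                          then {of_int a + of_int b * \<eta> + of_int c * \<xi> | a b c. True}
                          else {of_int a | a. True})}"


section \<open>The maps \<open>\<gamma>\<close> and \<open>\<delta>\<close>\<close>

definition \<gamma> :: "qex mat \<Rightarrow> (s3_class \<Rightarrow>\<^sub>0 rat) set" where
  "\<gamma> X = (let r = (\<lambda>i j. const_part (X $$ (i - 1, j - 1))) in
     burnside_proj S3
       (r 1 1 *\<^sub>b T l\<^sub>e f\<^sub>e + r 1 2 *\<^sub>b T l\<^sub>e f\<^sub>g + r 1 3 *\<^sub>b T l\<^sub>e f\<^sub>h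
      + r 2 1 *\<^sub>b T l\<^sub>g f\<^sub>e + r 2 2 *\<^sub>b T l\<^sub>g f\<^sub>g + r 2 3 *\<^sub>b T l\<^sub>g f\<^sub>h
      + r 3 1 *\<^sub>b T l\<^sub>h f\<^sub>e + r 3 2 *\<^sub>b T l\<^sub>h f\<^sub>g + r 3 3 *\<^sub>b T l\<^sub>h f\<^sub>h
      + r 1 6 *\<^sub>b T l\<^sub>e f\<^sub>4 + r 2 6 *\<^sub>b T l\<^sub>g f\<^sub>4 + r 3 6 *\<^sub>b T l\<^sub>h f\<^sub>4
      + r 4 4 *\<^sub>b \<epsilon>\<^sub>2 + r 4 6 *\<^sub>b b_\<epsilon>2_\<epsilon>4 + r 5 5 *\<^sub>b \<epsilon>\<^sub>3
      + r 6 1 *\<^sub>b T l\<^sub>4 f\<^sub>e + r 6 2 *\<^sub>b T l\<^sub>4 f\<^sub>g + r 6 3 *\<^sub>b T l\<^sub>4 f\<^sub>h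
      + r 6 4 *\<^sub>b b_\<epsilon>4_\<epsilon>2
      + r 6 6 *\<^sub>b \<epsilon>\<^sub>4
      + eta_part (X $$ (5, 5)) *\<^sub>b T l\<^sub>4 f\<^sub>4
      + xi_part (X $$ (5, 5)) *\<^sub>b b''_\<epsilon>4_\<epsilon>4))"

definition c\<^sub>1 :: "qex mat" where
  "c\<^sub>1 = mat_of_rows_list 6
    [[0, -2,  0, 0, 0, 0],
     [6,  6, -4, 0, 0, 0],
     [0,  0,  1, 0, 0, 0],
     [0,  0,  0, 1, 0, 0],
     [0,  0,  0, 0, 1, 0],
     [0,  0,  0, 0, 0, 1]]"

definition c\<^sub>2 :: "qex mat" where
  "c\<^sub>2 = mat_of_rows_list 6
    [[1, 0, 0, 0, 0, 0],
     [0, 1, 0, 0, 0, 0],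
     [0, 7, 1, 0, 0, 0],
     [0, 0, 0, 1, 0, 0],
     [0, 0, 0, 0, 1, 0],
     [0, 0, 0, 0, 0, 1]]"

definition c\<^sub>3 :: "qex mat" where
  "c\<^sub>3 = mat_of_rows_list 6
    [[1, 0, 0, 0, 0, 0],
     [0, 1, 0, 0, 0, 0],
     [0, 0, 1, 0, 0, 1],
     [0, 0, 0, 1, 0, 0],
     [0, 0, 0, 0, 1, 0],
     [0, 0, 6, 0, 0, 1]]"

definition B\<^sub>Z :: "(s3_class \<Rightarrow>\<^sub>0 int) set ring" where
  "B\<^sub>Z = burnside S3"

definition \<delta> :: "(s3_class \<Rightarrow>\<^sub>0 int) set \<Rightarrow> qex mat" where
  "\<delta> y = inv\<^bsub>A\<^esub> c\<^sub>3 \<otimes>\<^bsub>A\<^esub> inv\<^bsub>A\<^esub> c\<^sub>2 \<otimes>\<^bsub>A\<^esub> inv\<^bsub>A\<^esub> c\<^sub>1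
          \<otimes>\<^bsub>A\<^esub> inv_into (carrier A) \<gamma> (burnside_incl S3 y)
          \<otimes>\<^bsub>A\<^esub> c\<^sub>1 \<otimes>\<^bsub>A\<^esub> c\<^sub>2 \<otimes>\<^bsub>A\<^esub> c\<^sub>3"

definition \<Lambda> :: "qex mat set" where
  "\<Lambda> = \<delta> ` carrier B\<^sub>Z"

end

theory Submission
  imports Defs
begin

text \<open>That \<open>\<gamma>\<close> respects products is nowhere assumed: of
  \<open>\<gamma>\<close> only bijectivity is derived, from the explicit inverse
  \<open>dcoord\<close>. Multiplicativity is proved for \<open>\<delta>\<close> itself, in the
  coordinates \<open>ecoord\<close>, where the fractions coming from \<open>\<gamma>\<close> and
  from the inverse units have cancelled. Weighting a point by the order of its stabilizer gives
  every orbit the same total |G|^2. Orbits can therefore be counted by sums over all points and all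
  group elements, without transversals. Type counts are functionals on the free module that vanish
  on the relations and are dual to the 22 representatives, so equality in the quotient is decided by
  22 numbers, over the integers as over the rationals. The final integral matrix is not unimodular.
  The congruences say which quotients of the entries are integers, and in terms of these quotients
  the inverse becomes integral.\<close>

text \<open>
  The point stabilizers of a biset are subgroups of \<open>G \<times> G\<close>, read as relations on \<open>G\<close>. The
  stabilizer of \<open>[m, n]\<close> in \<open>M \<times>\<^sub>G N\<close> is the relational composition of those of \<open>m\<close> and
  \<open>n\<close>, and the orbit forming \<open>[m, n]\<close> has \<open>|G| / |k\<^sub>2 \<inter> k\<^sub>1|\<close> elements; so the weighted
  stabilizer counts of a tensor product are given by a Mackey-type sum over subgroups.

  For \<open>S\<^sub>3\<close>, a subgroup of \<open>S\<^sub>3 \<times> S\<^sub>3\<close> is determined up to conjugacy by three orders, which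
  gives 22 classes. The counts of orbits of each type are the coordinates of the double Burnside
  algebra, and \<open>\<delta>\<close> is linear in them. As \<open>A\<close> is a ring and the double Burnside algebra is
  generated by \<open>H\<^sub>5\<^sub>5\<close>, \<open>H\<^sup>\<Delta>\<^sub>4\<close>, \<open>H\<^sub>6\<close>, \<open>H\<^sub>7\<close>, multiplicativity of \<open>\<delta>\<close> only has to be
  checked for left multiplication by these four elements. The image is then found by inverting
  an integral matrix.
\<close>

section \<open>Bisets and their tensor products\<close>

lemma biset_isomorphicI:
  assumes "bij_betw f (bcarrier M) (bcarrier N)"
    and "\<And>h m. h \<in> carrier G \<Longrightarrow> m \<in> bcarrier M \<Longrightarrow> f (lact M h m) = lact N h (f m)"
    and "\<And>h m. h \<in> carrier G \<Longrightarrow> m \<in> bcarrier M \<Longrightarrow> f (ract M m h) = ract N (f m) h"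
  shows "biset_isomorphic G M N"
  using assms unfolding biset_isomorphic_def by blast

lemma biset_isomorphic_trans:
  assumes "biset_isomorphic G M N" "biset_isomorphic G N P"
  shows "biset_isomorphic G M P"
proof -
  obtain f where f: "bij_betw f (bcarrier M) (bcarrier N)"
    "\<forall>h\<in>carrier G. \<forall>m\<in>bcarrier M. f (lact M h m) = lact N h (f m) \<and> f (ract M m h) = ract N (f m) h"
    using assms(1) unfolding biset_isomorphic_def by blast
  obtain g where g: "bij_betw g (bcarrier N) (bcarrier P)"
    "\<forall>h\<in>carrier G. \<forall>m\<in>bcarrier N. g (lact N h m) = lact P h (g m) \<and> g (ract N m h) = ract P (g m) h"
    using assms(2) unfolding biset_isomorphic_def by blast
  have "f m \<in> bcarrier N" if "m \<in> bcarrier M" for m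
    using f(1) that bij_betwE by blast
  then show ?thesis
    by (intro biset_isomorphicI[of "g \<circ> f"] bij_betw_trans[OF f(1) g(1)]) (use f(2) g(2) in auto)
qed

lemma is_bisetD:
  assumes "is_biset G M"
  shows "finite (bcarrier M)"
    and "h \<in> carrier G \<Longrightarrow> m \<in> bcarrier M \<Longrightarrow> lact M h m \<in> bcarrier M"
    and "h \<in> carrier G \<Longrightarrow> m \<in> bcarrier M \<Longrightarrow> ract M m h \<in> bcarrier M"
    and "m \<in> bcarrier M \<Longrightarrow> lact M \<one>\<^bsub>G\<^esub> m = m"
    and "m \<in> bcarrier M \<Longrightarrow> ract M m \<one>\<^bsub>G\<^esub> = m"
    and "h \<in> carrier G \<Longrightarrow> k \<in> carrier G \<Longrightarrow> m \<in> bcarrier M \<Longrightarrow> lact M h (lact M k m) = lact M (h \<otimes>\<^bsub>G\<^esub> k) m"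
    and "h \<in> carrier G \<Longrightarrow> k \<in> carrier G \<Longrightarrow> m \<in> bcarrier M \<Longrightarrow> ract M (ract M m h) k = ract M m (h \<otimes>\<^bsub>G\<^esub> k)"
    and "h \<in> carrier G \<Longrightarrow> k \<in> carrier G \<Longrightarrow> m \<in> bcarrier M \<Longrightarrow> ract M (lact M h m) k = lact M h (ract M m k)"
  using assms unfolding is_biset_def by blast+

lemma is_bisetI:
  assumes "finite (bcarrier M)"
    and "\<And>h m. h \<in> carrier G \<Longrightarrow> m \<in> bcarrier M \<Longrightarrow> lact M h m \<in> bcarrier M"
    and "\<And>h m. h \<in> carrier G \<Longrightarrow> m \<in> bcarrier M \<Longrightarrow> ract M m h \<in> bcarrier M"
    and "\<And>m. m \<in> bcarrier M \<Longrightarrow> lact M \<one>\<^bsub>G\<^esub> m = m"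
    and "\<And>m. m \<in> bcarrier M \<Longrightarrow> ract M m \<one>\<^bsub>G\<^esub> = m"
    and "\<And>h k m. h \<in> carrier G \<Longrightarrow> k \<in> carrier G \<Longrightarrow> m \<in> bcarrier M \<Longrightarrow> lact M h (lact M k m) = lact M (h \<otimes>\<^bsub>G\<^esub> k) m"
    and "\<And>h k m. h \<in> carrier G \<Longrightarrow> k \<in> carrier G \<Longrightarrow> m \<in> bcarrier M \<Longrightarrow> ract M (ract M m h) k = ract M m (h \<otimes>\<^bsub>G\<^esub> k)"
    and "\<And>h k m. h \<in> carrier G \<Longrightarrow> k \<in> carrier G \<Longrightarrow> m \<in> bcarrier M \<Longrightarrow> ract M (lact M h m) k = lact M h (ract M m k)"
  shows "is_biset G M"
  by (simp add: is_biset_def assms)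

lemma biset_isomorphic_sym:
  assumes M: "is_biset G M" and "biset_isomorphic G M N"
  shows "biset_isomorphic G N M"
proof -
  obtain f where f: "bij_betw f (bcarrier M) (bcarrier N)"
    "\<And>h m. h \<in> carrier G \<Longrightarrow> m \<in> bcarrier M \<Longrightarrow> f (lact M h m) = lact N h (f m)"
    "\<And>h m. h \<in> carrier G \<Longrightarrow> m \<in> bcarrier M \<Longrightarrow> f (ract M m h) = ract N (f m) h"
    using assms(2) unfolding biset_isomorphic_def by blast
  define g where "g = inv_into (bcarrier M) f"
  have g: "bij_betw g (bcarrier N) (bcarrier M)"
    unfolding g_def by (rule bij_betw_inv_into[OF f(1)])
  have fg: "f (g n) = n" "g n \<in> bcarrier M" if "n \<in> bcarrier N" for n
    using that f(1) g bij_betwE unfolding g_def by (auto simp: bij_betw_inv_into_right)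
  have gf: "g (f m) = m" if "m \<in> bcarrier M" for m
    using that f(1) unfolding g_def by (simp add: bij_betw_inv_into_left)
  show ?thesis
  proof (rule biset_isomorphicI[OF g])
    fix h n assume h: "h \<in> carrier G" and n: "n \<in> bcarrier N"
    have "lact N h n = f (lact M h (g n))" "ract N n h = f (ract M (g n) h)"
      using f h fg[OF n] by auto
    then show "g (lact N h n) = lact M h (g n)" "g (ract N n h) = ract M (g n) h"
      using gf is_bisetD(2,3)[OF M h fg(2)[OF n]] by auto
  qed
qed

text \<open>Classes and relations are built from bisets on \<open>nat\<close> only; cosets, orbits
  and disjoint sums enter through such a copy, obtained by numbering the points.\<close>

lemma ex_nat_biset:
  assumes M: "is_biset G M"
  obtains N :: "('g, nat) biset" where "is_biset G N" "biset_isomorphic G M N"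
proof -
  obtain f :: "_ \<Rightarrow> nat" where f: "bij_betw f (bcarrier M) {0..<card (bcarrier M)}"
    using ex_bij_betw_finite_nat[OF is_bisetD(1)[OF M]] by blast
  define g where "g = inv_into (bcarrier M) f"
  define N :: "('g, nat) biset" where
    "N = \<lparr>bcarrier = f ` bcarrier M, lact = (\<lambda>h x. f (lact M h (g x))), ract = (\<lambda>x h. f (ract M (g x) h))\<rparr>"
  have gf: "g (f m) = m" if "m \<in> bcarrier M" for m
    using that f unfolding g_def by (simp add: bij_betw_inv_into_left)
  show ?thesis
  proof
    show "is_biset G N"
      by (rule is_bisetI) (auto simp: N_def gf is_bisetD[OF M])
    show "biset_isomorphic G M N"
    proof (rule biset_isomorphicI[of f])
      show "bij_betw f (bcarrier M) (bcarrier N)"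
        using f by (simp add: N_def bij_betw_def)
    qed (simp_all add: N_def gf)
  qed
qed

lemma bclass_eqI:
  assumes "is_biset G M" "biset_isomorphic G M N"
  shows "bclass G M = bclass G N"
proof -
  have "biset_isomorphic G M P \<longleftrightarrow> biset_isomorphic G N P" for P :: "('a, nat) biset"
    using biset_isomorphic_trans[OF assms(2)] biset_isomorphic_trans[OF biset_isomorphic_sym[OF assms]] by metis
  then show ?thesis
    by (simp add: bclass_def)
qed

lemma bclass_nonempty:
  fixes M :: "('g, 'x) biset"
  assumes "is_biset G M"
  obtains N :: "('g, nat) biset" where "N \<in> bclass G M" "is_biset G N" "biset_isomorphic G M N" "bclass G N = bclass G M"
proof -
  obtain N :: "('g, nat) biset" where N: "is_biset G N" "biset_isomorphic G M N"
    using ex_nat_biset[OF assms] by blast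
  show ?thesis
    by (rule that[of N]) (use N bclass_eqI[OF assms N(2)] in \<open>auto simp: bclass_def\<close>)
qed

lemma bclass_in_bclasses:
  fixes M :: "('g, 'x) biset"
  assumes "is_biset G M"
  shows "bclass G M \<in> bclasses G"
proof -
  obtain N :: "('g, nat) biset" where "is_biset G N" "bclass G N = bclass G M"
    using bclass_nonempty[OF assms] by metis
  then show ?thesis
    unfolding bclasses_def by force
qed

lemma bclassesE:
  assumes "C \<in> bclasses G"
  obtains M :: "('g, nat) biset" where "is_biset G M" "C = bclass G M"
  using assms unfolding bclasses_def by blast

lemma is_biset_sum:
  assumes "is_biset G M" "is_biset G N"
  shows "is_biset G (biset_sum M N)"
  by (rule is_bisetI) (auto simp: biset_sum_def is_bisetD[OF assms(1)] is_bisetD[OF assms(2)])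

lemma biset_sum_cong:
  assumes "biset_isomorphic G M M'" "biset_isomorphic G N N'"
  shows "biset_isomorphic G (biset_sum M N) (biset_sum M' N')"
proof -
  obtain f where f: "bij_betw f (bcarrier M) (bcarrier M')"
    "\<forall>h\<in>carrier G. \<forall>m\<in>bcarrier M. f (lact M h m) = lact M' h (f m) \<and> f (ract M m h) = ract M' (f m) h"
    using assms(1) unfolding biset_isomorphic_def by blast
  obtain g where g: "bij_betw g (bcarrier N) (bcarrier N')"
    "\<forall>h\<in>carrier G. \<forall>m\<in>bcarrier N. g (lact N h m) = lact N' h (g m) \<and> g (ract N m h) = ract N' (g m) h"
    using assms(2) unfolding biset_isomorphic_def by blast
  have "bij_betw (map_sum f g) (bcarrier M <+> bcarrier N) (bcarrier M' <+> bcarrier N')"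
  proof (rule bij_betw_imageI)
    show "inj_on (map_sum f g) (bcarrier M <+> bcarrier N)"
      using f(1) g(1) by (force simp: bij_betw_def inj_on_def elim!: PlusE)
    show "map_sum f g ` (bcarrier M <+> bcarrier N) = bcarrier M' <+> bcarrier N'"
      unfolding bij_betw_imp_surj_on[OF f(1), symmetric] bij_betw_imp_surj_on[OF g(1), symmetric]
      by (simp add: Plus_def image_Un image_image)
  qed
  then show ?thesis
    by (intro biset_isomorphicI[of "map_sum f g"]) (use f(2) g(2) in \<open>auto simp: biset_sum_def\<close>)
qed

section \<open>Tensor products over a finite group\<close>

locale fin_group = group G for G (structure) +
  assumes finite_carrier: "finite (carrier G)"
begin

lemma tensor_orbit_eq:
  assumes M: "is_biset G M" and N: "is_biset G N"
    and "m \<in> bcarrier M" "n \<in> bcarrier N" "g \<in> carrier G"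
  shows "tensor_orbit G M N (ract M m g) n = tensor_orbit G M N m (lact N g n)"
proof -
  have "(\<lambda>x. (ract M (ract M m g) (inv x), lact N x n)) ` carrier G
      = (\<lambda>x. (ract M m (inv x), lact N x (lact N g n))) ` carrier G" (is "?l ` _ = ?r ` _")
  proof (intro equalityI image_subsetI)
    fix x assume x: "x \<in> carrier G"
    have "?l x = ?r (x \<otimes> inv g)"
      using assms x by (simp add: is_bisetD[OF M] is_bisetD[OF N] inv_mult_group m_assoc)
    then show "?l x \<in> ?r ` carrier G" using x assms by blast
    have "?r x = ?l (x \<otimes> g)"
      using assms x by (simp add: is_bisetD[OF M] is_bisetD[OF N] inv_mult_group m_assoc[symmetric])
    then show "?r x \<in> ?l ` carrier G" using x assms by blast
  qed
  then show ?thesis by (simp add: tensor_orbit_def)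
qed

lemma tensor_orbit_self:
  assumes "is_biset G M" "is_biset G N" "m \<in> bcarrier M" "n \<in> bcarrier N"
  shows "(m, n) \<in> tensor_orbit G M N m n"
  unfolding tensor_orbit_def
  by (rule image_eqI[of _ _ \<one>]) (use assms in \<open>auto simp: is_bisetD[OF assms(1)] is_bisetD[OF assms(2)]\<close>)

lemma tensor_orbit_eq_iff:
  assumes M: "is_biset G M" and N: "is_biset G N"
    and "m \<in> bcarrier M" "n \<in> bcarrier N" "m' \<in> bcarrier M" "n' \<in> bcarrier N"
  shows "tensor_orbit G M N m n = tensor_orbit G M N m' n' \<longleftrightarrow>
    (\<exists>g\<in>carrier G. m = ract M m' g \<and> n' = lact N g n)"
proof
  assume "tensor_orbit G M N m n = tensor_orbit G M N m' n'"
  then have "(m, n) \<in> tensor_orbit G M N m' n'"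
    using tensor_orbit_self[OF M N] assms by blast
  then obtain g where g: "g \<in> carrier G" "m = ract M m' (inv g)" "n = lact N g n'"
    by (auto simp: tensor_orbit_def)
  have "n' = lact N (inv g) n"
    using g assms by (simp add: is_bisetD[OF N])
  then show "\<exists>g\<in>carrier G. m = ract M m' g \<and> n' = lact N g n"
    using g by blast
next
  assume "\<exists>g\<in>carrier G. m = ract M m' g \<and> n' = lact N g n"
  then show "tensor_orbit G M N m n = tensor_orbit G M N m' n'"
    using tensor_orbit_eq[OF M N] assms by blast
qed

lemma carrier_tensor:
  "bcarrier (biset_tensor G M N) = {tensor_orbit G M N m n | m n. m \<in> bcarrier M \<and> n \<in> bcarrier N}"
  by (simp add: biset_tensor_def)

lemma lact_tensor:
  assumes M: "is_biset G M" and N: "is_biset G N" and "m \<in> bcarrier M" "n \<in> bcarrier N" "h \<in> carrier G"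
  shows "lact (biset_tensor G M N) h (tensor_orbit G M N m n) = tensor_orbit G M N (lact M h m) n"
  using assms unfolding biset_tensor_def tensor_orbit_def
  by (auto simp: image_image is_bisetD[OF M] is_bisetD[OF N])

lemma ract_tensor:
  assumes M: "is_biset G M" and N: "is_biset G N" and "m \<in> bcarrier M" "n \<in> bcarrier N" "h \<in> carrier G"
  shows "ract (biset_tensor G M N) (tensor_orbit G M N m n) h = tensor_orbit G M N m (ract N n h)"
  using assms unfolding biset_tensor_def tensor_orbit_def
  by (auto simp: image_image is_bisetD[OF M] is_bisetD[OF N])

lemma is_biset_tensor:
  assumes M: "is_biset G M" and N: "is_biset G N"
  shows "is_biset G (biset_tensor G M N)"
proof -
  have "bcarrier (biset_tensor G M N) = (\<lambda>(m, n). tensor_orbit G M N m n) ` (bcarrier M \<times> bcarrier N)"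
    by (auto simp: carrier_tensor)
  then have fin: "finite (bcarrier (biset_tensor G M N))"
    using is_bisetD(1)[OF M] is_bisetD(1)[OF N] by simp
  have I: "tensor_orbit G M N m n \<in> bcarrier (biset_tensor G M N)" if "m \<in> bcarrier M" "n \<in> bcarrier N" for m n
    using that by (auto simp: carrier_tensor)
  have E: thesis if "X \<in> bcarrier (biset_tensor G M N)"
    "\<And>m n. m \<in> bcarrier M \<Longrightarrow> n \<in> bcarrier N \<Longrightarrow> X = tensor_orbit G M N m n \<Longrightarrow> thesis" for X thesis
    using that by (auto simp: carrier_tensor)
  show ?thesis
    by (rule is_bisetI[OF fin]; erule E)
      (simp_all add: I lact_tensor[OF M N] ract_tensor[OF M N] is_bisetD[OF M] is_bisetD[OF N])
qed

text \<open>The universal property in a form that serves all isomorphisms out of a tensor product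
  below: a balanced map in two variables, equivariant on both sides, onto, and separating
  orbits.\<close>

lemma tensor_isomorphicI:
  fixes \<phi> :: "'x \<Rightarrow> 'y \<Rightarrow> 'z"
  assumes M: "is_biset G M" and N: "is_biset G N"
    and bal: "\<And>m n g. m \<in> bcarrier M \<Longrightarrow> n \<in> bcarrier N \<Longrightarrow> g \<in> carrier G \<Longrightarrow> \<phi> (ract M m g) n = \<phi> m (lact N g n)"
    and sep: "\<And>m n m' n'. m \<in> bcarrier M \<Longrightarrow> n \<in> bcarrier N \<Longrightarrow> m' \<in> bcarrier M \<Longrightarrow> n' \<in> bcarrier N \<Longrightarrow>
        \<phi> m n = \<phi> m' n' \<Longrightarrow> tensor_orbit G M N m n = tensor_orbit G M N m' n'"
    and surj: "(\<Union>m\<in>bcarrier M. \<phi> m ` bcarrier N) = bcarrier P"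
    and l: "\<And>m n h. m \<in> bcarrier M \<Longrightarrow> n \<in> bcarrier N \<Longrightarrow> h \<in> carrier G \<Longrightarrow> \<phi> (lact M h m) n = lact P h (\<phi> m n)"
    and r: "\<And>m n h. m \<in> bcarrier M \<Longrightarrow> n \<in> bcarrier N \<Longrightarrow> h \<in> carrier G \<Longrightarrow> \<phi> m (ract N n h) = ract P (\<phi> m n) h"
  shows "biset_isomorphic G (biset_tensor G M N) P"
proof -
  \<comment> \<open>An orbit is evaluated at an arbitrary member; \<open>bal\<close> makes the
    choice immaterial.\<close>
  define F where "F X = (let p = (SOME p. p \<in> X) in \<phi> (fst p) (snd p))" for X
  have F: "F (tensor_orbit G M N m n) = \<phi> m n" if "m \<in> bcarrier M" "n \<in> bcarrier N" for m n
  proof -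
    define p where "p = (SOME p. p \<in> tensor_orbit G M N m n)"
    have "p \<in> tensor_orbit G M N m n"
      unfolding p_def by (rule someI) (rule tensor_orbit_self[OF M N that])
    then obtain g where g: "g \<in> carrier G" "p = (ract M m (inv g), lact N g n)"
      by (auto simp: tensor_orbit_def)
    then have "\<phi> (fst p) (snd p) = \<phi> m n"
      using that by (simp add: bal is_bisetD[OF N])
    then show ?thesis by (simp add: F_def p_def Let_def)
  qed
  show ?thesis
  proof (rule biset_isomorphicI[of F])
    show "bij_betw F (bcarrier (biset_tensor G M N)) (bcarrier P)"
    proof (rule bij_betw_imageI)
      show "inj_on F (bcarrier (biset_tensor G M N))"
      proof (rule inj_onI)
        fix X Y assume "X \<in> bcarrier (biset_tensor G M N)" "Y \<in> bcarrier (biset_tensor G M N)" and eq: "F X = F Y"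
        then obtain m n m' n' where X: "X = tensor_orbit G M N m n" "Y = tensor_orbit G M N m' n'"
          and mn: "m \<in> bcarrier M" "n \<in> bcarrier N" "m' \<in> bcarrier M" "n' \<in> bcarrier N"
          unfolding carrier_tensor by blast
        show "X = Y"
          using sep[OF mn] eq mn by (simp add: X F)
      qed
      have "F ` bcarrier (biset_tensor G M N) = (\<Union>m\<in>bcarrier M. \<phi> m ` bcarrier N)"
      proof (intro equalityI subsetI)
        fix y assume "y \<in> F ` bcarrier (biset_tensor G M N)"
        then show "y \<in> (\<Union>m\<in>bcarrier M. \<phi> m ` bcarrier N)"
          unfolding carrier_tensor using F by fastforce
      next
        fix y assume "y \<in> (\<Union>m\<in>bcarrier M. \<phi> m ` bcarrier N)"
        then obtain m n where "m \<in> bcarrier M" "n \<in> bcarrier N" "y = F (tensor_orbit G M N m n)"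
          by (auto simp: F)
        then show "y \<in> F ` bcarrier (biset_tensor G M N)"
          by (auto simp: carrier_tensor)
      qed
      then show "F ` bcarrier (biset_tensor G M N) = bcarrier P"
        using surj by simp
    qed
  qed (auto simp: carrier_tensor lact_tensor[OF M N] ract_tensor[OF M N] F is_bisetD[OF M] is_bisetD[OF N] l r)
qed

lemma biset_tensor_cong:
  assumes M: "is_biset G M" and N: "is_biset G N" and M': "is_biset G M'" and N': "is_biset G N'"
    and "biset_isomorphic G M M'" "biset_isomorphic G N N'"
  shows "biset_isomorphic G (biset_tensor G M N) (biset_tensor G M' N')"
proof -
  obtain f where f: "bij_betw f (bcarrier M) (bcarrier M')"
    "\<And>h m. h\<in>carrier G \<Longrightarrow> m\<in>bcarrier M \<Longrightarrow> f (lact M h m) = lact M' h (f m)"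
    "\<And>h m. h\<in>carrier G \<Longrightarrow> m\<in>bcarrier M \<Longrightarrow> f (ract M m h) = ract M' (f m) h"
    using assms(5) unfolding biset_isomorphic_def by blast
  obtain g where g: "bij_betw g (bcarrier N) (bcarrier N')"
    "\<And>h m. h\<in>carrier G \<Longrightarrow> m\<in>bcarrier N \<Longrightarrow> g (lact N h m) = lact N' h (g m)"
    "\<And>h m. h\<in>carrier G \<Longrightarrow> m\<in>bcarrier N \<Longrightarrow> g (ract N m h) = ract N' (g m) h"
    using assms(6) unfolding biset_isomorphic_def by blast
  have fc: "f m \<in> bcarrier M'" if "m \<in> bcarrier M" for m using that f(1) bij_betwE by blast
  have gc: "g m \<in> bcarrier N'" if "m \<in> bcarrier N" for m using that g(1) bij_betwE by blast
  show ?thesis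
  proof (rule tensor_isomorphicI[OF M N, of "\<lambda>m n. tensor_orbit G M' N' (f m) (g n)"])
    fix m n m' n' assume mn: "m \<in> bcarrier M" "n \<in> bcarrier N" "m' \<in> bcarrier M" "n' \<in> bcarrier N"
      and "tensor_orbit G M' N' (f m) (g n) = tensor_orbit G M' N' (f m') (g n')"
    then obtain x where x: "x \<in> carrier G" "f m = ract M' (f m') x" "g n' = lact N' x (g n)"
      using tensor_orbit_eq_iff[OF M' N' fc[OF mn(1)] gc[OF mn(2)] fc[OF mn(3)] gc[OF mn(4)]] by metis
    then have "f m = f (ract M m' x)" "g n' = g (lact N x n)"
      using mn f g by auto
    then have "m = ract M m' x" "n' = lact N x n"
      using f(1) g(1) mn x is_bisetD(3)[OF M] is_bisetD(2)[OF N] by (auto simp: bij_betw_def inj_on_def)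
    then show "tensor_orbit G M N m n = tensor_orbit G M N m' n'"
      using tensor_orbit_eq_iff[OF M N mn(1,2,3,4)] x(1) by blast
  next
    show "(\<Union>m\<in>bcarrier M. (\<lambda>n. tensor_orbit G M' N' (f m) (g n)) ` bcarrier N) = bcarrier (biset_tensor G M' N')"
      unfolding carrier_tensor bij_betw_imp_surj_on[OF f(1), symmetric] bij_betw_imp_surj_on[OF g(1), symmetric]
      by blast
  qed (auto simp: f g fc gc tensor_orbit_eq[OF M' N'] lact_tensor[OF M' N'] ract_tensor[OF M' N'])
qed

lemma is_biset_regular: "is_biset G (regular_biset G)"
  by (rule is_bisetI) (auto simp: regular_biset_def finite_carrier m_assoc)

lemma regular_tensor:
  assumes M: "is_biset G M"
  shows "biset_isomorphic G (biset_tensor G (regular_biset G) M) M"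
proof (rule tensor_isomorphicI[OF is_biset_regular M, of "lact M"])
  fix g n g' n' assume a: "g \<in> bcarrier (regular_biset G)" "n \<in> bcarrier M" "g' \<in> bcarrier (regular_biset G)"
    "n' \<in> bcarrier M" "lact M g n = lact M g' n'"
  then have g: "g \<in> carrier G" "g' \<in> carrier G" by (auto simp: regular_biset_def)
  have "n' = lact M (inv g' \<otimes> g) n"
    using a g by (metis inv_closed is_bisetD(4,6)[OF M] l_inv)
  moreover have "g = ract (regular_biset G) g' (inv g' \<otimes> g)"
    using g by (simp add: regular_biset_def m_assoc[symmetric])
  ultimately show "tensor_orbit G (regular_biset G) M g n = tensor_orbit G (regular_biset G) M g' n'"
    using tensor_orbit_eq_iff[OF is_biset_regular M] a g by blast
next
  show "(\<Union>m\<in>bcarrier (regular_biset G). lact M m ` bcarrier M) = bcarrier M"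
  proof (intro equalityI subsetI)
    fix m assume "m \<in> bcarrier M"
    then show "m \<in> (\<Union>m\<in>bcarrier (regular_biset G). lact M m ` bcarrier M)"
      by (intro UN_I[of \<one>] image_eqI[of _ _ m]) (simp_all add: regular_biset_def is_bisetD[OF M])
  qed (auto simp: regular_biset_def is_bisetD[OF M])
qed (auto simp: regular_biset_def is_bisetD[OF M])

lemma tensor_regular:
  assumes M: "is_biset G M"
  shows "biset_isomorphic G (biset_tensor G M (regular_biset G)) M"
proof (rule tensor_isomorphicI[OF M is_biset_regular, of "ract M"])
  fix m g m' g' assume a: "m \<in> bcarrier M" "g \<in> bcarrier (regular_biset G)" "m' \<in> bcarrier M"
    "g' \<in> bcarrier (regular_biset G)" "ract M m g = ract M m' g'"
  then have g: "g \<in> carrier G" "g' \<in> carrier G" by (auto simp: regular_biset_def)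
  have "m = ract M m' (g' \<otimes> inv g)"
    using a g by (metis inv_closed is_bisetD(5,7)[OF M] r_inv)
  moreover have "g' = lact (regular_biset G) (g' \<otimes> inv g) g"
    using g by (simp add: regular_biset_def m_assoc)
  ultimately show "tensor_orbit G M (regular_biset G) m g = tensor_orbit G M (regular_biset G) m' g'"
    using tensor_orbit_eq_iff[OF M is_biset_regular] a g by blast
next
  show "(\<Union>m\<in>bcarrier M. ract M m ` bcarrier (regular_biset G)) = bcarrier M"
  proof (intro equalityI subsetI)
    fix m assume "m \<in> bcarrier M"
    then show "m \<in> (\<Union>m\<in>bcarrier M. ract M m ` bcarrier (regular_biset G))"
      by (intro UN_I[of m] image_eqI[of _ _ \<one>]) (simp_all add: regular_biset_def is_bisetD[OF M])
  qed (auto simp: regular_biset_def is_bisetD[OF M])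
qed (auto simp: regular_biset_def is_bisetD[OF M])

lemma tensor_assoc:
  assumes M: "is_biset G M" and N: "is_biset G N" and P: "is_biset G P"
  shows "biset_isomorphic G (biset_tensor G (biset_tensor G M N) P) (biset_tensor G M (biset_tensor G N P))"
proof -
  note MN = is_biset_tensor[OF M N] and NP = is_biset_tensor[OF N P]
  note D = is_bisetD[OF M] is_bisetD[OF N] is_bisetD[OF P]
  \<comment> \<open>A point of the inner tensor product is an orbit, so a representative is chosen.
    Another choice moves some g across the outer and then the inner tensor sign, where it
    cancels.\<close>
  define \<phi> where "\<phi> X p = (let q = (SOME q. q \<in> X) in
      tensor_orbit G M (biset_tensor G N P) (fst q) (tensor_orbit G N P (snd q) p))" for X p
  have NPI: "tensor_orbit G N P n p \<in> bcarrier (biset_tensor G N P)" if "n \<in> bcarrier N" "p \<in> bcarrier P" for n p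
    using that by (auto simp: carrier_tensor)
  have \<phi>: "\<phi> (tensor_orbit G M N m n) p = tensor_orbit G M (biset_tensor G N P) m (tensor_orbit G N P n p)"
    if "m \<in> bcarrier M" "n \<in> bcarrier N" "p \<in> bcarrier P" for m n p
  proof -
    define q where "q = (SOME q. q \<in> tensor_orbit G M N m n)"
    have "q \<in> tensor_orbit G M N m n"
      unfolding q_def by (rule someI) (rule tensor_orbit_self[OF M N that(1,2)])
    then obtain g where g: "g \<in> carrier G" "q = (ract M m (inv g), lact N g n)"
      by (auto simp: tensor_orbit_def)
    have "lact (biset_tensor G N P) (inv g) (tensor_orbit G N P (lact N g n) p) = tensor_orbit G N P n p"
      using that g by (simp add: lact_tensor[OF N P] D)
    then have "tensor_orbit G M (biset_tensor G N P) (fst q) (tensor_orbit G N P (snd q) p)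
      = tensor_orbit G M (biset_tensor G N P) m (tensor_orbit G N P n p)"
      using that g by (simp add: tensor_orbit_eq[OF M NP] NPI D)
    then show ?thesis by (simp add: \<phi>_def q_def Let_def)
  qed
  show ?thesis
  proof (rule tensor_isomorphicI[OF MN P, of \<phi>])
    fix X p g assume "X \<in> bcarrier (biset_tensor G M N)" and p: "p \<in> bcarrier P" and g: "g \<in> carrier G"
    then obtain m n where X: "X = tensor_orbit G M N m n" and mn: "m \<in> bcarrier M" "n \<in> bcarrier N"
      by (auto simp: carrier_tensor)
    show "\<phi> (ract (biset_tensor G M N) X g) p = \<phi> X (lact P g p)"
      using p g mn by (simp add: X \<phi> ract_tensor[OF M N] tensor_orbit_eq[OF N P] D)
    show "\<phi> (lact (biset_tensor G M N) g X) p = lact (biset_tensor G M (biset_tensor G N P)) g (\<phi> X p)"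
      using p g mn by (simp add: X \<phi> lact_tensor[OF M N] lact_tensor[OF M NP] NPI D)
    show "\<phi> X (ract P p g) = ract (biset_tensor G M (biset_tensor G N P)) (\<phi> X p) g"
      using p g mn by (simp add: X \<phi> ract_tensor[OF N P] ract_tensor[OF M NP] NPI D)
  next
    fix X p X' p'
    assume "X \<in> bcarrier (biset_tensor G M N)" "X' \<in> bcarrier (biset_tensor G M N)"
      and p: "p \<in> bcarrier P" "p' \<in> bcarrier P" and eq: "\<phi> X p = \<phi> X' p'"
    then obtain m n m' n' where X: "X = tensor_orbit G M N m n" "X' = tensor_orbit G M N m' n'"
      and mn: "m \<in> bcarrier M" "n \<in> bcarrier N" "m' \<in> bcarrier M" "n' \<in> bcarrier N"
      by (auto simp: carrier_tensor)
    obtain g where g: "g \<in> carrier G" "m = ract M m' g"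
      "tensor_orbit G N P n' p' = lact (biset_tensor G N P) g (tensor_orbit G N P n p)"
      using eq tensor_orbit_eq_iff[OF M NP mn(1) NPI[OF mn(2) p(1)] mn(3) NPI[OF mn(4) p(2)]]
      by (auto simp: X \<phi> mn p)
    then have "tensor_orbit G N P n' p' = tensor_orbit G N P (lact N g n) p"
      using mn p by (simp add: lact_tensor[OF N P])
    then obtain k where k: "k \<in> carrier G" "n' = ract N (lact N g n) k" "p = lact P k p'"
      using tensor_orbit_eq_iff[OF N P mn(4) p(2) D(10)[OF g(1) mn(2)] p(1)] by metis
    have "tensor_orbit G (biset_tensor G M N) P X p = tensor_orbit G (biset_tensor G M N) P (ract (biset_tensor G M N) X k) p'"
      using k mn p tensor_orbit_eq[OF MN P, of X p' k] by (auto simp: X carrier_tensor)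
    also have "ract (biset_tensor G M N) X k = tensor_orbit G M N m' n'"
      using k g mn by (simp add: X ract_tensor[OF M N] tensor_orbit_eq[OF M N] D)
    finally show "tensor_orbit G (biset_tensor G M N) P X p = tensor_orbit G (biset_tensor G M N) P X' p'"
      by (simp add: X)
  next
    show "(\<Union>X\<in>bcarrier (biset_tensor G M N). \<phi> X ` bcarrier P) = bcarrier (biset_tensor G M (biset_tensor G N P))"
      by (auto simp: carrier_tensor \<phi> image_iff) (metis \<phi>)+
  qed
qed

lemma sum_tensor:
  assumes M: "is_biset G M" and M': "is_biset G M'" and N: "is_biset G N"
  shows "biset_isomorphic G (biset_tensor G (biset_sum M M') N) (biset_sum (biset_tensor G M N) (biset_tensor G M' N))"
proof -
  note S = is_biset_sum[OF M M']
  note D = is_bisetD[OF M] is_bisetD[OF M'] is_bisetD[OF N]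
  have cS: "bcarrier (biset_sum M M') = bcarrier M <+> bcarrier M'"
    and rS: "ract (biset_sum M M') (Inl m) g = Inl (ract M m g)" "ract (biset_sum M M') (Inr m') g = Inr (ract M' m' g)"
    and lS: "lact (biset_sum M M') g (Inl m) = Inl (lact M g m)" "lact (biset_sum M M') g (Inr m') = Inr (lact M' g m')"
    for m m' g by (auto simp: biset_sum_def)
  define \<phi> where "\<phi> x n = map_sum (\<lambda>m. tensor_orbit G M N m n) (\<lambda>m. tensor_orbit G M' N m n) x" for x n
  show ?thesis
  proof (rule tensor_isomorphicI[OF S N, of \<phi>])
    fix x n x' n' assume a: "x \<in> bcarrier (biset_sum M M')" "n \<in> bcarrier N" "x' \<in> bcarrier (biset_sum M M')"
      "n' \<in> bcarrier N" "\<phi> x n = \<phi> x' n'"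
    then show "tensor_orbit G (biset_sum M M') N x n = tensor_orbit G (biset_sum M M') N x' n'"
      by (auto simp: tensor_orbit_eq_iff[OF S N] cS \<phi>_def rS tensor_orbit_eq_iff[OF M N] tensor_orbit_eq_iff[OF M' N])
  next
    show "(\<Union>m\<in>bcarrier (biset_sum M M'). \<phi> m ` bcarrier N) = bcarrier (biset_sum (biset_tensor G M N) (biset_tensor G M' N))"
      by (auto simp: biset_sum_def carrier_tensor \<phi>_def image_iff) (metis InlI InrI map_sum.simps)+
  qed (auto simp: cS rS lS \<phi>_def tensor_orbit_eq[OF M N] tensor_orbit_eq[OF M' N] lact_tensor[OF M N]
      lact_tensor[OF M' N] ract_tensor[OF M N] ract_tensor[OF M' N] biset_sum_def[of "biset_tensor G M N"])
qed

lemma tensor_sum: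
  assumes M: "is_biset G M" and N: "is_biset G N" and N': "is_biset G N'"
  shows "biset_isomorphic G (biset_tensor G M (biset_sum N N')) (biset_sum (biset_tensor G M N) (biset_tensor G M N'))"
proof -
  note S = is_biset_sum[OF N N']
  note D = is_bisetD[OF M] is_bisetD[OF N] is_bisetD[OF N']
  have cS: "bcarrier (biset_sum N N') = bcarrier N <+> bcarrier N'"
    and rS: "ract (biset_sum N N') (Inl m) g = Inl (ract N m g)" "ract (biset_sum N N') (Inr m') g = Inr (ract N' m' g)"
    and lS: "lact (biset_sum N N') g (Inl m) = Inl (lact N g m)" "lact (biset_sum N N') g (Inr m') = Inr (lact N' g m')"
    for m m' g by (auto simp: biset_sum_def)
  define \<phi> where "\<phi> m x = map_sum (\<lambda>n. tensor_orbit G M N m n) (\<lambda>n. tensor_orbit G M N' m n) x" for x m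
  show ?thesis
  proof (rule tensor_isomorphicI[OF M S, of \<phi>])
    fix m x m' x' assume a: "m \<in> bcarrier M" "x \<in> bcarrier (biset_sum N N')" "m' \<in> bcarrier M"
      "x' \<in> bcarrier (biset_sum N N')" "\<phi> m x = \<phi> m' x'"
    then show "tensor_orbit G M (biset_sum N N') m x = tensor_orbit G M (biset_sum N N') m' x'"
      by (auto simp: tensor_orbit_eq_iff[OF M S] cS \<phi>_def lS tensor_orbit_eq_iff[OF M N] tensor_orbit_eq_iff[OF M N'])
  next
    show "(\<Union>m\<in>bcarrier M. \<phi> m ` bcarrier (biset_sum N N')) = bcarrier (biset_sum (biset_tensor G M N) (biset_tensor G M N'))"
      by (auto simp: biset_sum_def carrier_tensor \<phi>_def image_iff) (metis InlI InrI map_sum.simps)+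
  qed (auto simp: cS rS lS \<phi>_def tensor_orbit_eq[OF M N] tensor_orbit_eq[OF M N'] lact_tensor[OF M N]
      lact_tensor[OF M N'] ract_tensor[OF M N] ract_tensor[OF M N'] biset_sum_def[of "biset_tensor G M N"])
qed

text \<open>The union in \<open>bclass_tensor\<close> runs over a nonempty family of equal sets,
  because tensor products respect isomorphism in both factors.\<close>

lemma bclass_tensor_bclass:
  assumes M: "is_biset G M" and N: "is_biset G N"
  shows "bclass_tensor G (bclass G M) (bclass G N) = bclass G (biset_tensor G M N)"
proof -
  have eq: "bclass G (biset_tensor G M' N') = bclass G (biset_tensor G M N)"
    if "M' \<in> bclass G M" "N' \<in> bclass G N" for M' N'
  proof -
    have "is_biset G M'" "is_biset G N'" "biset_isomorphic G M M'" "biset_isomorphic G N N'"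
      using that by (auto simp: bclass_def)
    then show ?thesis
      using bclass_eqI[OF is_biset_tensor[OF M N] biset_tensor_cong[OF M N]] by metis
  qed
  obtain M' N' where "M' \<in> bclass G M" "N' \<in> bclass G N"
    using bclass_nonempty[OF M] bclass_nonempty[OF N] by metis
  then show ?thesis
    unfolding bclass_tensor_def using eq by blast
qed

end

section \<open>The double Burnside ring\<close>

lemma lookup_pm_scale [simp]: "Poly_Mapping.lookup (r *\<^sub>b f) k = r * Poly_Mapping.lookup f k"
  by (simp add: pm_scale_def map.rep_eq when_def)

interpretation pm: Modules.module "(*\<^sub>b) :: 'r::comm_ring_1 \<Rightarrow> ('k \<Rightarrow>\<^sub>0 'r) \<Rightarrow> ('k \<Rightarrow>\<^sub>0 'r)"
  by standard (auto intro!: poly_mapping_eqI simp: lookup_add algebra_simps)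

lemma pm_scale_single [simp]: "r *\<^sub>b Poly_Mapping.single k s = Poly_Mapping.single k (r * s)"
  by (rule poly_mapping_eqI) (simp add: lookup_single when_def)

lemma sum_single_lookup: "f = (\<Sum>k\<in>Poly_Mapping.keys f. Poly_Mapping.single k (Poly_Mapping.lookup f k))"
  by (rule poly_mapping_eqI)
    (auto simp: lookup_sum lookup_single when_def in_keys_iff if_distrib sum.delta' cong: if_cong)

lemma keys_scale_subset: "Poly_Mapping.keys (r *\<^sub>b f) \<subseteq> Poly_Mapping.keys f"
  by (auto simp: in_keys_iff)

definition lin :: "('k \<Rightarrow> 'r) \<Rightarrow> ('k \<Rightarrow>\<^sub>0 'r) \<Rightarrow> 'r::comm_ring_1" where
  "lin w f = (\<Sum>k\<in>Poly_Mapping.keys f. Poly_Mapping.lookup f k * w k)"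

text \<open>Over one finite superset of all supports involved, additivity becomes additivity of
  sums; keys whose coefficients cancel contribute zero. The same device serves for
  \<open>bmult_superset\<close>.\<close>

lemma lin_superset:
  assumes "finite S" "Poly_Mapping.keys f \<subseteq> S"
  shows "lin w f = (\<Sum>k\<in>S. Poly_Mapping.lookup f k * w k)"
  unfolding lin_def by (rule sum.mono_neutral_left) (use assms in \<open>auto simp: in_keys_iff\<close>)

lemma lin_single [simp]: "lin w (Poly_Mapping.single k r) = r * w k"
  using lin_superset[of "{k}" "Poly_Mapping.single k r" w] by auto

lemma lin_add [simp]: "lin w (f + g) = lin w f + lin w g"
proof -
  let ?S = "Poly_Mapping.keys f \<union> Poly_Mapping.keys g"
  show ?thesis
    using lin_superset[of ?S "f + g" w] lin_superset[of ?S f w] lin_superset[of ?S g w] keys_add[of f g]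
    by (simp add: lookup_add algebra_simps sum.distrib)
qed

lemma lin_scale [simp]: "lin w (r *\<^sub>b f) = r * lin w f"
  using lin_superset[OF finite_keys keys_scale_subset, of w r f]
  by (simp add: lin_def sum_distrib_left mult.assoc)

lemma lin_zero [simp]: "lin w 0 = 0"
  by (simp add: lin_def)

lemma lin_uminus [simp]: "lin w (- f) = - lin w f"
  using lin_add[of w f "- f"] by (simp add: eq_neg_iff_add_eq_0 add.commute del: lin_add)

lemma lin_diff [simp]: "lin w (f - g) = lin w f - lin w g"
  using lin_add[of w f "- g"] by simp

lemma lin_sum [simp]: "lin w (\<Sum>i\<in>I. f i) = (\<Sum>i\<in>I. lin w (f i))"
  by (induction I rule: infinite_finite_induct) auto

text \<open>As a plain function the product is bilinear on all finitely supported functions, without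
  conditions on the carrier.\<close>

definition bmult :: "('g, 'm) monoid_scheme \<Rightarrow> ('g bclass \<Rightarrow>\<^sub>0 'r::comm_ring_1) \<Rightarrow> ('g bclass \<Rightarrow>\<^sub>0 'r) \<Rightarrow> ('g bclass \<Rightarrow>\<^sub>0 'r)" where
  "bmult G f g = f \<otimes>\<^bsub>free_burnside G\<^esub> g"

lemma free_burnside_simps:
  "carrier (free_burnside G) = {f. Poly_Mapping.keys f \<subseteq> bclasses G}"
  "mult (free_burnside G) = bmult G"
  "one (free_burnside G) = basis_elt G (regular_biset G)"
  "zero (free_burnside G) = 0"
  "add (free_burnside G) = (+)"
  by (auto simp: free_burnside_def bmult_def fun_eq_iff)

lemma bmult_superset:
  assumes "finite S" "Poly_Mapping.keys f \<subseteq> S" "finite S'" "Poly_Mapping.keys g \<subseteq> S'"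
  shows "bmult G f g = (\<Sum>C\<in>S. \<Sum>D\<in>S'. Poly_Mapping.single (bclass_tensor G C D)
                  (Poly_Mapping.lookup f C * Poly_Mapping.lookup g D))"
proof -
  have "bmult G f g = (\<Sum>C\<in>S. \<Sum>D\<in>Poly_Mapping.keys g. Poly_Mapping.single (bclass_tensor G C D)
                  (Poly_Mapping.lookup f C * Poly_Mapping.lookup g D))"
    unfolding bmult_def free_burnside_def monoid.simps
    by (rule sum.mono_neutral_left) (use assms in \<open>auto simp: in_keys_iff\<close>)
  also have "\<dots> = (\<Sum>C\<in>S. \<Sum>D\<in>S'. Poly_Mapping.single (bclass_tensor G C D)
                  (Poly_Mapping.lookup f C * Poly_Mapping.lookup g D))"
    by (rule sum.cong[OF refl], rule sum.mono_neutral_left) (use assms in \<open>auto simp: in_keys_iff\<close>)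
  finally show ?thesis .
qed

lemma bmult_single [simp]:
  "bmult G (Poly_Mapping.single C r) (Poly_Mapping.single D s) = Poly_Mapping.single (bclass_tensor G C D) (r * s)"
  using bmult_superset[of "{C}" "Poly_Mapping.single C r" "{D}" "Poly_Mapping.single D s" G] by simp

lemma bmult_add_left: "bmult G (f + f') g = bmult G f g + bmult G f' g"
proof -
  let ?S = "Poly_Mapping.keys f \<union> Poly_Mapping.keys f'"
  note s = bmult_superset[of ?S _ "Poly_Mapping.keys g" g]
  show ?thesis
    using keys_add[of f f'] by (simp add: s lookup_add distrib_right single_add sum.distrib)
qed

lemma bmult_add_right: "bmult G g (f + f') = bmult G g f + bmult G g f'"
proof -
  let ?S = "Poly_Mapping.keys f \<union> Poly_Mapping.keys f'"
  note s = bmult_superset[of "Poly_Mapping.keys g" g ?S]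
  show ?thesis
    using keys_add[of f f'] by (simp add: s lookup_add distrib_left single_add sum.distrib)
qed

lemma bmult_zero [simp]: "bmult G 0 f = 0" "bmult G f 0 = 0"
  by (simp_all add: bmult_def free_burnside_def)

lemma bmult_scale_left: "bmult G (r *\<^sub>b f) g = r *\<^sub>b bmult G f g"
  using bmult_superset[OF finite_keys keys_scale_subset finite_keys subset_refl, of G r f g]
    bmult_superset[OF finite_keys subset_refl finite_keys subset_refl, of G f g]
  by (simp add: pm.scale_sum_right mult.assoc)

lemma bmult_scale_right: "bmult G g (r *\<^sub>b f) = r *\<^sub>b bmult G g f"
  using bmult_superset[OF finite_keys subset_refl finite_keys keys_scale_subset, of G g r f]
    bmult_superset[OF finite_keys subset_refl finite_keys subset_refl, of G g f]
  by (simp add: pm.scale_sum_right mult.left_commute)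

lemma bmult_uminus_left: "bmult G (- f) g = - bmult G f g"
  using bmult_add_left[of G f "- f" g] by (simp add: eq_neg_iff_add_eq_0 add.commute)

lemma bmult_uminus_right: "bmult G g (- f) = - bmult G g f"
  using bmult_add_right[of G g f "- f"] by (simp add: eq_neg_iff_add_eq_0 add.commute)

lemma bmult_diff_left: "bmult G (f - f') g = bmult G f g - bmult G f' g"
  using bmult_add_left[of G f "- f'" g] by (simp add: bmult_uminus_left)

lemma bmult_diff_right: "bmult G g (f - f') = bmult G g f - bmult G g f'"
  using bmult_add_right[of G g f "- f'"] by (simp add: bmult_uminus_right)

definition burnside_carrier :: "('g, 'm) monoid_scheme \<Rightarrow> ('g bclass \<Rightarrow>\<^sub>0 'r::comm_ring_1) set" where
  "burnside_carrier G = {f. Poly_Mapping.keys f \<subseteq> bclasses G}"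

lemma burnside_carrier_induct [consumes 1, case_names zero single add]:
  assumes "f \<in> burnside_carrier G"
    and "P 0" and "\<And>C r. C \<in> bclasses G \<Longrightarrow> P (Poly_Mapping.single C r)"
    and "\<And>f g. P f \<Longrightarrow> P g \<Longrightarrow> P (f + g)"
  shows "P f"
proof -
  have "P (\<Sum>k\<in>S. Poly_Mapping.single k (Poly_Mapping.lookup f k))" if "finite S" "S \<subseteq> bclasses G" for S
    using that by (induction S rule: finite_induct) (use assms in auto)
  from this[of "Poly_Mapping.keys f"] show ?thesis
    using assms(1) sum_single_lookup[of f, symmetric] by (simp add: burnside_carrier_def)
qed

lemma burnside_carrier_closed [simp, intro]:
  "0 \<in> burnside_carrier G"
  "C \<in> bclasses G \<Longrightarrow> Poly_Mapping.single C r \<in> burnside_carrier G"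
  "f \<in> burnside_carrier G \<Longrightarrow> g \<in> burnside_carrier G \<Longrightarrow> f + g \<in> burnside_carrier G"
  "f \<in> burnside_carrier G \<Longrightarrow> - f \<in> burnside_carrier G"
  "f \<in> burnside_carrier G \<Longrightarrow> g \<in> burnside_carrier G \<Longrightarrow> f - g \<in> burnside_carrier G"
  "f \<in> burnside_carrier G \<Longrightarrow> r *\<^sub>b f \<in> burnside_carrier G"
proof -
  show add: "f \<in> burnside_carrier G \<Longrightarrow> g \<in> burnside_carrier G \<Longrightarrow> f + g \<in> burnside_carrier G" for f g
    using keys_add[of f g] by (auto simp: burnside_carrier_def)
  show um: "f \<in> burnside_carrier G \<Longrightarrow> - f \<in> burnside_carrier G" for f
    by (auto simp: burnside_carrier_def in_keys_iff subset_iff)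
  show "f \<in> burnside_carrier G \<Longrightarrow> g \<in> burnside_carrier G \<Longrightarrow> f - g \<in> burnside_carrier G"
    using add[of f "- g"] um[of g] by simp
  show "f \<in> burnside_carrier G \<Longrightarrow> r *\<^sub>b f \<in> burnside_carrier G"
    using keys_scale_subset[of r f] by (auto simp: burnside_carrier_def)
qed (auto simp: burnside_carrier_def)

lemma burnside_carrier_sum [intro]:
  "(\<And>i. i \<in> I \<Longrightarrow> f i \<in> burnside_carrier G) \<Longrightarrow> (\<Sum>i\<in>I. f i) \<in> burnside_carrier G"
  by (induction I rule: infinite_finite_induct) auto

lemma basis_elt_carrier [intro]: "is_biset G M \<Longrightarrow> basis_elt G M \<in> burnside_carrier G"
  by (simp add: basis_elt_def bclass_in_bclasses)

lemma basis_elt_eqI: "is_biset G M \<Longrightarrow> biset_isomorphic G M N \<Longrightarrow> basis_elt G M = basis_elt G N"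
  by (simp add: basis_elt_def bclass_eqI)

text \<open>The generators in the definition of \<^const>\<open>burnside_rel\<close> are stated for bisets on \<^typ>\<open>nat\<close> only.\<close>

lemma biset_sum_rel:
  assumes M: "is_biset G M" and N: "is_biset G N"
  shows "basis_elt G (biset_sum M N) - basis_elt G M - basis_elt G N \<in> burnside_rel G"
proof -
  obtain M' :: "('a, nat) biset" where M': "is_biset G M'" "biset_isomorphic G M M'"
    using ex_nat_biset[OF M] by blast
  obtain N' :: "('a, nat) biset" where N': "is_biset G N'" "biset_isomorphic G N N'"
    using ex_nat_biset[OF N] by blast
  have "basis_elt G (biset_sum M N) - basis_elt G M - basis_elt G N
      = basis_elt G (biset_sum M' N') - basis_elt G M' - basis_elt G N'"
    by (simp add: basis_elt_eqI[OF is_biset_sum[OF M N] biset_sum_cong[OF M'(2) N'(2)]]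
        basis_elt_eqI[OF M M'(2)] basis_elt_eqI[OF N N'(2)])
  also have "\<dots> \<in> burnside_rel G"
    unfolding burnside_rel_def using M'(1) N'(1) by (intro pm.span_base) blast
  finally show ?thesis .
qed

lemma burnside_rel_closed:
  "0 \<in> burnside_rel G"
  "f \<in> burnside_rel G \<Longrightarrow> g \<in> burnside_rel G \<Longrightarrow> f + g \<in> burnside_rel G"
  "f \<in> burnside_rel G \<Longrightarrow> - f \<in> burnside_rel G"
  "f \<in> burnside_rel G \<Longrightarrow> g \<in> burnside_rel G \<Longrightarrow> f - g \<in> burnside_rel G"
  "f \<in> burnside_rel G \<Longrightarrow> r *\<^sub>b f \<in> burnside_rel G"
  unfolding burnside_rel_def
  by (blast intro: pm.span_zero pm.span_add pm.span_neg pm.span_diff pm.span_scale)+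

lemma burnside_rel_induct [consumes 1, case_names zero add rel]:
  fixes k :: "'g bclass \<Rightarrow>\<^sub>0 'r::comm_ring_1"
  assumes k: "k \<in> burnside_rel G"
    and "P 0" and add: "\<And>f g. P f \<Longrightarrow> P g \<Longrightarrow> P (f + g)"
    and rel: "\<And>r (M :: ('g, nat) biset) (N :: ('g, nat) biset). is_biset G M \<Longrightarrow> is_biset G N \<Longrightarrow>
      P (r *\<^sub>b (basis_elt G (biset_sum M N) - basis_elt G M - basis_elt G N))"
  shows "P k"
  using k unfolding burnside_rel_def
proof (induction rule: pm.span_induct_alt)
  case base
  show ?case by fact
next
  case (step c x y)
  show ?case by (rule add) (use step rel in auto)
qed

lemma burnside_rel_subset: "burnside_rel G \<subseteq> (burnside_carrier G :: ('g bclass \<Rightarrow>\<^sub>0 'r::comm_ring_1) set)"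
proof
  fix k :: "'g bclass \<Rightarrow>\<^sub>0 'r" assume "k \<in> burnside_rel G"
  then show "k \<in> burnside_carrier G"
    by (induction rule: burnside_rel_induct) (auto intro!: burnside_carrier_closed is_biset_sum)
qed

lemma lin_burnside_rel:
  assumes "k \<in> burnside_rel G"
    and "\<And>(M :: ('g, nat) biset) (N :: ('g, nat) biset). is_biset G M \<Longrightarrow> is_biset G N \<Longrightarrow>
      w (bclass G (biset_sum M N)) = w (bclass G M) + w (bclass G N)"
  shows "lin w k = 0"
  using assms(1)
  by (induction rule: burnside_rel_induct) (auto simp: assms(2) basis_elt_def)

lemma burnside_proj_def': "burnside_proj G f = (\<lambda>k. k + f) ` burnside_rel G"
  by (auto simp: burnside_proj_def a_r_coset_def r_coset_def free_burnside_def)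

lemma burnside_proj_eq_iff:
  fixes f g :: "'g bclass \<Rightarrow>\<^sub>0 'r::comm_ring_1"
  shows "burnside_proj G f = burnside_proj G g \<longleftrightarrow> f - g \<in> burnside_rel G"
proof
  assume eq: "burnside_proj G f = burnside_proj G g"
  have "0 + f \<in> burnside_proj G f"
    unfolding burnside_proj_def' using burnside_rel_closed(1) by (rule imageI)
  then obtain k where "k \<in> burnside_rel G" "0 + f = k + g"
    unfolding eq by (auto simp: burnside_proj_def')
  then show "f - g \<in> burnside_rel G" by simp
next
  assume k: "f - g \<in> burnside_rel G"
  show "burnside_proj G f = burnside_proj G g"
    unfolding burnside_proj_def'
  proof (intro equalityI image_subsetI)
    fix x :: "'g bclass \<Rightarrow>\<^sub>0 'r" assume x: "x \<in> burnside_rel G"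
    show "x + f \<in> (\<lambda>k. k + g) ` burnside_rel G"
      by (rule image_eqI[of _ _ "x + (f - g)"]) (use x k in \<open>auto intro: burnside_rel_closed\<close>)
    show "x + g \<in> (\<lambda>k. k + f) ` burnside_rel G"
      by (rule image_eqI[of _ _ "x - (f - g)"]) (use x k in \<open>auto intro: burnside_rel_closed\<close>)
  qed
qed

lemma map_of_int_simps:
  "Poly_Mapping.map rat_of_int 0 = 0"
  "Poly_Mapping.map rat_of_int (f + g) = Poly_Mapping.map rat_of_int f + Poly_Mapping.map rat_of_int g"
  "Poly_Mapping.map rat_of_int (f - g) = Poly_Mapping.map rat_of_int f - Poly_Mapping.map rat_of_int g"
  "Poly_Mapping.map rat_of_int (r *\<^sub>b f) = of_int r *\<^sub>b Poly_Mapping.map rat_of_int f"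
  by (auto intro!: poly_mapping_eqI simp: map.rep_eq when_def lookup_add lookup_minus)

lemma map_of_int_rel:
  assumes "k \<in> burnside_rel G"
  shows "Poly_Mapping.map rat_of_int k \<in> burnside_rel G"
proof -
  \<comment> \<open>Two instances, as the relations involve bisets on \<open>nat\<close> and on
    \<open>nat + nat\<close> and a local fact is fixed to one type.\<close>
  have b: "Poly_Mapping.map rat_of_int (basis_elt G M) = basis_elt G M" for M :: "('a, nat) biset"
    by (auto simp: basis_elt_def)
  have b': "Poly_Mapping.map rat_of_int (basis_elt G M) = basis_elt G M" for M :: "('a, nat + nat) biset"
    by (auto simp: basis_elt_def)
  show ?thesis
    using assms
    by (induction rule: burnside_rel_induct)
      (auto simp: map_of_int_simps b b' intro: burnside_rel_closed biset_sum_rel)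
qed

lemma burnside_incl_proj:
  "burnside_incl G (burnside_proj G f) = burnside_proj G (Poly_Mapping.map rat_of_int f)"
proof -
  have "burnside_proj G (Poly_Mapping.map rat_of_int (k + f)) = burnside_proj G (Poly_Mapping.map rat_of_int f)"
    if "k \<in> burnside_rel G" for k
    using map_of_int_rel[OF that] by (simp add: burnside_proj_eq_iff map_of_int_simps)
  moreover have "burnside_rel G \<noteq> ({} :: ('a bclass \<Rightarrow>\<^sub>0 int) set)"
    using burnside_rel_closed(1) by blast
  ultimately show ?thesis
    unfolding burnside_incl_def burnside_proj_def'[of G f] by simp
qed

section \<open>The free ring, the ideal of relations and the quotient\<close>

context fin_group
begin

lemma bclass_tensor_closed:
  assumes "C \<in> bclasses G" "D \<in> bclasses G"
  shows "bclass_tensor G C D \<in> bclasses G"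
  using assms by (auto elim!: bclassesE simp: bclass_tensor_bclass is_biset_tensor bclass_in_bclasses)

lemma bclass_tensor_assoc:
  assumes "C \<in> bclasses G" "D \<in> bclasses G" "E \<in> bclasses G"
  shows "bclass_tensor G (bclass_tensor G C D) E = bclass_tensor G C (bclass_tensor G D E)"
  using assms
  by (elim bclassesE) (simp add: bclass_tensor_bclass is_biset_tensor bclass_eqI tensor_assoc)

lemma bclass_tensor_regular:
  assumes "C \<in> bclasses G"
  shows "bclass_tensor G (bclass G (regular_biset G)) C = C" "bclass_tensor G C (bclass G (regular_biset G)) = C"
  using assms
  by (elim bclassesE; simp add: bclass_tensor_bclass is_biset_tensor is_biset_regular bclass_eqI
      regular_tensor tensor_regular)+

lemma bmult_closed [simp, intro]:
  assumes "f \<in> burnside_carrier G" "g \<in> burnside_carrier G"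
  shows "bmult G f g \<in> burnside_carrier G"
  using assms(1)
proof (induction rule: burnside_carrier_induct)
  case (single C r)
  show ?case using assms(2)
    by (induction rule: burnside_carrier_induct) (auto simp: single bclass_tensor_closed bmult_add_right)
qed (auto simp: bmult_add_left)

lemma bmult_assoc:
  assumes "f \<in> burnside_carrier G" "g \<in> burnside_carrier G" "h \<in> burnside_carrier G"
  shows "bmult G (bmult G f g) h = bmult G f (bmult G g h)"
  using assms(1)
proof (induction rule: burnside_carrier_induct)
  case (single C r)
  show ?case using assms(2)
  proof (induction rule: burnside_carrier_induct)
    case (single D s)
    show ?case using assms(3)
      by (induction rule: burnside_carrier_induct)
        (auto simp: single \<open>C \<in> bclasses G\<close> bclass_tensor_assoc bmult_add_right mult.assoc)
  qed (auto simp: bmult_add_left bmult_add_right)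
qed (auto simp: bmult_add_left)

lemma bmult_one:
  assumes "f \<in> burnside_carrier G"
  shows "bmult G (basis_elt G (regular_biset G)) f = f" "bmult G f (basis_elt G (regular_biset G)) = f"
  using assms
  by (induction rule: burnside_carrier_induct)
    (auto simp: basis_elt_def bclass_tensor_regular bmult_add_left bmult_add_right)

lemma bmult_basis:
  assumes "is_biset G M" "is_biset G N"
  shows "bmult G (basis_elt G M) (basis_elt G N) = basis_elt G (biset_tensor G M N)"
  using assms by (simp add: basis_elt_def bclass_tensor_bclass)

lemma ring_free_burnside: "ring (free_burnside G :: ('a bclass \<Rightarrow>\<^sub>0 'r::comm_ring_1) ring)"
proof (rule ringI)
  show "abelian_group (free_burnside G :: ('a bclass \<Rightarrow>\<^sub>0 'r) ring)"
  proof (rule abelian_groupI)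
    fix x :: "'a bclass \<Rightarrow>\<^sub>0 'r" assume "x \<in> carrier (free_burnside G)"
    then show "\<exists>y\<in>carrier (free_burnside G). y \<oplus>\<^bsub>free_burnside G\<^esub> x = \<zero>\<^bsub>free_burnside G\<^esub>"
      by (intro bexI[of _ "- x"]) (auto simp: free_burnside_simps burnside_carrier_def[symmetric])
  qed (auto simp: free_burnside_simps burnside_carrier_def[symmetric] algebra_simps)
  show "monoid (free_burnside G :: ('a bclass \<Rightarrow>\<^sub>0 'r) ring)"
    by (rule monoidI)
      (auto simp: free_burnside_simps burnside_carrier_def[symmetric] bmult_assoc bmult_one is_biset_regular)
qed (auto simp: free_burnside_simps burnside_carrier_def[symmetric] bmult_add_left bmult_add_right)

text \<open>Tensoring distributes over disjoint unions on either side. By bilinearity it is enough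
  to multiply a generating relation by one basis element, which again gives a generating relation up
  to isomorphism.\<close>

lemma bmult_rel:
  fixes k f :: "'a bclass \<Rightarrow>\<^sub>0 'r::comm_ring_1"
  assumes k: "k \<in> burnside_rel G" and f: "f \<in> burnside_carrier G"
  shows "bmult G f k \<in> burnside_rel G" "bmult G k f \<in> burnside_rel G"
proof -
  show "bmult G f k \<in> burnside_rel G"
    using f
  proof (induction rule: burnside_carrier_induct)
    case (single C r)
    then obtain P :: "('a, nat) biset" where P: "is_biset G P" "C = bclass G P"
      by (rule bclassesE)
    have C: "Poly_Mapping.single C r = r *\<^sub>b basis_elt G P"
      by (simp add: P basis_elt_def)
    have "bmult G (basis_elt G P) k \<in> burnside_rel G"
      using k
    proof (induction rule: burnside_rel_induct)
      case (rel r M N)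
      have eq: "bmult G (basis_elt G P) (basis_elt G (biset_sum M N)) = basis_elt G (biset_sum (biset_tensor G P M) (biset_tensor G P N))"
        using P rel by (simp add: bmult_basis is_biset_sum basis_elt_eqI[OF is_biset_tensor tensor_sum])
      then show ?case
        using P(1) rel by (simp add: bmult_scale_right bmult_diff_right eq bmult_basis[OF P(1) rel(1)]
            bmult_basis[OF P(1) rel(2)] burnside_rel_closed(5) biset_sum_rel is_biset_tensor)
    qed (auto simp: bmult_add_right intro: burnside_rel_closed)
    then show ?case
      by (simp add: C bmult_scale_left burnside_rel_closed)
  qed (auto simp: bmult_add_left intro: burnside_rel_closed)
  show "bmult G k f \<in> burnside_rel G"
    using f
  proof (induction rule: burnside_carrier_induct)
    case (single C r)
    then obtain P :: "('a, nat) biset" where P: "is_biset G P" "C = bclass G P"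
      by (rule bclassesE)
    have C: "Poly_Mapping.single C r = r *\<^sub>b basis_elt G P"
      by (simp add: P basis_elt_def)
    have "bmult G k (basis_elt G P) \<in> burnside_rel G"
      using k
    proof (induction rule: burnside_rel_induct)
      case (rel r M N)
      have eq: "bmult G (basis_elt G (biset_sum M N)) (basis_elt G P) = basis_elt G (biset_sum (biset_tensor G M P) (biset_tensor G N P))"
        using P rel by (simp add: bmult_basis is_biset_sum basis_elt_eqI[OF is_biset_tensor sum_tensor])
      then show ?case
        using P(1) rel by (simp add: bmult_scale_left bmult_diff_left eq bmult_basis[OF rel(1) P(1)]
            bmult_basis[OF rel(2) P(1)] burnside_rel_closed(5) biset_sum_rel is_biset_tensor)
    qed (auto simp: bmult_add_left intro: burnside_rel_closed)
    then show ?case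
      by (simp add: C bmult_scale_right burnside_rel_closed)
  qed (auto simp: bmult_add_right intro: burnside_rel_closed)
qed

lemma ideal_burnside_rel: "ideal (burnside_rel G) (free_burnside G :: ('a bclass \<Rightarrow>\<^sub>0 'r::comm_ring_1) ring)"
proof (rule idealI[OF ring_free_burnside])
  interpret R: ring "free_burnside G :: ('a bclass \<Rightarrow>\<^sub>0 'r) ring"
    by (rule ring_free_burnside)
  have inv: "\<ominus>\<^bsub>free_burnside G\<^esub> k = - k" if "k \<in> burnside_rel G" for k :: "'a bclass \<Rightarrow>\<^sub>0 'r"
    using subsetD[OF burnside_rel_subset that]
    by (intro R.add.inv_equality) (auto simp: free_burnside_simps burnside_carrier_def[symmetric])
  show "subgroup (burnside_rel G) (add_monoid (free_burnside G :: ('a bclass \<Rightarrow>\<^sub>0 'r) ring))"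
    by (rule R.add.subgroupI)
      (use burnside_rel_subset in \<open>auto simp: inv free_burnside_simps burnside_carrier_def[symmetric] intro: burnside_rel_closed\<close>)
qed (auto simp: free_burnside_simps burnside_carrier_def[symmetric] bmult_rel)

lemma ring_burnside: "ring (burnside G :: ('a bclass \<Rightarrow>\<^sub>0 'r::comm_ring_1) set ring)"
  unfolding burnside_def by (rule ideal.quotient_is_ring[OF ideal_burnside_rel])

lemma burnside_simps:
  "carrier (burnside G) = burnside_proj G ` burnside_carrier G"
  "\<one>\<^bsub>burnside G\<^esub> = burnside_proj G (basis_elt G (regular_biset G))"
  "f \<in> burnside_carrier G \<Longrightarrow> g \<in> burnside_carrier G \<Longrightarrow>
    burnside_proj G f \<otimes>\<^bsub>burnside G\<^esub> burnside_proj G g = burnside_proj G (bmult G f g)"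
  "f \<in> burnside_carrier G \<Longrightarrow> g \<in> burnside_carrier G \<Longrightarrow>
    burnside_proj G f \<oplus>\<^bsub>burnside G\<^esub> burnside_proj G g = burnside_proj G (f + g)"
proof -
  note I = ideal_burnside_rel
  show "carrier (burnside G) = burnside_proj G ` burnside_carrier G"
    by (auto simp: burnside_def FactRing_def A_RCOSETS_def' burnside_proj_def free_burnside_simps burnside_carrier_def[symmetric])
  show "\<one>\<^bsub>burnside G\<^esub> = burnside_proj G (basis_elt G (regular_biset G))"
    by (simp add: burnside_def FactRing_def burnside_proj_def free_burnside_simps)
  assume fg: "f \<in> burnside_carrier G" "g \<in> burnside_carrier G"
  then show "burnside_proj G f \<otimes>\<^bsub>burnside G\<^esub> burnside_proj G g = burnside_proj G (bmult G f g)"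
    using ideal.rcoset_mult_add[OF I]
    by (simp add: burnside_def FactRing_def burnside_proj_def free_burnside_simps burnside_carrier_def[symmetric])
  show "burnside_proj G f \<oplus>\<^bsub>burnside G\<^esub> burnside_proj G g = burnside_proj G (f + g)"
    using fg abelian_subgroup.a_rcos_sum[OF abelian_subgroupI3[OF ideal.axioms(1)[OF I] ring.is_abelian_group[OF ring_free_burnside]]]
    by (simp add: burnside_def FactRing_def burnside_proj_def free_burnside_simps burnside_carrier_def[symmetric])
qed

end

section \<open>Stabilizers and marks\<close>

text \<open>The stabilizer of m under the left action (h, k) m = h m k^-1 of G x G, with the inverse
  moved to the other side of the equation.\<close>

definition stab :: "('g, 'm) monoid_scheme \<Rightarrow> ('g, 'x) biset \<Rightarrow> 'x \<Rightarrow> ('g \<times> 'g) set" where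
  "stab G M m = {(h, k). h \<in> carrier G \<and> k \<in> carrier G \<and> lact M h m = ract M m k}"

text \<open>The conjugate (g, h) U (g, h)^-1, described by membership so that it can be composed
  with other relations directly.\<close>

definition conj_rel :: "('g, 'm) monoid_scheme \<Rightarrow> 'g \<Rightarrow> 'g \<Rightarrow> ('g \<times> 'g) set \<Rightarrow> ('g \<times> 'g) set" where
  "conj_rel G g h U = {(x, y). x \<in> carrier G \<and> y \<in> carrier G \<and>
     (inv\<^bsub>G\<^esub> g \<otimes>\<^bsub>G\<^esub> x \<otimes>\<^bsub>G\<^esub> g, inv\<^bsub>G\<^esub> h \<otimes>\<^bsub>G\<^esub> y \<otimes>\<^bsub>G\<^esub> h) \<in> U}"

text \<open>The left coset (g, h) U, again by a membership condition in place of an existential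
  one.\<close>

definition coset_of :: "('g, 'm) monoid_scheme \<Rightarrow> ('g \<times> 'g) set \<Rightarrow> 'g \<Rightarrow> 'g \<Rightarrow> ('g \<times> 'g) set" where
  "coset_of G U g h = {(x, y). x \<in> carrier G \<and> y \<in> carrier G \<and> (inv\<^bsub>G\<^esub> g \<otimes>\<^bsub>G\<^esub> x, inv\<^bsub>G\<^esub> h \<otimes>\<^bsub>G\<^esub> y) \<in> U}"

text \<open>
  The decimal digits of the type of \<open>U\<close> are the orders of its first projection \<open>p\<^sub>1 U\<close>, of the
  kernel \<open>k\<^sub>1 U = {x. (x, 1) \<in> U}\<close> and of its second projection. For subgroups of
  \<open>S\<^sub>3 \<times> S\<^sub>3\<close> the type determines the conjugacy class.
\<close>

definition rel_type :: "('g, 'm) monoid_scheme \<Rightarrow> ('g \<times> 'g) set \<Rightarrow> nat" where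
  "rel_type G U = 100 * card (Domain U) + 10 * card {x. (x, \<one>\<^bsub>G\<^esub>) \<in> U} + card (Range U)"

text \<open>An orbit with stabilizer U has |G|^2 / |U| points, each of weight |U|, and conjugate
  stabilizers have the same type. So this is the sum of F over the types of the orbits.\<close>

definition mark :: "('g, 'm) monoid_scheme \<Rightarrow> (nat \<Rightarrow> rat) \<Rightarrow> ('g, 'x) biset \<Rightarrow> rat" where
  "mark G F M = (\<Sum>m\<in>bcarrier M. of_nat (card (stab G M m)) * F (rel_type G (stab G M m))) / of_nat (order G) ^ 2"

definition kernel_meet :: "('g, 'm) monoid_scheme \<Rightarrow> ('g \<times> 'g) set \<Rightarrow> ('g \<times> 'g) set \<Rightarrow> nat" where
  "kernel_meet G U W = card {z. (\<one>\<^bsub>G\<^esub>, z) \<in> U \<and> (z, \<one>\<^bsub>G\<^esub>) \<in> W}"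

text \<open>
  The sum over the double cosets in the Mackey formula, taken over all group elements with
  the weights that account for repetitions.
\<close>

definition mackey_sum :: "('g, 'm) monoid_scheme \<Rightarrow> (nat \<Rightarrow> rat) \<Rightarrow> ('g \<times> 'g) set \<Rightarrow> ('g \<times> 'g) set \<Rightarrow> rat" where
  "mackey_sum G F U W = (\<Sum>h\<in>carrier G. let Y = conj_rel G h \<one>\<^bsub>G\<^esub> W in
     of_nat (kernel_meet G U Y * card (U O Y)) * F (rel_type G (U O Y)))"

lemma stab_iso:
  assumes "inj_on f (bcarrier M)" "is_biset G M" "m \<in> bcarrier M"
    and "\<And>h m. h \<in> carrier G \<Longrightarrow> m \<in> bcarrier M \<Longrightarrow> f (lact M h m) = lact N h (f m)"
    and "\<And>h m. h \<in> carrier G \<Longrightarrow> m \<in> bcarrier M \<Longrightarrow> f (ract M m h) = ract N (f m) h"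
  shows "stab G N (f m) = stab G M m"
  unfolding stab_def using assms(3) inj_onD[OF assms(1)] is_bisetD(2,3)[OF assms(2)]
  by (auto simp: assms(4,5)[symmetric])

lemma mark_iso:
  assumes M: "is_biset G M" and "biset_isomorphic G M N"
  shows "mark G F M = mark G F N"
proof -
  obtain f where f: "bij_betw f (bcarrier M) (bcarrier N)"
    "\<And>h m. h \<in> carrier G \<Longrightarrow> m \<in> bcarrier M \<Longrightarrow> f (lact M h m) = lact N h (f m)"
    "\<And>h m. h \<in> carrier G \<Longrightarrow> m \<in> bcarrier M \<Longrightarrow> f (ract M m h) = ract N (f m) h"
    using assms(2) unfolding biset_isomorphic_def by blast
  have "stab G N (f m) = stab G M m" if "m \<in> bcarrier M" for m
    by (rule stab_iso[OF bij_betw_imp_inj_on[OF f(1)] M that]) (auto simp: f)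
  then show ?thesis
    unfolding mark_def by (subst sum.reindex_bij_betw[OF f(1), symmetric]) simp
qed

lemma mark_sum:
  assumes M: "is_biset G M" and N: "is_biset G N"
  shows "mark G F (biset_sum M N) = mark G F M + mark G F N"
proof -
  have "stab G (biset_sum M N) (Inl m) = stab G M m" "stab G (biset_sum M N) (Inr n) = stab G N n" for m n
    by (auto simp: stab_def biset_sum_def)
  moreover have "bcarrier (biset_sum M N) = bcarrier M <+> bcarrier N"
    by (simp add: biset_sum_def)
  ultimately show ?thesis
    unfolding mark_def using is_bisetD(1)[OF M] is_bisetD(1)[OF N]
    by (simp add: sum.Plus add_divide_distrib)
qed

lemma mark_lincomb:
  "mark G (\<lambda>i. \<Sum>k\<in>K. c k * F k i) M = (\<Sum>k\<in>K. c k * mark G (F k) M)"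
  unfolding mark_def
  by (simp add: sum_distrib_left sum_divide_distrib sum.swap[of _ _ "bcarrier M"] mult.left_commute)

context fin_group
begin

lemma subgroup_stab:
  assumes M: "is_biset G M" and m: "m \<in> bcarrier M"
  shows "subgroup (stab G M m) (G \<times>\<times> G)"
proof -
  interpret GG: group "G \<times>\<times> G" by (intro DirProd_group is_group)
  show ?thesis
  proof (rule GG.subgroupI)
    show "stab G M m \<noteq> {}"
      using m by (auto simp: stab_def is_bisetD[OF M] intro!: exI[of _ \<one>])
  next
    fix p assume "p \<in> stab G M m"
    then obtain h k where p: "p = (h, k)" "h \<in> carrier G" "k \<in> carrier G" "lact M h m = ract M m k"
      by (auto simp: stab_def)
    have 1: "lact M (inv h) (ract M (lact M h m) (inv k)) = lact M (inv h) (ract M (ract M m k) (inv k))"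
      using p by simp
    have 2: "lact M (inv h) (ract M (lact M h m) (inv k)) = ract M m (inv k)"
      using p(2,3) m by (simp add: is_bisetD[OF M])
    have 3: "lact M (inv h) (ract M (ract M m k) (inv k)) = lact M (inv h) m"
      using p(2,3) m by (simp add: is_bisetD(5,7)[OF M])
    have "lact M (inv h) m = ract M m (inv k)"
      using 1 unfolding 2 3 by (rule sym)
    then show "inv\<^bsub>G \<times>\<times> G\<^esub> p \<in> stab G M m"
      using p by (simp add: inv_DirProd[OF is_group is_group] stab_def)
  next
    fix p q assume "p \<in> stab G M m" "q \<in> stab G M m"
    then obtain h k h' k' where p: "p = (h, k)" "h \<in> carrier G" "k \<in> carrier G" "lact M h m = ract M m k"
      and q: "q = (h', k')" "h' \<in> carrier G" "k' \<in> carrier G" "lact M h' m = ract M m k'"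
      by (auto simp: stab_def)
    have "lact M (h \<otimes> h') m = lact M h (ract M m k')"
      using p q m by (simp add: is_bisetD(6)[OF M, symmetric])
    also have "\<dots> = ract M (ract M m k) k'"
      using p q m by (simp add: is_bisetD(8)[OF M, symmetric])
    finally show "p \<otimes>\<^bsub>G \<times>\<times> G\<^esub> q \<in> stab G M m"
      using p q m by (simp add: is_bisetD(7)[OF M] stab_def)
  qed (auto simp: stab_def)
qed

section \<open>Conjugation of relations and the Mackey sum\<close>

lemma conj_rel_conj_rel:
  assumes "g \<in> carrier G" "h \<in> carrier G" "g' \<in> carrier G" "h' \<in> carrier G"
  shows "conj_rel G g h (conj_rel G g' h' U) = conj_rel G (g \<otimes> g') (h \<otimes> h') U"
  using assms by (auto simp: conj_rel_def inv_mult_group m_assoc)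

lemma conj_rel_one: "U \<subseteq> carrier G \<times> carrier G \<Longrightarrow> conj_rel G \<one> \<one> U = U"
  by (auto simp: conj_rel_def)

lemma conj_rel_subset: "conj_rel G g h U \<subseteq> carrier G \<times> carrier G"
  by (auto simp: conj_rel_def)

lemma conj_cancel:
  assumes "c \<in> carrier G" "x \<in> carrier G"
  shows "inv c \<otimes> (c \<otimes> x \<otimes> inv c) \<otimes> c = x" "c \<otimes> (inv c \<otimes> x \<otimes> c) \<otimes> inv c = x"
proof -
  have "inv c \<otimes> (c \<otimes> x \<otimes> inv c) \<otimes> c = inv c \<otimes> c \<otimes> x \<otimes> (inv c \<otimes> c)"
    "c \<otimes> (inv c \<otimes> x \<otimes> c) \<otimes> inv c = c \<otimes> inv c \<otimes> x \<otimes> (c \<otimes> inv c)"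
    using assms by (simp_all only: m_assoc m_closed inv_closed)
  then show "inv c \<otimes> (c \<otimes> x \<otimes> inv c) \<otimes> c = x" "c \<otimes> (inv c \<otimes> x \<otimes> c) \<otimes> inv c = x"
    using assms by simp_all
qed

lemma bij_betw_conj:
  assumes "g \<in> carrier G"
  shows "bij_betw (\<lambda>x. inv g \<otimes> x \<otimes> g) (carrier G) (carrier G)"
  by (rule bij_betwI[of _ _ _ "\<lambda>x. g \<otimes> x \<otimes> inv g"]) (use assms in \<open>auto simp: conj_cancel\<close>)

lemma conj_surj:
  assumes "h \<in> carrier G" "y \<in> carrier G"
  obtains y' where "y' \<in> carrier G" "y = inv h \<otimes> y' \<otimes> h"
  by (rule that[of "h \<otimes> y \<otimes> inv h"]) (use assms in \<open>simp_all add: conj_cancel\<close>)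

lemma card_conj_set:
  assumes "g \<in> carrier G" "S \<subseteq> carrier G"
  shows "card {x \<in> carrier G. inv g \<otimes> x \<otimes> g \<in> S} = card S"
proof (rule bij_betw_same_card)
  show "bij_betw (\<lambda>x. inv g \<otimes> x \<otimes> g) {x \<in> carrier G. inv g \<otimes> x \<otimes> g \<in> S} S"
  proof (rule bij_betw_imageI)
    show "inj_on (\<lambda>x. inv g \<otimes> x \<otimes> g) {x \<in> carrier G. inv g \<otimes> x \<otimes> g \<in> S}"
      by (rule inj_on_subset[OF bij_betw_imp_inj_on[OF bij_betw_conj[OF assms(1)]]]) auto
    show "(\<lambda>x. inv g \<otimes> x \<otimes> g) ` {x \<in> carrier G. inv g \<otimes> x \<otimes> g \<in> S} = S"
    proof (intro equalityI subsetI)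
      fix y assume y: "y \<in> S"
      then obtain x where "x \<in> carrier G" "y = inv g \<otimes> x \<otimes> g"
        using conj_surj[OF assms(1), of y] assms(2) by blast
      then show "y \<in> (\<lambda>x. inv g \<otimes> x \<otimes> g) ` {x \<in> carrier G. inv g \<otimes> x \<otimes> g \<in> S}"
        using y by (intro image_eqI[of _ _ x]) auto
    qed auto
  qed
qed

lemma card_conj_rel:
  assumes g: "g \<in> carrier G" and h: "h \<in> carrier G" and U: "U \<subseteq> carrier G \<times> carrier G"
  shows "card (conj_rel G g h U) = card U"
proof (rule bij_betw_same_card)
  let ?c = "\<lambda>(x, y). (inv g \<otimes> x \<otimes> g, inv h \<otimes> y \<otimes> h)"
  have "(case ?c p of (x, y) \<Rightarrow> (g \<otimes> x \<otimes> inv g, h \<otimes> y \<otimes> inv h)) = p" if "p \<in> conj_rel G g h U" for p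
    using that g h by (auto simp: conj_rel_def conj_cancel)
  moreover have "?c (case p of (x, y) \<Rightarrow> (g \<otimes> x \<otimes> inv g, h \<otimes> y \<otimes> inv h)) = p"
    "(case p of (x, y) \<Rightarrow> (g \<otimes> x \<otimes> inv g, h \<otimes> y \<otimes> inv h)) \<in> conj_rel G g h U" if "p \<in> U" for p
    using that U g h by (auto simp: conj_rel_def conj_cancel)
  ultimately show "bij_betw ?c (conj_rel G g h U) U"
    by (intro bij_betwI[of _ _ _ "\<lambda>(x, y). (g \<otimes> x \<otimes> inv g, h \<otimes> y \<otimes> inv h)"])
      (auto simp: conj_rel_def)
qed

text \<open>First projection and kernel are moved by conjugation with g, the second projection by
  conjugation with h; orders survive. This makes the type an invariant of the conjugacy
  class.\<close>

lemma rel_type_conj_rel: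
  assumes g: "g \<in> carrier G" and h: "h \<in> carrier G" and U: "U \<subseteq> carrier G \<times> carrier G"
  shows "rel_type G (conj_rel G g h U) = rel_type G U"
proof -
  have "Domain (conj_rel G g h U) = {x \<in> carrier G. inv g \<otimes> x \<otimes> g \<in> Domain U}"
  proof (intro equalityI subsetI)
    fix x assume "x \<in> {x \<in> carrier G. inv g \<otimes> x \<otimes> g \<in> Domain U}"
    then obtain y where x: "x \<in> carrier G" "(inv g \<otimes> x \<otimes> g, y) \<in> U" by auto
    moreover obtain y' where "y' \<in> carrier G" "y = inv h \<otimes> y' \<otimes> h"
      using x(2) U conj_surj[OF h, of y] by auto
    ultimately show "x \<in> Domain (conj_rel G g h U)"
      by (auto simp: conj_rel_def)
  qed (auto simp: conj_rel_def)
  then have D: "card (Domain (conj_rel G g h U)) = card (Domain U)"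
    using card_conj_set[OF g, of "Domain U"] U by auto
  have "Range (conj_rel G g h U) = {x \<in> carrier G. inv h \<otimes> x \<otimes> h \<in> Range U}"
  proof (intro equalityI subsetI)
    fix y assume "y \<in> {y \<in> carrier G. inv h \<otimes> y \<otimes> h \<in> Range U}"
    then obtain x where y: "y \<in> carrier G" "(x, inv h \<otimes> y \<otimes> h) \<in> U" by auto
    moreover obtain x' where "x' \<in> carrier G" "x = inv g \<otimes> x' \<otimes> g"
      using y(2) U conj_surj[OF g, of x] by auto
    ultimately show "y \<in> Range (conj_rel G g h U)"
      by (auto simp: conj_rel_def)
  qed (auto simp: conj_rel_def)
  then have R: "card (Range (conj_rel G g h U)) = card (Range U)"
    using card_conj_set[OF h, of "Range U"] U by auto
  have "{x. (x, \<one>) \<in> conj_rel G g h U} = {x \<in> carrier G. inv g \<otimes> x \<otimes> g \<in> {x. (x, \<one>) \<in> U}}"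
    using h by (auto simp: conj_rel_def)
  then have "card {x. (x, \<one>) \<in> conj_rel G g h U} = card {x. (x, \<one>) \<in> U}"
    using card_conj_set[OF g, of "{x. (x, \<one>) \<in> U}"] U by auto
  then show ?thesis
    by (simp add: rel_type_def D R)
qed

text \<open>The middle element is conjugated by the same h on both sides, and conjugation by h is
  onto.\<close>

lemma conj_rel_relcomp:
  assumes g: "g \<in> carrier G" and h: "h \<in> carrier G" and k: "k \<in> carrier G" and U: "U \<subseteq> carrier G \<times> carrier G"
  shows "conj_rel G g h U O conj_rel G h k W = conj_rel G g k (U O W)"
proof (intro equalityI subsetI)
  fix p assume "p \<in> conj_rel G g k (U O W)"
  then obtain x z y where p: "p = (x, z)" "x \<in> carrier G" "z \<in> carrier G"
    "(inv g \<otimes> x \<otimes> g, y) \<in> U" "(y, inv k \<otimes> z \<otimes> k) \<in> W"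
    by (auto simp: conj_rel_def)
  moreover obtain y' where "y' \<in> carrier G" "y = inv h \<otimes> y' \<otimes> h"
    using p(4) U conj_surj[OF h, of y] by auto
  ultimately show "p \<in> conj_rel G g h U O conj_rel G h k W"
    by (auto simp: conj_rel_def)
qed (auto simp: conj_rel_def)

text \<open>The conjugation in the middle is moved from the left factor to the right one; the
  conjugation left outside changes neither order nor type.\<close>

lemma conj_rel_relcomp_left:
  assumes g: "g \<in> carrier G" and h: "h \<in> carrier G" and U: "U \<subseteq> carrier G \<times> carrier G" and W: "W \<subseteq> carrier G \<times> carrier G"
  shows "conj_rel G g h U O W = conj_rel G g \<one> (U O conj_rel G (inv h) \<one> W)"
proof -
  have "W = conj_rel G h \<one> (conj_rel G (inv h) \<one> W)"
    using h by (simp add: conj_rel_conj_rel conj_rel_one[OF W])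
  then show ?thesis
    using conj_rel_relcomp[OF g h one_closed U, of "conj_rel G (inv h) \<one> W"] by simp
qed

lemma kernel_meet_conj:
  assumes g: "g \<in> carrier G" and h: "h \<in> carrier G" and U: "U \<subseteq> carrier G \<times> carrier G" and W: "W \<subseteq> carrier G \<times> carrier G"
  shows "kernel_meet G (conj_rel G g h U) W = kernel_meet G U (conj_rel G (inv h) \<one> W)"
proof -
  let ?S = "{z. (\<one>, z) \<in> U \<and> (z, \<one>) \<in> conj_rel G (inv h) \<one> W}"
  have "h \<otimes> (inv h \<otimes> z \<otimes> h) \<otimes> inv h = z" if "z \<in> carrier G" for z
    using that h by (simp add: m_assoc) (simp add: m_assoc[symmetric])
  then have "{z. (\<one>, z) \<in> conj_rel G g h U \<and> (z, \<one>) \<in> W} = {z \<in> carrier G. inv h \<otimes> z \<otimes> h \<in> ?S}"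
    using g h W by (auto simp: conj_rel_def)
  moreover have "?S \<subseteq> carrier G" using U by auto
  ultimately show ?thesis
    unfolding kernel_meet_def using card_conj_set[OF h, of ?S] by simp
qed

lemma kernel_meet_conj_right:
  assumes k: "k \<in> carrier G" and W: "W \<subseteq> carrier G \<times> carrier G"
  shows "kernel_meet G U (conj_rel G \<one> k W) = kernel_meet G U W"
proof -
  have "(z, \<one>) \<in> conj_rel G \<one> k W \<longleftrightarrow> (z, \<one>) \<in> W" for z
    using k W by (auto simp: conj_rel_def)
  then show ?thesis by (simp add: kernel_meet_def)
qed

lemma sum_mult_right_carrier:
  assumes "g \<in> carrier G"
  shows "(\<Sum>h\<in>carrier G. f (h \<otimes> g)) = (\<Sum>h\<in>carrier G. f h)"
  by (rule sum.reindex_bij_betw, rule bij_betwI[of _ _ _ "\<lambda>x. x \<otimes> inv g"])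
    (use assms in \<open>auto simp: m_assoc\<close>)

lemma sum_inv_carrier: "(\<Sum>h\<in>carrier G. f (inv h)) = (\<Sum>h\<in>carrier G. f h)"
  by (rule sum.reindex_bij_betw, rule bij_betwI[of _ _ _ "\<lambda>x. inv x"]) auto

text \<open>Conjugation by g only shifts the summation index, and conjugation by k acts on the outer
  side, where it affects no order. Hence the right factor may be replaced by the representative of
  its class.\<close>

lemma mackey_sum_conj:
  assumes g: "g \<in> carrier G" and k: "k \<in> carrier G" and U: "U \<subseteq> carrier G \<times> carrier G" and W: "W \<subseteq> carrier G \<times> carrier G"
  shows "mackey_sum G F U (conj_rel G g k W) = mackey_sum G F U W"
proof -
  define f where "f h = (let Y = conj_rel G h \<one> W in
     of_nat (kernel_meet G U Y * card (U O Y)) * F (rel_type G (U O Y)))" for h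
  have "(let Y = conj_rel G h \<one> (conj_rel G g k W) in
     of_nat (kernel_meet G U Y * card (U O Y)) * F (rel_type G (U O Y))) = f (h \<otimes> g)"
    if h: "h \<in> carrier G" for h
  proof -
    have e: "conj_rel G h \<one> (conj_rel G g k W) = conj_rel G \<one> k (conj_rel G (h \<otimes> g) \<one> W)"
      using g h k by (simp add: conj_rel_conj_rel)
    have "U O conj_rel G \<one> k (conj_rel G (h \<otimes> g) \<one> W) = conj_rel G \<one> k (U O conj_rel G (h \<otimes> g) \<one> W)"
      using conj_rel_relcomp[OF one_closed one_closed k U] by (simp add: conj_rel_one[OF U])
    moreover have "U O conj_rel G (h \<otimes> g) \<one> W \<subseteq> carrier G \<times> carrier G"
      using U by (auto simp: conj_rel_def)
    ultimately show ?thesis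
      by (simp add: e f_def Let_def kernel_meet_conj_right[OF k conj_rel_subset] card_conj_rel[OF one_closed k] rel_type_conj_rel[OF one_closed k])
  qed
  then have "mackey_sum G F U (conj_rel G g k W) = (\<Sum>h\<in>carrier G. f (h \<otimes> g))"
    unfolding mackey_sum_def by (intro sum.cong) auto
  also have "\<dots> = mackey_sum G F U W"
    by (simp only: sum_mult_right_carrier[OF g, of f]) (simp add: mackey_sum_def f_def)
  finally show ?thesis .
qed

section \<open>Coset bisets\<close>

context
  fixes U assumes U: "subgroup U (G \<times>\<times> G)"
begin

lemma sub_carrier: "U \<subseteq> carrier G \<times> carrier G"
  using subgroup.subset[OF U] by simp

lemma sub_closed:
  "(\<one>, \<one>) \<in> U"
  "(x, y) \<in> U \<Longrightarrow> (x', y') \<in> U \<Longrightarrow> (x \<otimes> x', y \<otimes> y') \<in> U"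
  "(x, y) \<in> U \<Longrightarrow> (inv x, inv y) \<in> U"
proof -
  show "(\<one>, \<one>) \<in> U" "(x, y) \<in> U \<Longrightarrow> (x', y') \<in> U \<Longrightarrow> (x \<otimes> x', y \<otimes> y') \<in> U"
    using subgroup.one_closed[OF U] subgroup.m_closed[OF U, of "(x, y)" "(x', y')"] by auto
  assume xy: "(x, y) \<in> U"
  then show "(inv x, inv y) \<in> U"
    using subgroup.m_inv_closed[OF U xy] sub_carrier inv_DirProd[OF is_group is_group, of x y] by auto
qed

lemma finite_sub: "finite U"
  using finite_subset[OF sub_carrier] finite_carrier by simp

lemma card_sub_pos: "card U > 0"
  using sub_closed(1) finite_sub by (auto simp: card_gt_0_iff)

lemma l_coset_eq_coset_of:
  assumes "g \<in> carrier G" "h \<in> carrier G"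
  shows "(g, h) <#\<^bsub>G \<times>\<times> G\<^esub> U = coset_of G U g h"
proof (intro equalityI subsetI)
  fix p assume "p \<in> (g, h) <#\<^bsub>G \<times>\<times> G\<^esub> U"
  then obtain x y where "(x, y) \<in> U" "p = (g \<otimes> x, h \<otimes> y)"
    by (auto simp: l_coset_def)
  then show "p \<in> coset_of G U g h"
    using assms sub_carrier by (auto simp: coset_of_def m_assoc[symmetric])
next
  fix p assume "p \<in> coset_of G U g h"
  then obtain x y where p: "p = (x, y)" "x \<in> carrier G" "y \<in> carrier G" "(inv g \<otimes> x, inv h \<otimes> y) \<in> U"
    by (auto simp: coset_of_def)
  then have "p = (g, h) \<otimes>\<^bsub>G \<times>\<times> G\<^esub> (inv g \<otimes> x, inv h \<otimes> y)"
    using assms by (simp add: m_assoc[symmetric])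
  then show "p \<in> (g, h) <#\<^bsub>G \<times>\<times> G\<^esub> U"
    using p(4) unfolding l_coset_def by blast
qed

lemma carrier_coset: "bcarrier (coset_biset G U) = {coset_of G U g h | g h. g \<in> carrier G \<and> h \<in> carrier G}"
proof -
  have "lcosets\<^bsub>G \<times>\<times> G\<^esub> U = {(g, h) <#\<^bsub>G \<times>\<times> G\<^esub> U | g h. g \<in> carrier G \<and> h \<in> carrier G}"
    by (auto simp: LCOSETS_def)
  also have "\<dots> = {coset_of G U g h | g h. g \<in> carrier G \<and> h \<in> carrier G}"
    by (intro Collect_cong ex_cong1) (auto simp: l_coset_eq_coset_of)
  finally show ?thesis
    by (simp add: coset_biset_def biset_of_left_set_def)
qed

lemma l_coset_coset_of:
  assumes "g \<in> carrier G" "h \<in> carrier G" "a \<in> carrier G" "b \<in> carrier G"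
  shows "(a, b) <#\<^bsub>G \<times>\<times> G\<^esub> coset_of G U g h = coset_of G U (a \<otimes> g) (b \<otimes> h)"
proof -
  interpret GG: group "G \<times>\<times> G" by (intro DirProd_group is_group)
  have "(a, b) <#\<^bsub>G \<times>\<times> G\<^esub> ((g, h) <#\<^bsub>G \<times>\<times> G\<^esub> U) = ((a, b) \<otimes>\<^bsub>G \<times>\<times> G\<^esub> (g, h)) <#\<^bsub>G \<times>\<times> G\<^esub> U"
    by (rule GG.lcos_m_assoc) (use assms sub_carrier in auto)
  then show ?thesis
    using assms by (simp add: l_coset_eq_coset_of)
qed

lemma act_coset:
  assumes "g \<in> carrier G" "h \<in> carrier G" "k \<in> carrier G"
  shows "lact (coset_biset G U) k (coset_of G U g h) = coset_of G U (k \<otimes> g) h"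
    and "ract (coset_biset G U) (coset_of G U g h) k = coset_of G U g (inv k \<otimes> h)"
  using assms by (simp_all add: coset_biset_def biset_of_left_set_def l_coset_coset_of)

lemma coset_of_eq_iff:
  assumes "g \<in> carrier G" "h \<in> carrier G" "g' \<in> carrier G" "h' \<in> carrier G"
  shows "coset_of G U g h = coset_of G U g' h' \<longleftrightarrow> (inv g \<otimes> g', inv h \<otimes> h') \<in> U"
proof
  have "(g', h') \<in> coset_of G U g' h'"
    using assms sub_closed(1) by (simp add: coset_of_def)
  then show "coset_of G U g h = coset_of G U g' h' \<Longrightarrow> (inv g \<otimes> g', inv h \<otimes> h') \<in> U"
    by (auto simp: coset_of_def)
next
  assume a: "(inv g \<otimes> g', inv h \<otimes> h') \<in> U"
  have c: "inv c \<otimes> x = (inv c \<otimes> d) \<otimes> (inv d \<otimes> x)" if "x \<in> carrier G" "c \<in> carrier G" "d \<in> carrier G" for x c d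
    using that by (metis inv_closed inv_solve_left m_assoc m_closed)
  have i: "inv g' \<otimes> g = inv (inv g \<otimes> g')" "inv h' \<otimes> h = inv (inv h \<otimes> h')"
    using assms by (simp_all add: inv_mult_group)
  show "coset_of G U g h = coset_of G U g' h'"
  proof (intro equalityI subsetI)
    fix p assume "p \<in> coset_of G U g h"
    then obtain x y where p: "p = (x, y)" "x \<in> carrier G" "y \<in> carrier G" "(inv g \<otimes> x, inv h \<otimes> y) \<in> U"
      by (auto simp: coset_of_def)
    have "(inv g' \<otimes> g \<otimes> (inv g \<otimes> x), inv h' \<otimes> h \<otimes> (inv h \<otimes> y)) \<in> U"
      unfolding i by (rule sub_closed(2)[OF sub_closed(3)[OF a] p(4)])
    then show "p \<in> coset_of G U g' h'"
      using p assms c[of x g' g] c[of y h' h] by (simp add: coset_of_def)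
  next
    fix p assume "p \<in> coset_of G U g' h'"
    then obtain x y where p: "p = (x, y)" "x \<in> carrier G" "y \<in> carrier G" "(inv g' \<otimes> x, inv h' \<otimes> y) \<in> U"
      by (auto simp: coset_of_def)
    have "(inv g \<otimes> g' \<otimes> (inv g' \<otimes> x), inv h \<otimes> h' \<otimes> (inv h' \<otimes> y)) \<in> U"
      by (rule sub_closed(2)[OF a p(4)])
    then show "p \<in> coset_of G U g h"
      using p assms c[of x g g'] c[of y h h'] by (simp add: coset_of_def)
  qed
qed

lemma is_biset_coset: "is_biset G (coset_biset G U)"
proof -
  have "bcarrier (coset_biset G U) = (\<lambda>(g, h). coset_of G U g h) ` (carrier G \<times> carrier G)"
    by (auto simp: carrier_coset)
  then have fin: "finite (bcarrier (coset_biset G U))"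
    using finite_carrier by simp
  have I: "coset_of G U g h \<in> bcarrier (coset_biset G U)" if "g \<in> carrier G" "h \<in> carrier G" for g h
    using that by (auto simp: carrier_coset)
  have E: thesis if "X \<in> bcarrier (coset_biset G U)"
    "\<And>g h. g \<in> carrier G \<Longrightarrow> h \<in> carrier G \<Longrightarrow> X = coset_of G U g h \<Longrightarrow> thesis" for X thesis
    using that by (auto simp: carrier_coset)
  show ?thesis
    by (rule is_bisetI[OF fin]; erule E) (simp_all add: act_coset I m_assoc[symmetric] inv_mult_group)
qed

lemma stab_coset:
  assumes g: "g \<in> carrier G" and h: "h \<in> carrier G"
  shows "stab G (coset_biset G U) (coset_of G U g h) = conj_rel G g h U"
proof -
  \<comment> \<open>The right action of a left G x G-set carries an inverse, so equality of the
    cosets asks for the inverses of the conjugated elements to lie in U.\<close>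
  have "(inv (x \<otimes> g) \<otimes> g, inv h \<otimes> (inv y \<otimes> h)) \<in> U \<longleftrightarrow> (inv g \<otimes> x \<otimes> g, inv h \<otimes> y \<otimes> h) \<in> U"
    if "x \<in> carrier G" "y \<in> carrier G" for x y
  proof -
    have "inv (x \<otimes> g) \<otimes> g = inv (inv g \<otimes> x \<otimes> g)" "inv h \<otimes> (inv y \<otimes> h) = inv (inv h \<otimes> y \<otimes> h)"
      using that g h by (simp_all add: inv_mult_group m_assoc)
    then show ?thesis
      using sub_closed(3)[of "inv g \<otimes> x \<otimes> g" "inv h \<otimes> y \<otimes> h"]
        sub_closed(3)[of "inv (inv g \<otimes> x \<otimes> g)" "inv (inv h \<otimes> y \<otimes> h)"] that g h by auto
  qed
  then show ?thesis
    unfolding stab_def conj_rel_def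
    by (intro Collect_cong) (simp add: case_prod_unfold act_coset[OF g h] coset_of_eq_iff[OF _ h g] g h cong: conj_cong)
qed

lemma card_coset_of:
  assumes "g \<in> carrier G" "h \<in> carrier G"
  shows "card {p \<in> carrier G \<times> carrier G. (case p of (g', h') \<Rightarrow> coset_of G U g' h') = coset_of G U g h} = card U"
proof -
  have "{p \<in> carrier G \<times> carrier G. (case p of (g', h') \<Rightarrow> coset_of G U g' h') = coset_of G U g h}
      = {p \<in> carrier G \<times> carrier G. (inv g \<otimes> fst p, inv h \<otimes> snd p) \<in> U}"
    by (intro Collect_cong) (simp add: case_prod_unfold mem_Times_iff eq_commute[of _ "coset_of G U g h"] coset_of_eq_iff[OF assms] cong: conj_cong)
  moreover have "bij_betw (\<lambda>p. (inv g \<otimes> fst p, inv h \<otimes> snd p))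
    {p \<in> carrier G \<times> carrier G. (inv g \<otimes> fst p, inv h \<otimes> snd p) \<in> U} U"
    by (rule bij_betwI[of _ _ _ "\<lambda>p. (g \<otimes> fst p, h \<otimes> snd p)"])
      (use assms sub_carrier in \<open>auto simp: m_assoc[symmetric]\<close>)
  ultimately show ?thesis
    by (simp add: bij_betw_same_card)
qed

text \<open>Each coset comes from |U| pairs (g, h), which turns a sum over cosets into a sum over
  all pairs.\<close>

lemma sum_coset_biset:
  fixes f :: "('a \<times> 'a) set \<Rightarrow> rat"
  shows "(\<Sum>C\<in>bcarrier (coset_biset G U). f C) = (\<Sum>g\<in>carrier G. \<Sum>h\<in>carrier G. f (coset_of G U g h)) / of_nat (card U)"
proof -
  let ?c = "\<lambda>(g, h). coset_of G U g h" and ?GG = "carrier G \<times> carrier G"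
  have "(\<Sum>p\<in>?GG. f (?c p)) = (\<Sum>C\<in>bcarrier (coset_biset G U). \<Sum>p\<in>{p \<in> ?GG. ?c p = C}. f (?c p))"
    by (rule sum.group[symmetric]) (use is_bisetD(1)[OF is_biset_coset] in \<open>auto simp: finite_carrier carrier_coset\<close>)
  also have "\<dots> = (\<Sum>C\<in>bcarrier (coset_biset G U). of_nat (card U) * f C)"
    by (rule sum.cong) (auto simp: carrier_coset card_coset_of)
  also have "\<dots> = of_nat (card U) * (\<Sum>C\<in>bcarrier (coset_biset G U). f C)"
    by (simp add: sum_distrib_left)
  finally show ?thesis
    using card_sub_pos by (simp add: sum.cartesian_product case_prod_unfold)
qed

lemma mark_coset: "mark G F (coset_biset G U) = F (rel_type G U)"
proof -
  have "(\<Sum>C\<in>bcarrier (coset_biset G U). of_nat (card (stab G (coset_biset G U) C)) * F (rel_type G (stab G (coset_biset G U) C)))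
    = (\<Sum>g\<in>carrier G. \<Sum>h\<in>carrier G. of_nat (card U) * F (rel_type G U)) / of_nat (card U)"
    unfolding sum_coset_biset
    by (intro arg_cong2[of _ _ _ _ "(/)"] sum.cong refl)
      (simp add: stab_coset card_conj_rel sub_carrier rel_type_conj_rel)
  then show ?thesis
    using card_sub_pos order_gt_0_iff_finite finite_carrier
    by (simp add: mark_def order_def power2_eq_square card_gt_0_iff)
qed

end

section \<open>Stabilizers and marks of tensor products\<close>

lemma stab_tensor:
  assumes M: "is_biset G M" and N: "is_biset G N" and m: "m \<in> bcarrier M" and n: "n \<in> bcarrier N"
  shows "stab G (biset_tensor G M N) (tensor_orbit G M N m n) = stab G M m O stab G N n"
proof -
  \<comment> \<open>The element g that moves across the tensor sign is the middle element of the
    relational composition.\<close>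
  have "lact (biset_tensor G M N) h (tensor_orbit G M N m n) = ract (biset_tensor G M N) (tensor_orbit G M N m n) k
    \<longleftrightarrow> (\<exists>g\<in>carrier G. lact M h m = ract M m g \<and> ract N n k = lact N g n)"
    if "h \<in> carrier G" "k \<in> carrier G" for h k
    using that m n
    by (simp add: lact_tensor[OF M N] ract_tensor[OF M N] tensor_orbit_eq_iff[OF M N] is_bisetD[OF M] is_bisetD[OF N])
  then have "stab G (biset_tensor G M N) (tensor_orbit G M N m n) = {(h, k). h \<in> carrier G \<and> k \<in> carrier G \<and>
      (\<exists>g\<in>carrier G. lact M h m = ract M m g \<and> ract N n k = lact N g n)}"
    unfolding stab_def by (intro Collect_cong) (simp add: case_prod_unfold cong: conj_cong)
  also have "\<dots> = stab G M m O stab G N n"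
    unfolding stab_def relcomp_unfold by (intro Collect_cong) (auto simp: eq_commute)
  finally show ?thesis .
qed

text \<open>Orbit-stabilizer: the fibres of g -> (m g^-1, g n) are the left cosets of the group K of
  all z with m z = m and z n = n, and K is what \<open>kernel_meet\<close> counts.\<close>

lemma card_tensor_orbit:
  assumes M: "is_biset G M" and N: "is_biset G N" and m: "m \<in> bcarrier M" and n: "n \<in> bcarrier N"
  shows "card (tensor_orbit G M N m n) * kernel_meet G (stab G M m) (stab G N n) = order G"
proof -
  let ?\<phi> = "\<lambda>g. (ract M m (inv g), lact N g n)"
  define K where "K = {z \<in> carrier G. ract M m z = m \<and> lact N z n = n}"
  have K: "{z. (\<one>, z) \<in> stab G M m \<and> (z, \<one>) \<in> stab G N n} = K"
    using m n by (auto simp: stab_def K_def is_bisetD(4)[OF M] is_bisetD(5)[OF N])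
  have fib: "card {g \<in> carrier G. ?\<phi> g = ?\<phi> g0} = card K" if g0: "g0 \<in> carrier G" for g0
  proof (rule bij_betw_same_card)
    have "ract M m (inv g) = ract M m (inv g0) \<longleftrightarrow> ract M m (inv g0 \<otimes> g) = m" if g: "g \<in> carrier G" for g
    proof
      assume "ract M m (inv g) = ract M m (inv g0)"
      then have "ract M (ract M m (inv g)) g = ract M (ract M m (inv g0)) g" by simp
      then show "ract M m (inv g0 \<otimes> g) = m"
        using m g g0 by (simp add: is_bisetD(5,7)[OF M])
    next
      assume "ract M m (inv g0 \<otimes> g) = m"
      then have "ract M (ract M m (inv g0 \<otimes> g)) (inv g) = ract M m (inv g)" by simp
      then show "ract M m (inv g) = ract M m (inv g0)"
        using m g g0 by (simp add: is_bisetD(5,7)[OF M] m_assoc)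
    qed
    moreover have "lact N g n = lact N g0 n \<longleftrightarrow> lact N (inv g0 \<otimes> g) n = n" if g: "g \<in> carrier G" for g
    proof
      assume "lact N g n = lact N g0 n"
      then have "lact N (inv g0) (lact N g n) = lact N (inv g0) (lact N g0 n)" by simp
      then show "lact N (inv g0 \<otimes> g) n = n"
        using n g g0 by (simp add: is_bisetD(4,6)[OF N])
    next
      assume "lact N (inv g0 \<otimes> g) n = n"
      then have "lact N g0 (lact N (inv g0 \<otimes> g) n) = lact N g0 n" by simp
      then show "lact N g n = lact N g0 n"
        using n g g0 by (simp add: is_bisetD(4,6)[OF N] m_assoc[symmetric])
    qed
    ultimately show "bij_betw (\<lambda>g. inv g0 \<otimes> g) {g \<in> carrier G. ?\<phi> g = ?\<phi> g0} K"
      using g0 by (intro bij_betwI[of _ _ _ "\<lambda>z. g0 \<otimes> z"]) (auto simp: K_def m_assoc[symmetric])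
  qed
  have "order G = (\<Sum>p\<in>tensor_orbit G M N m n. card {g \<in> carrier G. ?\<phi> g = p})"
    using sum.group[of "carrier G" "tensor_orbit G M N m n" ?\<phi> "\<lambda>_. 1::nat"] finite_carrier
    by (simp add: tensor_orbit_def order_def)
  also have "\<dots> = (\<Sum>p\<in>tensor_orbit G M N m n. card K)"
    by (rule sum.cong[OF refl]) (auto simp: tensor_orbit_def simp del: prod.inject intro!: fib)
  finally show ?thesis
    by (simp add: kernel_meet_def K)
qed

text \<open>A point X of the tensor product is a set of pairs, so a sum over points is a sum over
  all pairs with weight 1/|X|, which is the kernel order divided by |G|. This brings the power of
  |G| from two to three.\<close>

lemma mark_tensor:
  assumes M: "is_biset G M" and N: "is_biset G N"
  shows "mark G F (biset_tensor G M N) = (\<Sum>m\<in>bcarrier M. \<Sum>n\<in>bcarrier N.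
    of_nat (kernel_meet G (stab G M m) (stab G N n) * card (stab G M m O stab G N n)) *
      F (rel_type G (stab G M m O stab G N n))) / of_nat (order G) ^ 3"
proof -
  let ?P = "bcarrier M \<times> bcarrier N" and ?B = "biset_tensor G M N"
  define o' where "o' p = (case p of (m, n) \<Rightarrow> tensor_orbit G M N m n)" for p
  define \<kappa> where "\<kappa> p = (case p of (m, n) \<Rightarrow> kernel_meet G (stab G M m) (stab G N n))" for p
  define f where "f X = of_nat (card (stab G ?B X)) * F (rel_type G (stab G ?B X))" for X
  have G0: "of_nat (order G) \<noteq> (0::rat)"
    using order_gt_0_iff_finite finite_carrier by simp
  have mem: "p \<in> o' p" if "p \<in> ?P" for p
    using that tensor_orbit_self[OF M N] by (auto simp: o'_def)
  have fib: "{p \<in> ?P. o' p = X} = X" if "X \<in> bcarrier ?B" for X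
  proof -
    obtain m n where X: "X = tensor_orbit G M N m n" and mn: "m \<in> bcarrier M" "n \<in> bcarrier N"
      using \<open>X \<in> bcarrier ?B\<close> by (auto simp: carrier_tensor)
    have "p \<in> ?P \<and> o' p = X" if p: "p \<in> X" for p
    proof -
      obtain g where g: "g \<in> carrier G" "p = (ract M m (inv g), lact N g n)"
        using p by (auto simp: X tensor_orbit_def)
      then have "o' p = tensor_orbit G M N m (lact N (inv g) (lact N g n))"
        using mn by (simp add: o'_def tensor_orbit_eq[OF M N] is_bisetD(2)[OF N])
      then show ?thesis
        using mn g by (simp add: X is_bisetD[OF M] is_bisetD[OF N])
    qed
    then show ?thesis using mem by blast
  qed
  have "(\<Sum>p\<in>?P. of_nat (\<kappa> p) / of_nat (order G) * f (o' p))
      = (\<Sum>X\<in>bcarrier ?B. \<Sum>p\<in>{p \<in> ?P. o' p = X}. of_nat (\<kappa> p) / of_nat (order G) * f (o' p))"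
    by (rule sum.group[symmetric])
      (use is_bisetD(1)[OF M] is_bisetD(1)[OF N] is_bisetD(1)[OF is_biset_tensor[OF M N]] in \<open>auto simp: o'_def carrier_tensor\<close>)
  also have "\<dots> = (\<Sum>X\<in>bcarrier ?B. f X)"
  proof (rule sum.cong[OF refl])
    fix X assume X: "X \<in> bcarrier ?B"
    \<comment> \<open>The weight of each pair is 1/|X|, by \<open>card_tensor_orbit\<close>.\<close>
    have "of_nat (\<kappa> p) / of_nat (order G) * f (o' p) = f X / of_nat (card X)" if "p \<in> {p \<in> ?P. o' p = X}" for p
    proof -
      have "card X * \<kappa> p = order G"
        using that card_tensor_orbit[OF M N] by (auto simp: o'_def \<kappa>_def)
      then have "of_nat (card X) * of_nat (\<kappa> p) = (of_nat (order G) :: rat)"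
        by (metis of_nat_mult)
      moreover from this have "of_nat (card X) \<noteq> (0::rat)"
        using G0 by (metis mult_zero_left)
      moreover have "o' p = X"
        using that by simp
      ultimately show ?thesis
        using G0 by (simp add: divide_simps mult_ac)
    qed
    then have "(\<Sum>p\<in>{p \<in> ?P. o' p = X}. of_nat (\<kappa> p) / of_nat (order G) * f (o' p)) = of_nat (card X) * (f X / of_nat (card X))"
      by (simp add: fib[OF X])
    moreover have "card X \<noteq> 0"
    proof -
      have "finite X"
        using fib[OF X] is_bisetD(1)[OF M] is_bisetD(1)[OF N] by (metis (no_types, lifting) finite_SigmaI finite_subset mem_Collect_eq subsetI)
      moreover have "X \<noteq> {}"
        using X mem by (auto simp: carrier_tensor tensor_orbit_def)
      ultimately show ?thesis by simp
    qed
    ultimately show "(\<Sum>p\<in>{p \<in> ?P. o' p = X}. of_nat (\<kappa> p) / of_nat (order G) * f (o' p)) = f X"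
      by simp
  qed
  finally have "(\<Sum>X\<in>bcarrier ?B. f X) = (\<Sum>p\<in>?P. of_nat (\<kappa> p) * f (o' p)) / of_nat (order G)"
    by (simp add: sum_divide_distrib)
  also have "(\<Sum>p\<in>?P. of_nat (\<kappa> p) * f (o' p)) = (\<Sum>m\<in>bcarrier M. \<Sum>n\<in>bcarrier N.
    of_nat (kernel_meet G (stab G M m) (stab G N n) * card (stab G M m O stab G N n)) *
      F (rel_type G (stab G M m O stab G N n)))"
    unfolding sum.cartesian_product
    by (rule sum.cong) (auto simp: f_def o'_def \<kappa>_def stab_tensor[OF M N])
  finally show ?thesis
    by (simp add: mark_def f_def power3_eq_cube power2_eq_square)
qed

text \<open>The points of a transitive left factor have the conjugates of U as stabilizers. The
  conjugation by g is invisible, the one by h is passed to the right factor as its inverse, and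
  summing over h gives the Mackey sum.\<close>

lemma mark_coset_tensor:
  assumes U: "subgroup U (G \<times>\<times> G)" and N: "is_biset G N"
  shows "mark G F (biset_tensor G (coset_biset G U) N) =
    (\<Sum>n\<in>bcarrier N. mackey_sum G F U (stab G N n)) / (of_nat (card U) * of_nat (order G) ^ 2)"
proof -
  define w where "w U W = of_nat (kernel_meet G U W * card (U O W)) * F (rel_type G (U O W))" for U W
  note UC = sub_carrier[OF U]
  have w: "w (conj_rel G g h U) W = w U (conj_rel G (inv h) \<one> W)"
    if "g \<in> carrier G" "h \<in> carrier G" and W: "W \<subseteq> carrier G \<times> carrier G" for g h W
  proof -
    have "U O conj_rel G (inv h) \<one> W \<subseteq> carrier G \<times> carrier G"
      using UC by (auto simp: conj_rel_def)
    then show ?thesis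
      using that by (simp add: w_def conj_rel_relcomp_left[OF _ _ UC W] kernel_meet_conj[OF _ _ UC W]
          card_conj_rel rel_type_conj_rel)
  qed
  have G0: "of_nat (order G) \<noteq> (0::rat)"
    using order_gt_0_iff_finite finite_carrier by simp
  have "(\<Sum>m\<in>bcarrier (coset_biset G U). w (stab G (coset_biset G U) m) W) = of_nat (order G) * mackey_sum G F U W / of_nat (card U)"
    if W: "W \<subseteq> carrier G \<times> carrier G" for W
  proof -
    have "(\<Sum>m\<in>bcarrier (coset_biset G U). w (stab G (coset_biset G U) m) W)
      = (\<Sum>g\<in>carrier G. \<Sum>h\<in>carrier G. w U (conj_rel G (inv h) \<one> W)) / of_nat (card U)"
      unfolding sum_coset_biset[OF U]
      by (intro arg_cong2[of _ _ _ _ "(/)"] sum.cong refl) (simp add: stab_coset[OF U] w W)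
    also have "\<dots> = of_nat (order G) * (\<Sum>h\<in>carrier G. w U (conj_rel G h \<one> W)) / of_nat (card U)"
      by (simp only: sum_inv_carrier[of "\<lambda>h. w U (conj_rel G h \<one> W)"] sum_constant order_def)
    finally show ?thesis
      by (simp add: mackey_sum_def w_def Let_def)
  qed
  moreover have "stab G N n \<subseteq> carrier G \<times> carrier G" for n
    by (auto simp: stab_def)
  ultimately have "(\<Sum>m\<in>bcarrier (coset_biset G U). \<Sum>n\<in>bcarrier N. w (stab G (coset_biset G U) m) (stab G N n))
      = (\<Sum>n\<in>bcarrier N. of_nat (order G) * mackey_sum G F U (stab G N n) / of_nat (card U))"
    by (subst sum.swap) simp
  then show ?thesis
    using G0 unfolding mark_tensor[OF is_biset_coset[OF U] N] w_def
    by (simp add: sum_distrib_left[symmetric] sum_divide_distrib[symmetric] power3_eq_cube power2_eq_square)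
qed

section \<open>Transitive bisets and splitting off an orbit\<close>

lemma transitive_biset:
  assumes M: "is_biset G M" and m: "m \<in> bcarrier M"
    and trans: "\<And>x. x \<in> bcarrier M \<Longrightarrow> \<exists>a\<in>carrier G. \<exists>b\<in>carrier G. x = lact M a (ract M m (inv b))"
  shows "biset_isomorphic G M (coset_biset G (stab G M m))"
proof -
  note U = subgroup_stab[OF M m]
  \<comment> \<open>For x = a m b^-1 this is the coset of (a, b) modulo the stabilizer of m; no
    choice of a and b enters the definition.\<close>
  define f where "f x = {(h, k). h \<in> carrier G \<and> k \<in> carrier G \<and> lact M h m = ract M x k}" for x
  have f: "f (lact M a (ract M m (inv b))) = coset_of G (stab G M m) a b" if ab: "a \<in> carrier G" "b \<in> carrier G" for a b
  proof -
    have "lact M h m = ract M (lact M a (ract M m (inv b))) k \<longleftrightarrow> lact M (inv a \<otimes> h) m = ract M m (inv b \<otimes> k)"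
      if hk: "h \<in> carrier G" "k \<in> carrier G" for h k
    proof
      assume "lact M h m = ract M (lact M a (ract M m (inv b))) k"
      then have "lact M (inv a) (lact M h m) = lact M (inv a) (ract M (lact M a (ract M m (inv b))) k)" by simp
      then show "lact M (inv a \<otimes> h) m = ract M m (inv b \<otimes> k)"
        using ab hk m by (simp add: is_bisetD[OF M])
    next
      assume "lact M (inv a \<otimes> h) m = ract M m (inv b \<otimes> k)"
      then have "lact M a (lact M (inv a \<otimes> h) m) = lact M a (ract M m (inv b \<otimes> k))" by simp
      then show "lact M h m = ract M (lact M a (ract M m (inv b))) k"
        using ab hk m by (simp add: is_bisetD[OF M] m_assoc[symmetric])
    qed
    then show ?thesis
      using ab by (auto simp: f_def coset_of_def stab_def)
  qed
  show ?thesis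
  proof (rule biset_isomorphicI[of f])
    show "bij_betw f (bcarrier M) (bcarrier (coset_biset G (stab G M m)))"
    proof (rule bij_betw_imageI)
      show "inj_on f (bcarrier M)"
      proof (rule inj_onI)
        fix x y assume x: "x \<in> bcarrier M" and y: "y \<in> bcarrier M" and eq: "f x = f y"
        obtain a b where ab: "a \<in> carrier G" "b \<in> carrier G" "x = lact M a (ract M m (inv b))"
          using trans[OF x] by blast
        have "(a, b) \<in> f x"
          using ab m by (simp add: f_def is_bisetD[OF M])
        then have "lact M a m = ract M y b"
          unfolding eq by (simp add: f_def)
        then have "ract M (lact M a m) (inv b) = ract M (ract M y b) (inv b)" by simp
        then show "x = y"
          using ab m y by (simp add: is_bisetD[OF M])
      qed
      show "f ` bcarrier M = bcarrier (coset_biset G (stab G M m))"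
      proof (intro equalityI subsetI)
        fix C assume "C \<in> f ` bcarrier M"
        then show "C \<in> bcarrier (coset_biset G (stab G M m))"
          using trans f by (fastforce simp: carrier_coset[OF U])
      next
        fix C assume "C \<in> bcarrier (coset_biset G (stab G M m))"
        then obtain a b where ab: "a \<in> carrier G" "b \<in> carrier G" "C = coset_of G (stab G M m) a b"
          by (auto simp: carrier_coset[OF U])
        then show "C \<in> f ` bcarrier M"
          using f[OF ab(1,2)] m is_bisetD(2,3)[OF M] by (metis imageI inv_closed)
      qed
    qed
  next
    fix h x assume h: "h \<in> carrier G" and x: "x \<in> bcarrier M"
    obtain a b where ab: "a \<in> carrier G" "b \<in> carrier G" "x = lact M a (ract M m (inv b))"
      using trans[OF x] by blast
    have "lact M h x = lact M (h \<otimes> a) (ract M m (inv b))" "ract M x h = lact M a (ract M m (inv (inv h \<otimes> b)))"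
      using ab h m by (simp_all add: is_bisetD[OF M] inv_mult_group)
    then show "f (lact M h x) = lact (coset_biset G (stab G M m)) h (f x)"
      "f (ract M x h) = ract (coset_biset G (stab G M m)) (f x) h"
      using ab h by (simp_all add: f act_coset[OF U])
  qed
qed

text \<open>Any point of a transitive biset can serve as base point, and the coset of (g, h) has the
  conjugate of U as its stabilizer.\<close>

lemma coset_biset_conj:
  assumes U: "subgroup U (G \<times>\<times> G)" and g: "g \<in> carrier G" and h: "h \<in> carrier G"
  shows "biset_isomorphic G (coset_biset G U) (coset_biset G (conj_rel G g h U))"
proof -
  have "biset_isomorphic G (coset_biset G U) (coset_biset G (stab G (coset_biset G U) (coset_of G U g h)))"
  proof (rule transitive_biset[OF is_biset_coset[OF U]])
    show "coset_of G U g h \<in> bcarrier (coset_biset G U)"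
      using g h by (auto simp: carrier_coset[OF U])
    fix C assume "C \<in> bcarrier (coset_biset G U)"
    then obtain a b where ab: "a \<in> carrier G" "b \<in> carrier G" "C = coset_of G U a b"
      by (auto simp: carrier_coset[OF U])
    then show "\<exists>x\<in>carrier G. \<exists>y\<in>carrier G.
        C = lact (coset_biset G U) x (ract (coset_biset G U) (coset_of G U g h) (inv y))"
      using g h by (intro bexI[of _ "a \<otimes> inv g"] bexI[of _ "b \<otimes> inv h"]) (simp_all add: act_coset[OF U] m_assoc)
  qed
  then show ?thesis
    by (simp add: stab_coset[OF U g h])
qed

lemma biset_split:
  assumes M: "is_biset G M" and S: "S \<subseteq> bcarrier M"
    and cl: "\<And>x h. x \<in> bcarrier M \<Longrightarrow> h \<in> carrier G \<Longrightarrow> lact M h x \<in> S \<longleftrightarrow> x \<in> S"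
      "\<And>x h. x \<in> bcarrier M \<Longrightarrow> h \<in> carrier G \<Longrightarrow> ract M x h \<in> S \<longleftrightarrow> x \<in> S"
  shows "is_biset G (M\<lparr>bcarrier := S\<rparr>)" "is_biset G (M\<lparr>bcarrier := bcarrier M - S\<rparr>)"
    "biset_isomorphic G M (biset_sum (M\<lparr>bcarrier := S\<rparr>) (M\<lparr>bcarrier := bcarrier M - S\<rparr>))"
proof -
  have sub: "x \<in> bcarrier M" if "x \<in> S" for x using that S by blast
  show "is_biset G (M\<lparr>bcarrier := S\<rparr>)"
    by (rule is_bisetI) (use finite_subset[OF S is_bisetD(1)[OF M]] in \<open>auto simp: sub cl is_bisetD[OF M]\<close>)
  show "is_biset G (M\<lparr>bcarrier := bcarrier M - S\<rparr>)"
    by (rule is_bisetI) (auto simp: cl is_bisetD[OF M])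
  show "biset_isomorphic G M (biset_sum (M\<lparr>bcarrier := S\<rparr>) (M\<lparr>bcarrier := bcarrier M - S\<rparr>))"
  proof (rule biset_isomorphicI[of "\<lambda>x. if x \<in> S then Inl x else Inr x"])
    show "bij_betw (\<lambda>x. if x \<in> S then Inl x else Inr x) (bcarrier M)
      (bcarrier (biset_sum (M\<lparr>bcarrier := S\<rparr>) (M\<lparr>bcarrier := bcarrier M - S\<rparr>)))"
      using S by (intro bij_betwI[of _ _ _ "case_sum id id"]) (auto simp: biset_sum_def split: if_splits)
  qed (auto simp: biset_sum_def cl)
qed

lemma orbit_closed:
  assumes M: "is_biset G M" and m: "m \<in> bcarrier M"
  defines "S \<equiv> {lact M a (ract M m (inv b)) | a b. a \<in> carrier G \<and> b \<in> carrier G}"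
  shows "S \<subseteq> bcarrier M" "m \<in> S"
    and "x \<in> bcarrier M \<Longrightarrow> h \<in> carrier G \<Longrightarrow> lact M h x \<in> S \<longleftrightarrow> x \<in> S"
    and "x \<in> bcarrier M \<Longrightarrow> h \<in> carrier G \<Longrightarrow> ract M x h \<in> S \<longleftrightarrow> x \<in> S"
proof -
  show S: "S \<subseteq> bcarrier M"
    using m by (auto simp: S_def is_bisetD[OF M])
  show "m \<in> S"
    unfolding S_def using m by (intro CollectI exI[of _ \<one>]) (simp add: is_bisetD[OF M])
  have l: "lact M h x \<in> S" if xS: "x \<in> S" and "h \<in> carrier G" for x h
  proof -
    obtain a b where ab: "a \<in> carrier G" "b \<in> carrier G" "x = lact M a (ract M m (inv b))"
      using xS by (auto simp: S_def)
    then have "lact M h x = lact M (h \<otimes> a) (ract M m (inv b))"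
      using that m by (simp add: is_bisetD[OF M])
    then show ?thesis using ab that unfolding S_def by blast
  qed
  have r: "ract M x h \<in> S" if xS: "x \<in> S" and "h \<in> carrier G" for x h
  proof -
    obtain a b where ab: "a \<in> carrier G" "b \<in> carrier G" "x = lact M a (ract M m (inv b))"
      using xS by (auto simp: S_def)
    then have "ract M x h = lact M a (ract M m (inv (inv h \<otimes> b)))"
      using that m by (simp add: is_bisetD[OF M] inv_mult_group)
    then show ?thesis using ab that unfolding S_def by blast
  qed
  assume x: "x \<in> bcarrier M" and h: "h \<in> carrier G"
  have "lact M (inv h) (lact M h x) = x" "ract M (ract M x h) (inv h) = x"
    using x h by (simp_all add: is_bisetD[OF M])
  then show "lact M h x \<in> S \<longleftrightarrow> x \<in> S" "ract M x h \<in> S \<longleftrightarrow> x \<in> S"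
    using l r h by (metis inv_closed)+
qed

end

section \<open>Coordinates with respect to representatives of the subgroup classes\<close>

text \<open>\<open>SOME\<close> picks a biset from the class. Marks are isomorphism invariants, so
  the value does not depend on the choice, as \<open>class_mark_basis\<close> shows.\<close>

definition class_mark :: "('g, 'm) monoid_scheme \<Rightarrow> (nat \<Rightarrow> rat) \<Rightarrow> ('g bclass \<Rightarrow>\<^sub>0 rat) \<Rightarrow> rat" where
  "class_mark G F = lin (\<lambda>C. mark G F (SOME M. M \<in> C))"

lemma class_mark_basis:
  assumes "is_biset G M"
  shows "class_mark G F (basis_elt G M) = mark G F M"
proof -
  define N where "N = (SOME N. N \<in> bclass G M)"
  have "N \<in> bclass G M"
    unfolding N_def using bclass_nonempty[OF assms] by (metis someI)
  then have "biset_isomorphic G M N"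
    by (simp add: bclass_def)
  then have "mark G F N = mark G F M"
    using mark_iso[OF assms] by metis
  then show ?thesis
    by (simp add: class_mark_def basis_elt_def N_def)
qed

lemma class_mark_simps [simp]:
  "class_mark G F 0 = 0"
  "class_mark G F (f + g) = class_mark G F f + class_mark G F g"
  "class_mark G F (f - g) = class_mark G F f - class_mark G F g"
  "class_mark G F (- f) = - class_mark G F f"
  "class_mark G F (r *\<^sub>b f) = r * class_mark G F f"
  "class_mark G F (\<Sum>i\<in>I. h i) = (\<Sum>i\<in>I. class_mark G F (h i))"
  by (simp_all add: class_mark_def)

lemma class_mark_rel:
  assumes "k \<in> burnside_rel G"
  shows "class_mark G F k = 0"
  unfolding class_mark_def
proof (rule lin_burnside_rel[OF assms])
  fix M N :: "('a, nat) biset" assume MN: "is_biset G M" "is_biset G N"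
  show "mark G F (SOME P. P \<in> bclass G (biset_sum M N)) =
      mark G F (SOME P. P \<in> bclass G M) + mark G F (SOME P. P \<in> bclass G N)"
    using class_mark_basis[OF MN(1), of F] class_mark_basis[OF MN(2), of F]
      class_mark_basis[OF is_biset_sum[OF MN], of F] mark_sum[OF MN, of F]
    by (simp add: class_mark_def basis_elt_def)
qed

lemma class_mark_lincomb:
  "class_mark G (\<lambda>i. \<Sum>k\<in>K. c k * F k i) f = (\<Sum>k\<in>K. c k * class_mark G (F k) f)"
  unfolding class_mark_def lin_def mark_lincomb
  by (simp add: sum_distrib_left sum.swap[of _ _ "Poly_Mapping.keys f"] mult.left_commute)

lemma map_of_int_carrier:
  "f \<in> burnside_carrier G \<Longrightarrow> Poly_Mapping.map rat_of_int f \<in> burnside_carrier G"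
  by (induction rule: burnside_carrier_induct) (auto simp: map_of_int_simps)

lemma map_of_int_basis [simp]: "Poly_Mapping.map rat_of_int (basis_elt G M) = basis_elt G M"
  by (simp add: basis_elt_def)

lemma map_of_int_sum:
  "Poly_Mapping.map rat_of_int (\<Sum>i\<in>I. f i) = (\<Sum>i\<in>I. Poly_Mapping.map rat_of_int (f i))"
  by (induction I rule: infinite_finite_induct) (auto simp: map_of_int_simps)

lemma map_of_int_bmult:
  assumes "f \<in> burnside_carrier G" "g \<in> burnside_carrier G"
  shows "Poly_Mapping.map rat_of_int (bmult G f g) = bmult G (Poly_Mapping.map rat_of_int f) (Poly_Mapping.map rat_of_int g)"
  using assms(1)
proof (induction rule: burnside_carrier_induct)
  case (single C r)
  show ?case using assms(2)
    by (induction rule: burnside_carrier_induct) (auto simp: map_of_int_simps bmult_add_right)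
qed (auto simp: map_of_int_simps bmult_add_left)

text \<open>Representatives are indexed by their own type, so that the type of a stabilizer names
  its representative. The assumptions make the type a complete invariant of conjugacy.\<close>

locale class_reps = fin_group +
  fixes I :: "nat set" and rep :: "nat \<Rightarrow> ('a \<times> 'a) set"
  assumes finite_I: "finite I"
    and subgroup_rep: "i \<in> I \<Longrightarrow> subgroup (rep i) (G \<times>\<times> G)"
    and type_rep: "i \<in> I \<Longrightarrow> rel_type G (rep i) = i"
    and conj_to_rep: "subgroup U (G \<times>\<times> G) \<Longrightarrow>
      \<exists>i\<in>I. \<exists>g\<in>carrier G. \<exists>h\<in>carrier G. U = conj_rel G g h (rep i)"
begin

definition rep_elt :: "nat \<Rightarrow> 'a bclass \<Rightarrow>\<^sub>0 'r::comm_ring_1" where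
  "rep_elt i = basis_elt G (coset_biset G (rep i))"

lemma rep_elt_carrier [simp, intro]: "i \<in> I \<Longrightarrow> rep_elt i \<in> burnside_carrier G"
  unfolding rep_elt_def by (intro basis_elt_carrier is_biset_coset subgroup_rep)

lemma class_mark_rep_elt: "i \<in> I \<Longrightarrow> class_mark G F (rep_elt i) = F i"
  by (simp add: rep_elt_def class_mark_basis is_biset_coset subgroup_rep mark_coset type_rep)

lemma conj_rep_type:
  assumes "subgroup U (G \<times>\<times> G)"
  obtains g h where "g \<in> carrier G" "h \<in> carrier G" "rel_type G U \<in> I" "U = conj_rel G g h (rep (rel_type G U))"
    "card U = card (rep (rel_type G U))"
proof -
  obtain i g h where igh: "i \<in> I" "g \<in> carrier G" "h \<in> carrier G" "U = conj_rel G g h (rep i)"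
    using conj_to_rep[OF assms] by blast
  have "rel_type G U = i" "card U = card (rep i)"
    using igh sub_carrier[OF subgroup_rep[OF igh(1)]] by (simp_all add: rel_type_conj_rel type_rep card_conj_rel)
  then show ?thesis
    using igh that[of g h] by simp
qed

lemma basis_elt_coset:
  assumes "subgroup U (G \<times>\<times> G)"
  shows "rel_type G U \<in> I" "basis_elt G (coset_biset G U) = rep_elt (rel_type G U)"
proof -
  obtain g h where gh: "g \<in> carrier G" "h \<in> carrier G" "rel_type G U \<in> I" "U = conj_rel G g h (rep (rel_type G U))"
    by (rule conj_rep_type[OF assms])
  show "rel_type G U \<in> I" by fact
  show "basis_elt G (coset_biset G U) = rep_elt (rel_type G U)"
    unfolding rep_elt_def
    by (subst gh(4), rule basis_elt_eqI[symmetric])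
      (use gh(1-3) in \<open>simp_all add: is_biset_coset coset_biset_conj subgroup_rep\<close>)
qed

text \<open>Induction on the number of points: one orbit is split off, and it is isomorphic to the
  coset biset of a stabilizer.\<close>

lemma span_basis_elt:
  fixes M :: "('a, 'x) biset"
  assumes "is_biset G M"
  shows "\<exists>c. basis_elt G M - (\<Sum>i\<in>I. c i *\<^sub>b rep_elt i) \<in> (burnside_rel G :: ('a bclass \<Rightarrow>\<^sub>0 'r::comm_ring_1) set)"
  using assms
proof (induction "card (bcarrier M)" arbitrary: M rule: less_induct)
  case less
  note M = less.prems
  show ?case
  proof (cases "bcarrier M = {}")
    case True
    \<comment> \<open>The class of the empty biset vanishes in the quotient because the empty biset
      is isomorphic to its own double.\<close>
    have "biset_isomorphic G (biset_sum M M) M"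
      by (rule biset_isomorphicI[of "case_sum id id"]) (auto simp: biset_sum_def True bij_betw_def inj_on_def elim!: PlusE)
    then have "basis_elt G (biset_sum M M) = (basis_elt G M :: 'a bclass \<Rightarrow>\<^sub>0 'r)"
      by (rule basis_elt_eqI[OF is_biset_sum[OF M M]])
    moreover have "basis_elt G (biset_sum M M) - basis_elt G M - basis_elt G M \<in> (burnside_rel G :: ('a bclass \<Rightarrow>\<^sub>0 'r) set)"
      by (rule biset_sum_rel[OF M M])
    ultimately have "- basis_elt G M \<in> (burnside_rel G :: ('a bclass \<Rightarrow>\<^sub>0 'r) set)"
      by simp
    then have "basis_elt G M - (\<Sum>i\<in>I. 0 *\<^sub>b rep_elt i) \<in> (burnside_rel G :: ('a bclass \<Rightarrow>\<^sub>0 'r) set)"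
      using burnside_rel_closed(3) by fastforce
    then show ?thesis by (rule exI[of _ "\<lambda>_. 0"])
  next
    case False
    then obtain m where m: "m \<in> bcarrier M" by blast
    define S where "S = {lact M a (ract M m (inv b)) | a b. a \<in> carrier G \<and> b \<in> carrier G}"
    note S = orbit_closed[OF M m, folded S_def]
    let ?M = "M\<lparr>bcarrier := S\<rparr>" and ?N = "M\<lparr>bcarrier := bcarrier M - S\<rparr>"
    note sp = biset_split[OF M S(1,3,4)]
    have "card (bcarrier ?N) < card (bcarrier M)"
      using S(2) m is_bisetD(1)[OF M] by (auto intro!: psubset_card_mono)
    then obtain c where c: "basis_elt G ?N - (\<Sum>i\<in>I. c i *\<^sub>b rep_elt i) \<in> (burnside_rel G :: ('a bclass \<Rightarrow>\<^sub>0 'r) set)"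
      using less.hyps sp(2) by blast
    have st: "stab G ?M m = stab G M m"
      by (simp add: stab_def)
    have iso: "biset_isomorphic G ?M (coset_biset G (stab G ?M m))"
      by (rule transitive_biset[OF sp(1)]) (use S(2) in \<open>auto simp: S_def\<close>)
    then have M': "basis_elt G ?M = (rep_elt (rel_type G (stab G M m)) :: 'a bclass \<Rightarrow>\<^sub>0 'r)"
      by (simp add: basis_elt_eqI[OF sp(1) iso[unfolded st]] basis_elt_coset(2)[OF subgroup_stab[OF M m]])
    define j where "j = rel_type G (stab G M m)"
    have j: "j \<in> I"
      unfolding j_def by (rule basis_elt_coset[OF subgroup_stab[OF M m]])
    have e: "basis_elt G M = (basis_elt G (biset_sum ?M ?N) :: 'a bclass \<Rightarrow>\<^sub>0 'r)"
      by (rule basis_elt_eqI[OF M sp(3)])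
    have "basis_elt G M - basis_elt G ?M - basis_elt G ?N \<in> (burnside_rel G :: ('a bclass \<Rightarrow>\<^sub>0 'r) set)"
      by (subst e, rule biset_sum_rel[OF sp(1,2)])
    then have "(basis_elt G M - basis_elt G ?M - basis_elt G ?N) + (basis_elt G ?N - (\<Sum>i\<in>I. c i *\<^sub>b rep_elt i))
        \<in> (burnside_rel G :: ('a bclass \<Rightarrow>\<^sub>0 'r) set)"
      using c by (rule burnside_rel_closed)
    \<comment> \<open>The orbit that was split off raises the coefficient of its type by
      one.\<close>
    moreover have "(\<Sum>i\<in>I. (c i + (if i = j then 1 else 0)) *\<^sub>b rep_elt i) = (\<Sum>i\<in>I. c i *\<^sub>b rep_elt i) + (rep_elt j :: 'a bclass \<Rightarrow>\<^sub>0 'r)"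
    proof -
      have "(\<Sum>i\<in>I. (if i = j then 1 else 0) *\<^sub>b rep_elt i) = (\<Sum>i\<in>I. if i = j then (rep_elt j :: 'a bclass \<Rightarrow>\<^sub>0 'r) else 0)"
        by (rule sum.cong) auto
      then show ?thesis
        using j finite_I by (simp add: pm.scale_left_distrib sum.distrib)
    qed
    ultimately have "basis_elt G M - (\<Sum>i\<in>I. (c i + (if i = j then 1 else 0)) *\<^sub>b rep_elt i) \<in> (burnside_rel G :: ('a bclass \<Rightarrow>\<^sub>0 'r) set)"
      by (simp add: M' j_def[symmetric] algebra_simps)
    then show ?thesis by (rule exI[of _ "\<lambda>i. c i + (if i = j then 1 else 0)"])
  qed
qed

lemma span_carrier:
  fixes f :: "'a bclass \<Rightarrow>\<^sub>0 'r::comm_ring_1"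
  assumes "f \<in> burnside_carrier G"
  shows "\<exists>c. f - (\<Sum>i\<in>I. c i *\<^sub>b rep_elt i) \<in> burnside_rel G"
  using assms
proof (induction rule: burnside_carrier_induct)
  case zero
  show ?case
    by (rule exI[of _ "\<lambda>_. 0"]) (simp add: burnside_rel_closed)
next
  case (single C r)
  then obtain M :: "('a, nat) biset" where M: "is_biset G M" "C = bclass G M"
    by (rule bclassesE)
  then obtain c where c: "basis_elt G M - (\<Sum>i\<in>I. c i *\<^sub>b rep_elt i) \<in> (burnside_rel G :: ('a bclass \<Rightarrow>\<^sub>0 'r) set)"
    using span_basis_elt[OF M(1)] by blast
  have "Poly_Mapping.single C r - (\<Sum>i\<in>I. (r * c i) *\<^sub>b rep_elt i) = r *\<^sub>b (basis_elt G M - (\<Sum>i\<in>I. c i *\<^sub>b rep_elt i))"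
    by (simp add: M basis_elt_def pm.scale_right_diff_distrib pm.scale_sum_right)
  then show ?case
    using burnside_rel_closed(5)[OF c, of r] by (intro exI[of _ "\<lambda>i. r * c i"]) simp
next
  case (add f g)
  then obtain c d where "f - (\<Sum>i\<in>I. c i *\<^sub>b rep_elt i) \<in> burnside_rel G" "g - (\<Sum>i\<in>I. d i *\<^sub>b rep_elt i) \<in> burnside_rel G"
    by blast
  then have "(f - (\<Sum>i\<in>I. c i *\<^sub>b rep_elt i)) + (g - (\<Sum>i\<in>I. d i *\<^sub>b rep_elt i)) \<in> burnside_rel G"
    by (rule burnside_rel_closed)
  then show ?case
    by (intro exI[of _ "\<lambda>i. c i + d i"]) (simp add: pm.scale_left_distrib sum.distrib algebra_simps)
qed

text \<open>Modulo relations f is a combination of the representatives, and the indicator marks are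
  the dual functionals: if they vanish on f, all coefficients vanish.\<close>

lemma rel_iff_class_mark:
  assumes "f \<in> burnside_carrier G"
  shows "f \<in> burnside_rel G \<longleftrightarrow> (\<forall>i\<in>I. class_mark G (of_bool \<circ> (=) i) f = 0)"
proof
  assume a: "\<forall>i\<in>I. class_mark G (of_bool \<circ> (=) i) f = 0"
  obtain c where c: "f - (\<Sum>i\<in>I. c i *\<^sub>b rep_elt i) \<in> burnside_rel G"
    using span_carrier[OF assms] by blast
  have "c i = 0" if i: "i \<in> I" for i
  proof -
    have "(\<Sum>j\<in>I. c j * class_mark G (of_bool \<circ> (=) i) (rep_elt j)) = (\<Sum>j\<in>I. if j = i then c j else 0)"
      by (rule sum.cong) (auto simp: class_mark_rep_elt)
    then show ?thesis
      using class_mark_rel[OF c, of "of_bool \<circ> (=) i"] a i finite_I by simp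
  qed
  then show "f \<in> burnside_rel G"
    using c by simp
qed (simp add: class_mark_rel)

text \<open>This is injectivity of the passage from integral to rational coefficients: the integral
  coefficients of f can be read off from rational marks.\<close>

lemma int_rel_iff_class_mark:
  assumes f: "f \<in> burnside_carrier G"
  shows "f \<in> burnside_rel G \<longleftrightarrow> Poly_Mapping.map rat_of_int f \<in> burnside_rel G"
proof
  assume a: "Poly_Mapping.map rat_of_int f \<in> burnside_rel G"
  obtain c where c: "f - (\<Sum>i\<in>I. c i *\<^sub>b rep_elt i) \<in> burnside_rel G"
    using span_carrier[OF assms] by blast
  have "c i = 0" if i: "i \<in> I" for i
  proof -
    have "(\<Sum>j\<in>I. of_int (c j) * class_mark G (of_bool \<circ> (=) i) (rep_elt j)) = (\<Sum>j\<in>I. if j = i then rat_of_int (c j) else 0)"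
      by (rule sum.cong) (auto simp: class_mark_rep_elt)
    then show ?thesis
      using class_mark_rel[OF map_of_int_rel[OF c], of "of_bool \<circ> (=) i"] class_mark_rel[OF a] i finite_I
      by (simp add: map_of_int_simps map_of_int_sum rep_elt_def)
  qed
  then show "f \<in> burnside_rel G"
    using c by simp
qed (rule map_of_int_rel)

text \<open>Left multiplication by a transitive class is transferred to the weight function. The new
  weight at i is the mark of the product with the representative of type i.\<close>

lemma class_mark_coset_mult:
  assumes U: "subgroup U (G \<times>\<times> G)" and f: "f \<in> burnside_carrier G"
  shows "class_mark G F (bmult G (basis_elt G (coset_biset G U)) f) =
    class_mark G (\<lambda>i. mackey_sum G F U (rep i) / of_nat (card U * card (rep i))) f"
  using f
proof (induction rule: burnside_carrier_induct)
  case (single C r)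
  then obtain N :: "('a, nat) biset" where N: "is_biset G N" "C = bclass G N"
    by (rule bclassesE)
  note X = is_biset_coset[OF U]
  have "mackey_sum G F U (stab G N n) =
      of_nat (card (stab G N n)) * (mackey_sum G F U (rep (rel_type G (stab G N n))) / of_nat (card (rep (rel_type G (stab G N n)))))"
    if n: "n \<in> bcarrier N" for n
  proof -
    note S = subgroup_stab[OF N(1) n]
    obtain g h where gh: "g \<in> carrier G" "h \<in> carrier G" "rel_type G (stab G N n) \<in> I"
      "stab G N n = conj_rel G g h (rep (rel_type G (stab G N n)))"
      "card (stab G N n) = card (rep (rel_type G (stab G N n)))"
      by (rule conj_rep_type[OF S])
    have "mackey_sum G F U (stab G N n) = mackey_sum G F U (rep (rel_type G (stab G N n)))"
      by (subst gh(4), rule mackey_sum_conj[OF gh(1,2) sub_carrier[OF U] sub_carrier[OF subgroup_rep[OF gh(3)]]])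
    then show ?thesis
      using card_sub_pos[OF S] gh(5) by simp
  qed
  then have "mark G F (biset_tensor G (coset_biset G U) N) =
      mark G (\<lambda>i. mackey_sum G F U (rep i) / of_nat (card U * card (rep i))) N"
    unfolding mark_coset_tensor[OF U N(1)] by (simp add: mark_def sum_divide_distrib mult_ac)
  moreover have "Poly_Mapping.single C r = r *\<^sub>b basis_elt G N"
    by (simp add: N basis_elt_def)
  ultimately show ?case
    using X N(1) by (simp add: bmult_scale_right bmult_basis class_mark_basis is_biset_tensor)
qed (simp_all add: bmult_add_right)

text \<open>Weights are evaluated only at types of stabilizers, and these lie in I.\<close>

lemma class_mark_cong:
  assumes "\<And>i. i \<in> I \<Longrightarrow> F i = F' i" and f: "f \<in> burnside_carrier G"
  shows "class_mark G F f = class_mark G F' f"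
  using f
proof (induction rule: burnside_carrier_induct)
  case (single C r)
  then obtain N :: "('a, nat) biset" where N: "is_biset G N" "C = bclass G N"
    by (rule bclassesE)
  have "F (rel_type G (stab G N n)) = F' (rel_type G (stab G N n))" if "n \<in> bcarrier N" for n
    by (rule assms(1)) (rule basis_elt_coset(1)[OF subgroup_stab[OF N(1) that]])
  then have "mark G F N = mark G F' N"
    by (simp add: mark_def)
  moreover have "Poly_Mapping.single C r = r *\<^sub>b basis_elt G N"
    by (simp add: N basis_elt_def)
  ultimately show ?case
    using N(1) by (simp add: class_mark_basis)
qed simp_all

end

section \<open>The subgroups of \<open>S\<^sub>3 \<times> S\<^sub>3\<close>\<close>

text \<open>\<open>Ri\<close> and \<open>Mi\<close> stand for the permutations \<open>b\<^sup>i\<close> and \<open>b\<^sup>i a\<close>.\<close>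

datatype s3 = R0 | R1 | R2 | M0 | M1 | M2

text \<open>The table follows from a b = b^-1 a; it is written out so that products can be evaluated
  by rewriting.\<close>

fun cmul :: "s3 \<Rightarrow> s3 \<Rightarrow> s3" where
    "cmul R0 R0 = R0"
  | "cmul R0 R1 = R1"
  | "cmul R0 R2 = R2"
  | "cmul R0 M0 = M0"
  | "cmul R0 M1 = M1"
  | "cmul R0 M2 = M2"
  | "cmul R1 R0 = R1"
  | "cmul R1 R1 = R2"
  | "cmul R1 R2 = R0"
  | "cmul R1 M0 = M1"
  | "cmul R1 M1 = M2"
  | "cmul R1 M2 = M0"
  | "cmul R2 R0 = R2"
  | "cmul R2 R1 = R0"
  | "cmul R2 R2 = R1"
  | "cmul R2 M0 = M2"
  | "cmul R2 M1 = M0"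
  | "cmul R2 M2 = M1"
  | "cmul M0 R0 = M0"
  | "cmul M0 R1 = M2"
  | "cmul M0 R2 = M1"
  | "cmul M0 M0 = R0"
  | "cmul M0 M1 = R2"
  | "cmul M0 M2 = R1"
  | "cmul M1 R0 = M1"
  | "cmul M1 R1 = M0"
  | "cmul M1 R2 = M2"
  | "cmul M1 M0 = R1"
  | "cmul M1 M1 = R0"
  | "cmul M1 M2 = R2"
  | "cmul M2 R0 = M2"
  | "cmul M2 R1 = M1"
  | "cmul M2 R2 = M0"
  | "cmul M2 M0 = R2"
  | "cmul M2 M1 = R1"
  | "cmul M2 M2 = R0"

primrec cinv :: "s3 \<Rightarrow> s3" where
  "cinv R0 = R0" | "cinv R1 = R2" | "cinv R2 = R1" | "cinv M0 = M0" | "cinv M1 = M1" | "cinv M2 = M2"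

primrec enc :: "s3 \<Rightarrow> nat \<Rightarrow> nat" where
  "enc R0 = id" | "enc R1 = perm_b" | "enc R2 = perm_b \<circ> perm_b"
| "enc M0 = perm_a" | "enc M1 = perm_b \<circ> perm_a" | "enc M2 = perm_b \<circ> perm_b \<circ> perm_a"

definition els :: "s3 list" where "els = [R0, R1, R2, M0, M1, M2]"

text \<open>Membership in \<open>V i\<close> on codes; as there, any index other than 0, 1, 4 gives
  the whole group.\<close>

definition vmem :: "nat \<Rightarrow> s3 \<Rightarrow> bool" where
  "vmem i x = (if i = 0 then x = R0 else if i = 1 then x = R0 \<or> x = M0
     else if i = 4 then x = R0 \<or> x = R1 \<or> x = R2 else True)"

definition rel_of :: "(s3 \<Rightarrow> s3 \<Rightarrow> bool) \<Rightarrow> ((nat \<Rightarrow> nat) \<times> (nat \<Rightarrow> nat)) set" where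
  "rel_of P = {(enc x, enc y) | x y. P x y}"

text \<open>The first of the computable counterparts, on predicates, of composition, conjugation,
  order and type of relations. Quantifiers become searches through \<open>els\<close>.\<close>

definition ccomp :: "(s3 \<Rightarrow> s3 \<Rightarrow> bool) \<Rightarrow> (s3 \<Rightarrow> s3 \<Rightarrow> bool) \<Rightarrow> s3 \<Rightarrow> s3 \<Rightarrow> bool" where
  "ccomp P Q x y = list_ex (\<lambda>z. P x z \<and> Q z y) els"

definition cconj :: "s3 \<Rightarrow> s3 \<Rightarrow> (s3 \<Rightarrow> s3 \<Rightarrow> bool) \<Rightarrow> s3 \<Rightarrow> s3 \<Rightarrow> bool" where
  "cconj g h P x y = P (cmul (cmul (cinv g) x) g) (cmul (cmul (cinv h) y) h)"

definition cnt :: "(s3 \<Rightarrow> bool) \<Rightarrow> nat" where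
  "cnt Q = length (filter Q els)"

definition csize :: "(s3 \<Rightarrow> s3 \<Rightarrow> bool) \<Rightarrow> nat" where
  "csize P = sum_list (map (\<lambda>x. cnt (P x)) els)"

definition ctype :: "(s3 \<Rightarrow> s3 \<Rightarrow> bool) \<Rightarrow> nat" where
  "ctype P = 100 * cnt (\<lambda>x. list_ex (P x) els) + 10 * cnt (\<lambda>x. P x R0) + cnt (\<lambda>y. list_ex (\<lambda>x. P x y) els)"

text \<open>The keys are the types. After the 16 products come the diagonals of \<open>V 1\<close>,
  \<open>V 4\<close>, \<open>V 5\<close> and then U_6, U_7, U_8. Since \<open>vmem 4\<close> tells
  the even permutations, \<open>vmem 4 x = vmem 4 y\<close> says that x and y have equal
  sign.\<close>

definition creps :: "(nat \<times> (s3 \<Rightarrow> s3 \<Rightarrow> bool)) list" where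
  "creps = [
    (111, \<lambda>x y. vmem 0 x \<and> vmem 0 y),
    (112, \<lambda>x y. vmem 0 x \<and> vmem 1 y),
    (113, \<lambda>x y. vmem 0 x \<and> vmem 4 y),
    (116, \<lambda>x y. vmem 0 x \<and> vmem 5 y),
    (221, \<lambda>x y. vmem 1 x \<and> vmem 0 y),
    (222, \<lambda>x y. vmem 1 x \<and> vmem 1 y),
    (223, \<lambda>x y. vmem 1 x \<and> vmem 4 y),
    (226, \<lambda>x y. vmem 1 x \<and> vmem 5 y),
    (331, \<lambda>x y. vmem 4 x \<and> vmem 0 y),
    (332, \<lambda>x y. vmem 4 x \<and> vmem 1 y),
    (333, \<lambda>x y. vmem 4 x \<and> vmem 4 y),
    (336, \<lambda>x y. vmem 4 x \<and> vmem 5 y),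
    (661, \<lambda>x y. vmem 5 x \<and> vmem 0 y),
    (662, \<lambda>x y. vmem 5 x \<and> vmem 1 y),
    (663, \<lambda>x y. vmem 5 x \<and> vmem 4 y),
    (666, \<lambda>x y. vmem 5 x \<and> vmem 5 y),
    (212, \<lambda>x y. x = y \<and> vmem 1 x),
    (313, \<lambda>x y. x = y \<and> vmem 4 x),
    (616, \<lambda>x y. x = y),
    (216, \<lambda>x y. vmem 1 x \<and> vmem 4 x = vmem 4 y),
    (632, \<lambda>x y. vmem 1 y \<and> vmem 4 x = vmem 4 y),
    (636, \<lambda>x y. vmem 4 x = vmem 4 y)]"

lemma set_els: "set els = UNIV"
proof -
  have "x \<in> set els" for x by (cases x) (simp_all add: els_def)
  then show ?thesis by blast
qed

lemma distinct_els: "distinct els"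
  by (simp add: els_def)

lemma perm_a_eq: "perm_a n = (if n = 1 then 2 else if n = 2 then 1 else n)"
  by (simp add: perm_a_def transpose_def)

lemma perm_b_eq: "perm_b n = (if n = 1 then 2 else if n = 2 then 3 else if n = 3 then 1 else n)"
  by (simp add: perm_b_def transpose_def)

lemma enc_cmul: "enc (cmul x y) = enc x \<circ> enc y"
  by (rule ext) (cases x; cases y; simp add: perm_a_eq perm_b_eq)

lemma inj_enc: "inj enc"
proof (rule injI)
  fix x y assume "enc x = enc y"
  then have "enc x 1 = enc y 1" "enc x 2 = enc y 2" by simp_all
  then show "x = y"
    by (cases x; cases y; simp add: perm_a_eq perm_b_eq)
qed

lemma enc_eq_iff [simp]: "enc x = enc y \<longleftrightarrow> x = y"
  using inj_enc by (auto dest: injD)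

lemma perm_a_permutes: "perm_a permutes {1..3}" and perm_b_permutes: "perm_b permutes {1..3}"
  unfolding perm_a_def perm_b_def
  by (auto intro!: permutes_compose permutes_swap_id simp: permutes_id)

lemma range_enc: "range enc = carrier S3"
proof (rule card_subset_eq)
  show fin: "finite (carrier S3)"
    using sym_group_card_carrier[of 3] by (intro card_ge_0_finite) simp
  have "enc x permutes {1..3}" for x
    by (cases x; simp only: enc.simps; intro permutes_compose perm_a_permutes perm_b_permutes permutes_id)
  then show "range enc \<subseteq> carrier S3"
    by (auto simp: sym_group_carrier)
  have "card (range enc) = card (set els)"
    by (simp add: set_els card_image inj_enc)
  also have "\<dots> = 6"
    by (simp add: distinct_card[OF distinct_els]) (simp add: els_def)
  finally show "card (range enc) = card (carrier S3)"
    by (simp add: sym_group_card_carrier fact_numeral)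
qed

lemma enc_carrier [simp, intro]: "enc x \<in> carrier S3"
  using range_enc by blast

lemma carrier_S3_E:
  assumes "p \<in> carrier S3" obtains x where "p = enc x"
  using assms range_enc by blast

interpretation S3: fin_group S3
proof -
  interpret group S3 by (rule sym_group_is_group)
  show "fin_group S3"
    by unfold_locales (simp add: range_enc[symmetric] set_els[symmetric])
qed

lemma S3_mult [simp]: "enc x \<otimes>\<^bsub>S3\<^esub> enc y = enc (cmul x y)"
  by (simp add: sym_group_mult enc_cmul)

lemma S3_one: "\<one>\<^bsub>S3\<^esub> = enc R0"
  by (simp add: sym_group_one)

lemma S3_inv [simp]: "inv\<^bsub>S3\<^esub> enc x = enc (cinv x)"
  by (rule S3.inv_equality) (cases x; simp add: S3_one del: enc.simps)+

lemma cmul_assoc: "cmul (cmul x y) z = cmul x (cmul y z)"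
  by (cases x; cases y; cases z; simp)

lemma cmul_R0 [simp]: "cmul R0 x = x" "cmul x R0 = x"
  by (cases x; simp)+

lemma cmul_cinv [simp]: "cmul x (cinv x) = R0" "cmul (cinv x) x = R0"
  by (cases x; simp)+

section \<open>Relations on the group and predicates on codes\<close>

lemma mem_rel_of [simp]: "(enc x, enc y) \<in> rel_of P \<longleftrightarrow> P x y"
  by (auto simp: rel_of_def simp del: enc.simps)

lemma rel_of_carrier: "rel_of P \<subseteq> carrier S3 \<times> carrier S3"
  by (auto simp: rel_of_def simp del: enc.simps)

lemma rel_of_relcomp: "rel_of P O rel_of Q = rel_of (ccomp P Q)"
  by (auto simp: rel_of_def ccomp_def list_ex_iff set_els simp del: enc.simps)

lemma conj_rel_of: "conj_rel S3 (enc g) (enc h) (rel_of P) = rel_of (cconj g h P)"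
  by (auto simp: conj_rel_def cconj_def elim!: carrier_S3_E simp del: enc.simps)
    (auto simp: rel_of_def cconj_def simp del: enc.simps)

lemma card_enc: "card {p. \<exists>x. p = enc x \<and> Q x} = cnt Q"
proof -
  have "{p. \<exists>x. p = enc x \<and> Q x} = enc ` set (filter Q els)"
    by (auto simp: set_els)
  then show ?thesis
    by (simp add: card_image inj_on_def distinct_card distinct_els cnt_def del: set_filter)
qed

lemma card_rel_of: "card (rel_of P) = csize P"
proof -
  have "rel_of P = (\<Union>x\<in>set els. {enc x} \<times> {p. \<exists>y. p = enc y \<and> P x y})"
    by (auto simp: rel_of_def set_els)
  moreover have "card (\<Union>x\<in>set els. {enc x} \<times> {p. \<exists>y. p = enc y \<and> P x y}) = (\<Sum>x\<in>set els. card ({enc x} \<times> {p. \<exists>y. p = enc y \<and> P x y}))"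
  proof (rule card_UN_disjoint)
    have "finite {p. \<exists>y. p = enc y \<and> P x y}" for x
      by (rule finite_subset[OF _ S3.finite_carrier]) auto
    then show "\<forall>x\<in>set els. finite ({enc x} \<times> {p. \<exists>y. p = enc y \<and> P x y})" by simp
  qed auto
  ultimately show ?thesis
    by (simp add: card_cartesian_product card_enc csize_def sum_list_distinct_conv_sum_set[OF distinct_els])
qed

lemma rel_type_rel_of: "rel_type S3 (rel_of P) = ctype P"
proof -
  have "Domain (rel_of P) = {p. \<exists>x. p = enc x \<and> list_ex (P x) els}"
    "{p. (p, \<one>\<^bsub>S3\<^esub>) \<in> rel_of P} = {p. \<exists>x. p = enc x \<and> P x R0}"
    "Range (rel_of P) = {p. \<exists>y. p = enc y \<and> list_ex (\<lambda>x. P x y) els}"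
    by (auto simp: rel_of_def S3_one list_ex_iff set_els simp del: enc.simps)
  then show ?thesis
    by (simp add: rel_type_def ctype_def card_enc)
qed

lemma kernel_meet_rel_of: "kernel_meet S3 (rel_of P) (rel_of Q) = cnt (\<lambda>z. P R0 z \<and> Q z R0)"
proof -
  have "{z. (\<one>\<^bsub>S3\<^esub>, z) \<in> rel_of P \<and> (z, \<one>\<^bsub>S3\<^esub>) \<in> rel_of Q} = {p. \<exists>z. p = enc z \<and> P R0 z \<and> Q z R0}"
    by (auto simp: rel_of_def S3_one simp del: enc.simps)
  then show ?thesis
    by (simp add: kernel_meet_def card_enc)
qed

definition mackey_terms :: "(s3 \<Rightarrow> s3 \<Rightarrow> bool) \<Rightarrow> (s3 \<Rightarrow> s3 \<Rightarrow> bool) \<Rightarrow> (nat \<times> nat) list" where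
  "mackey_terms P Q = map (\<lambda>h. let Q' = cconj h R0 Q; C = ccomp P Q' in
     (cnt (\<lambda>z. P R0 z \<and> Q' z R0) * csize C, ctype C)) els"

lemma mackey_sum_rel_of:
  "mackey_sum S3 F (rel_of P) (rel_of Q) = (\<Sum>(w, t)\<leftarrow>mackey_terms P Q. of_nat w * F t)"
proof -
  let ?t = "\<lambda>h. let Y = conj_rel S3 h \<one>\<^bsub>S3\<^esub> (rel_of Q) in
     of_nat (kernel_meet S3 (rel_of P) Y * card (rel_of P O Y)) * F (rel_type S3 (rel_of P O Y))"
  have "mackey_sum S3 F (rel_of P) (rel_of Q) = (\<Sum>h\<in>UNIV. ?t (enc h))"
    unfolding mackey_sum_def range_enc[symmetric] by (subst sum.reindex[OF inj_enc]) (simp add: comp_def)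
  also have "\<dots> = (\<Sum>h\<leftarrow>els. ?t (enc h))"
    by (simp add: sum_list_distinct_conv_sum_set[OF distinct_els] set_els)
  also have "\<dots> = (\<Sum>(w, t)\<leftarrow>mackey_terms P Q. of_nat w * F t)"
    by (simp add: mackey_terms_def comp_def Let_def S3_one conj_rel_of rel_of_relcomp kernel_meet_rel_of
        card_rel_of rel_type_rel_of del: enc.simps)
  finally show ?thesis .
qed

lemma subgroup_rel_ofI:
  assumes "P R0 R0" "\<And>x y x' y'. P x y \<Longrightarrow> P x' y' \<Longrightarrow> P (cmul x x') (cmul y y')" "\<And>x y. P x y \<Longrightarrow> P (cinv x) (cinv y)"
  shows "subgroup (rel_of P) (S3 \<times>\<times> S3)"
proof -
  interpret GG: group "S3 \<times>\<times> S3" by (intro DirProd_group S3.is_group)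
  show ?thesis
    by (rule GG.subgroupI)
      (use assms rel_of_carrier in \<open>auto simp: rel_of_def inv_DirProd[OF S3.is_group S3.is_group] simp del: enc.simps\<close>)
qed

lemma subgroup_rel_ofE:
  assumes U: "subgroup U (S3 \<times>\<times> S3)"
  obtains P where "U = rel_of P" "P R0 R0" "\<And>x y x' y'. P x y \<Longrightarrow> P x' y' \<Longrightarrow> P (cmul x x') (cmul y y')"
proof
  define P where "P x y \<longleftrightarrow> (enc x, enc y) \<in> U" for x y
  show "U = rel_of P"
    using S3.sub_carrier[OF U] by (auto simp: P_def rel_of_def elim!: carrier_S3_E simp del: enc.simps)
  show "P R0 R0"
    using S3.sub_closed(1)[OF U] by (simp add: P_def S3_one del: enc.simps)
  show "P (cmul x x') (cmul y y')" if "P x y" "P x' y'" for x y x' y'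
    using S3.sub_closed(2)[OF U, of "enc x" "enc y" "enc x'" "enc y'"] that by (simp add: P_def del: enc.simps)
qed

lemma vmem_closed:
  "vmem i R0" "vmem i x \<Longrightarrow> vmem i y \<Longrightarrow> vmem i (cmul x y)" "vmem i (cinv x) = vmem i x"
  "vmem 4 (cmul x y) \<longleftrightarrow> (vmem 4 x \<longleftrightarrow> vmem 4 y)"
proof -
  show "vmem i R0" by (simp add: vmem_def)
  show "vmem i (cinv x) = vmem i x" by (cases x; simp add: vmem_def)
  show "vmem 4 (cmul x y) \<longleftrightarrow> (vmem 4 x \<longleftrightarrow> vmem 4 y)"
    by (cases x; cases y; simp add: vmem_def)
  show "vmem i x \<Longrightarrow> vmem i y \<Longrightarrow> vmem i (cmul x y)"
    by (cases "i = 0"; cases "i = 1"; cases "i = 4"; cases x; cases y; simp add: vmem_def)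
qed

lemma subgroup_creps: "(i, P) \<in> set creps \<Longrightarrow> subgroup (rel_of P) (S3 \<times>\<times> S3)"
  by (rule subgroup_rel_ofI) (auto simp: creps_def vmem_closed)

lemma ctype_creps: "list_all (\<lambda>(i, P). ctype P = i) creps"
  by code_simp

lemma cconj_cconj: "cconj g h (cconj g' h' P) = cconj (cmul g g') (cmul h h') P"
proof -
  have "cinv (cmul x y) = cmul (cinv y) (cinv x)" for x y by (cases x; cases y; simp)
  then show ?thesis by (simp add: cconj_def fun_eq_iff cmul_assoc)
qed

lemma cconj_R0: "cconj R0 R0 P = P"
  by (simp add: cconj_def fun_eq_iff)

section \<open>Classification of the subgroups up to conjugacy\<close>

definition classified :: "(s3 \<Rightarrow> s3 \<Rightarrow> bool) \<Rightarrow> bool" where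
  "classified P \<longleftrightarrow> (\<exists>(i, Q)\<in>set creps. \<exists>g h. P = cconj g h Q)"

lemma classified_cconj: "classified (cconj g h P) \<Longrightarrow> classified P"
proof -
  assume "classified (cconj g h P)"
  then obtain i Q g' h' where Q: "(i, Q) \<in> set creps" "cconj g h P = cconj g' h' Q"
    unfolding classified_def by blast
  then have "cconj (cinv g) (cinv h) (cconj g h P) = cconj (cinv g) (cinv h) (cconj g' h' Q)" by simp
  then show ?thesis
    using Q(1) by (auto simp: classified_def cconj_cconj cconj_R0)
qed

locale closed_rel =
  fixes P :: "s3 \<Rightarrow> s3 \<Rightarrow> bool"
  assumes one: "P R0 R0" and mult: "P x y \<Longrightarrow> P x' y' \<Longrightarrow> P (cmul x x') (cmul y y')"
begin

lemma inv: "P (cinv x) (cinv y) \<longleftrightarrow> P x y"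
proof -
  have c: "P (cinv x) (cinv y)" if P: "P x y" for x y
  proof -
    \<comment> \<open>All element orders divide 6, so the inverse is the fifth power and closure
      under products is enough.\<close>
    have x: "cinv z = cmul z (cmul z (cmul z (cmul z z)))" for z by (cases z; simp)
    show ?thesis
      unfolding x[of x] x[of y] by (intro mult P)
  qed
  have "cinv (cinv z) = z" for z by (cases z; simp)
  then show ?thesis using c[of x y] c[of "cinv x" "cinv y"] by auto
qed

lemma translate: "P p q \<Longrightarrow> P (cmul x p) (cmul y q) \<longleftrightarrow> P x y"
  using mult[of x y p q] mult[of "cmul x p" "cmul y q" "cinv p" "cinv q"] by (auto simp: inv cmul_assoc)

lemma rot: "P R2 R0 = P R1 R0" "P R0 R2 = P R0 R1" "P R2 R2 = P R1 R1" "P R2 R1 = P R1 R2"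
  using inv[of R1 R0] inv[of R0 R1] inv[of R1 R1] inv[of R1 R2] by simp_all

text \<open>The subgroups of C3 x C3: the trivial one, the whole group, and four of order 3,
  generated by (b, 1), (1, b), (b, b) and (b, b^-1). Any two of these four pairs generate
  everything.\<close>

lemma rot_cases:
  obtains (none) "\<not> P R1 R0" "\<not> P R0 R1" "\<not> P R1 R1" "\<not> P R1 R2"
  | (left) "P R1 R0" "\<not> P R0 R1" "\<not> P R1 R1" "\<not> P R1 R2"
  | (right) "\<not> P R1 R0" "P R0 R1" "\<not> P R1 R1" "\<not> P R1 R2"
  | (diag) "\<not> P R1 R0" "\<not> P R0 R1" "P R1 R1" "\<not> P R1 R2"
  | (anti) "\<not> P R1 R0" "\<not> P R0 R1" "\<not> P R1 R1" "P R1 R2"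
  | (all) "P R1 R0" "P R0 R1" "P R1 R1" "P R1 R2"
  using translate[of R1 R0 R0 R1] translate[of R1 R0 R1 R1] translate[of R1 R0 R1 R2]
    translate[of R0 R1 R1 R1] translate[of R0 R1 R1 R2] translate[of R1 R1 R1 R2]
    translate[of R1 R0 R1 R0]
  by (simp add: rot) metis

lemma classifiedI:
  assumes "(i, Q) \<in> set creps" "\<And>x y. P x y = cconj g h Q x y"
  shows "classified P"
  using assms unfolding classified_def by (force intro!: bexI[of _ "(i, Q)"])

lemma classified_rot:
  assumes n: "\<And>x y. P x y \<Longrightarrow> vmem 4 x \<and> vmem 4 y"
  shows "classified P"
proof -
  have v: "\<not> vmem 4 x \<or> \<not> vmem 4 y \<Longrightarrow> P x y = False" for x y
    using n by blast
  show ?thesis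
  proof (cases rule: rot_cases)
    case none
    then show ?thesis
      by (intro classifiedI[of 111 "\<lambda>x y. vmem 0 x \<and> vmem 0 y" R0 R0])
        (simp add: creps_def, (case_tac x; case_tac y; simp add: v one rot cconj_def vmem_def))
  next
    case left
    then show ?thesis
      by (intro classifiedI[of 331 "\<lambda>x y. vmem 4 x \<and> vmem 0 y" R0 R0])
        (simp add: creps_def, (case_tac x; case_tac y; simp add: v one rot cconj_def vmem_def))
  next
    case right
    then show ?thesis
      by (intro classifiedI[of 113 "\<lambda>x y. vmem 0 x \<and> vmem 4 y" R0 R0])
        (simp add: creps_def, (case_tac x; case_tac y; simp add: v one rot cconj_def vmem_def))
  next
    case diag
    then show ?thesis
      by (intro classifiedI[of 313 "\<lambda>x y. x = y \<and> vmem 4 x" R0 R0])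
        (simp add: creps_def, (case_tac x; case_tac y; simp add: v one rot cconj_def vmem_def))
  next
    case anti
    \<comment> \<open>Inversion on the rotations is conjugation by a reflection, so conjugating the
      first coordinate by a turns the antidiagonal into the diagonal.\<close>
    then show ?thesis
      by (intro classifiedI[of 313 "\<lambda>x y. x = y \<and> vmem 4 x" M0 R0])
        (simp add: creps_def, (case_tac x; case_tac y; simp add: v one rot cconj_def vmem_def))
  next
    case all
    then show ?thesis
      by (intro classifiedI[of 333 "\<lambda>x y. vmem 4 x \<and> vmem 4 y" R0 R0])
        (simp add: creps_def, (case_tac x; case_tac y; simp add: v one rot cconj_def vmem_def))
  qed
qed

text \<open>Translation by (a, 1) copies the rows of the rotations to the rows of the reflections,
  so P is determined by its rotation part.\<close>

lemma classified_left:
  assumes m: "P M0 R0" and n: "\<And>x y. P x y \<Longrightarrow> vmem 4 y"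
  shows "classified P"
proof -
  have v: "P M0 y = P R0 y" "P M1 y = P R1 y" "P M2 y = P R2 y" "\<not> vmem 4 y \<Longrightarrow> P x y = False" for x y
    using n translate[OF m, of M0 y] translate[OF m, of M1 y] translate[OF m, of M2 y] by auto
  \<comment> \<open>Conjugation by (a, 1) exchanges (b, b) with (b^-1, b), so a rotation part that
    is just the diagonal or just the antidiagonal cannot occur.\<close>
  have d: "P R1 R1 \<longleftrightarrow> P R1 R2"
    using mult[OF mult[OF m, of R1 R1] m] mult[OF mult[OF m, of R1 R2] m] by (auto simp: rot)
  show ?thesis
  proof (cases rule: rot_cases)
    case none
    then show ?thesis
      by (intro classifiedI[of 221 "\<lambda>x y. vmem 1 x \<and> vmem 0 y" R0 R0])
        (simp add: creps_def, (case_tac x; case_tac y; simp add: v one rot cconj_def vmem_def))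
  next
    case left
    then show ?thesis
      by (intro classifiedI[of 661 "\<lambda>x y. vmem 5 x \<and> vmem 0 y" R0 R0])
        (simp add: creps_def, (case_tac x; case_tac y; simp add: v one rot cconj_def vmem_def))
  next
    case right
    then show ?thesis
      by (intro classifiedI[of 223 "\<lambda>x y. vmem 1 x \<and> vmem 4 y" R0 R0])
        (simp add: creps_def, (case_tac x; case_tac y; simp add: v one rot cconj_def vmem_def))
  next
    case diag
    then show ?thesis using d by (simp add: rot)
  next
    case anti
    then show ?thesis using d by (simp add: rot)
  next
    case all
    then show ?thesis
      by (intro classifiedI[of 663 "\<lambda>x y. vmem 5 x \<and> vmem 4 y" R0 R0])
        (simp add: creps_def, (case_tac x; case_tac y; simp add: v one rot cconj_def vmem_def))
  qed
qed

lemma classified_right: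
  assumes m: "P R0 M0" and n: "\<And>x y. P x y \<Longrightarrow> vmem 4 x"
  shows "classified P"
proof -
  have v: "P x M0 = P x R0" "P x M1 = P x R1" "P x M2 = P x R2" "\<not> vmem 4 x \<Longrightarrow> P x y = False" for x y
    using n translate[OF m, of x M0] translate[OF m, of x M1] translate[OF m, of x M2] by auto
  have d: "P R1 R1 \<longleftrightarrow> P R1 R2"
    using mult[OF mult[OF m, of R1 R1] m] mult[OF mult[OF m, of R1 R2] m] by (auto simp: rot)
  show ?thesis
  proof (cases rule: rot_cases)
    case none
    then show ?thesis
      by (intro classifiedI[of 112 "\<lambda>x y. vmem 0 x \<and> vmem 1 y" R0 R0])
        (simp add: creps_def, (case_tac x; case_tac y; simp add: v one rot cconj_def vmem_def))
  next
    case left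
    then show ?thesis
      by (intro classifiedI[of 332 "\<lambda>x y. vmem 4 x \<and> vmem 1 y" R0 R0])
        (simp add: creps_def, (case_tac x; case_tac y; simp add: v one rot cconj_def vmem_def))
  next
    case right
    then show ?thesis
      by (intro classifiedI[of 116 "\<lambda>x y. vmem 0 x \<and> vmem 5 y" R0 R0])
        (simp add: creps_def, (case_tac x; case_tac y; simp add: v one rot cconj_def vmem_def))
  next
    case diag
    then show ?thesis using d by (simp add: rot)
  next
    case anti
    then show ?thesis using d by (simp add: rot)
  next
    case all
    then show ?thesis
      by (intro classifiedI[of 336 "\<lambda>x y. vmem 4 x \<and> vmem 5 y" R0 R0])
        (simp add: creps_def, (case_tac x; case_tac y; simp add: v one rot cconj_def vmem_def))
  qed
qed

text \<open>Both signs agree throughout P, and translation by (a, a) carries the even half onto the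
  odd half, so again the rotation part decides. All six rotation parts occur here.\<close>

lemma classified_diag:
  assumes m: "P M0 M0" and n: "\<And>x y. P x y \<Longrightarrow> vmem 4 x = vmem 4 y"
  shows "classified P"
proof -
  have t: "P (cmul x M0) (cmul y M0) = P x y" for x y
    by (rule translate[OF m])
  have v: "P M0 M0" "P M0 M1 = P R0 R1" "P M0 M2 = P R0 R2" "P M1 M0 = P R1 R0" "P M1 M1 = P R1 R1" "P M1 M2 = P R1 R2"
    "P M2 M0 = P R2 R0" "P M2 M1 = P R2 R1" "P M2 M2 = P R2 R2"
    using m t[of M0 M1] t[of M0 M2] t[of M1 M0] t[of M1 M1] t[of M1 M2] t[of M2 M0] t[of M2 M1] t[of M2 M2] by simp_all
  have v': "vmem 4 x \<noteq> vmem 4 y \<Longrightarrow> P x y = False" for x y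
    using n by blast
  note v = v v'
  show ?thesis
  proof (cases rule: rot_cases)
    case none
    then show ?thesis
      by (intro classifiedI[of 212 "\<lambda>x y. x = y \<and> vmem 1 x" R0 R0])
        (simp add: creps_def, (case_tac x; case_tac y; simp add: v one rot cconj_def vmem_def))
  next
    case left
    then show ?thesis
      by (intro classifiedI[of 632 "\<lambda>x y. vmem 1 y \<and> vmem 4 x = vmem 4 y" R0 R0])
        (simp add: creps_def, (case_tac x; case_tac y; simp add: v one rot cconj_def vmem_def))
  next
    case right
    then show ?thesis
      by (intro classifiedI[of 216 "\<lambda>x y. vmem 1 x \<and> vmem 4 x = vmem 4 y" R0 R0])
        (simp add: creps_def, (case_tac x; case_tac y; simp add: v one rot cconj_def vmem_def))
  next
    case diag
    then show ?thesis
      by (intro classifiedI[of 616 "\<lambda>x y. x = y" R0 R0])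
        (simp add: creps_def, (case_tac x; case_tac y; simp add: v one rot cconj_def vmem_def))
  next
    case anti
    then show ?thesis
      by (intro classifiedI[of 616 "\<lambda>x y. x = y" M0 R0])
        (simp add: creps_def, (case_tac x; case_tac y; simp add: v one rot cconj_def vmem_def))
  next
    case all
    then show ?thesis
      by (intro classifiedI[of 636 "\<lambda>x y. vmem 4 x = vmem 4 y" R0 R0])
        (simp add: creps_def, (case_tac x; case_tac y; simp add: v one rot cconj_def vmem_def))
  qed
qed

lemma classified_full:
  assumes m: "P M0 R0" and m': "P R0 M0"
  shows "classified P"
proof -
  have v: "P M0 y = P R0 y" "P M1 y = P R1 y" "P M2 y = P R2 y" "P x M0 = P x R0" "P x M1 = P x R1" "P x M2 = P x R2" for x y
    using translate[OF m, of M0 y] translate[OF m, of M1 y] translate[OF m, of M2 y]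
      translate[OF m', of x M0] translate[OF m', of x M1] translate[OF m', of x M2] by simp_all
  have d: "P R1 R1 \<longleftrightarrow> P R1 R2"
    using mult[OF mult[OF m, of R1 R1] m] mult[OF mult[OF m, of R1 R2] m] by (auto simp: rot)
  show ?thesis
  proof (cases rule: rot_cases)
    case none
    then show ?thesis
      by (intro classifiedI[of 222 "\<lambda>x y. vmem 1 x \<and> vmem 1 y" R0 R0])
        (simp add: creps_def, (case_tac x; case_tac y; simp add: v one rot cconj_def vmem_def))
  next
    case left
    then show ?thesis
      by (intro classifiedI[of 662 "\<lambda>x y. vmem 5 x \<and> vmem 1 y" R0 R0])
        (simp add: creps_def, (case_tac x; case_tac y; simp add: v one rot cconj_def vmem_def))
  next
    case right
    then show ?thesis
      by (intro classifiedI[of 226 "\<lambda>x y. vmem 1 x \<and> vmem 5 y" R0 R0])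
        (simp add: creps_def, (case_tac x; case_tac y; simp add: v one rot cconj_def vmem_def))
  next
    case diag
    then show ?thesis using d by (simp add: rot)
  next
    case anti
    then show ?thesis using d by (simp add: rot)
  next
    case all
    then show ?thesis
      by (intro classifiedI[of 666 "\<lambda>x y. vmem 5 x \<and> vmem 5 y" R0 R0])
        (simp add: creps_def, (case_tac x; case_tac y; simp add: v one rot cconj_def vmem_def))
  qed
qed

lemma closed_rel_cconj: "closed_rel (cconj g h P)"
proof
  have i: "cmul (cmul (cinv g) (cmul x x')) g = cmul (cmul (cmul (cinv g) x) g) (cmul (cmul (cinv g) x') g)" for g x x'
    by (metis cmul_assoc cmul_R0(1) cmul_cinv(1))
  show "cconj g h P R0 R0"
    by (simp add: cconj_def one)
  show "cconj g h P (cmul x x') (cmul y y')" if "cconj g h P x y" "cconj g h P x' y'" for x y x' y'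
    using mult that by (simp add: cconj_def i)
qed

text \<open>The third power of a reflection is itself, that of a rotation is 1.\<close>

lemma cube_left: "P x y \<Longrightarrow> \<not> vmem 4 x \<Longrightarrow> vmem 4 y \<Longrightarrow> P x R0"
  using mult[OF mult[of x y x y], of x y] by (cases x; cases y; simp add: vmem_def)

lemma cube_right: "P x y \<Longrightarrow> vmem 4 x \<Longrightarrow> \<not> vmem 4 y \<Longrightarrow> P R0 y"
  using mult[OF mult[of x y x y], of x y] by (cases x; cases y; simp add: vmem_def)

end

lemma conj_refl:
  assumes "\<not> vmem 4 x"
  obtains g where "cmul (cmul (cinv g) M0) g = x"
  using that[of R0] that[of R1] that[of R2] assms by (cases x; simp add: vmem_def)

lemma vmem_4_conj: "vmem 4 (cmul (cmul (cinv g) x) g) = vmem 4 x"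
  by (cases g; cases x; simp add: vmem_def)

text \<open>The image of P under the pair of signs is one of the five subgroups of C2 x C2. Each has
  its own lemma above, applied after conjugating the reflections at hand to a.\<close>

lemma classified_closed_rel:
  assumes "closed_rel P"
  shows "classified P"
proof -
  interpret closed_rel P by fact
  have c: "cmul (cmul (cinv g) R0) g = R0" for g by simp
  show ?thesis
  proof (cases "\<exists>x. \<not> vmem 4 x \<and> P x R0")
    case True
    then obtain x where x: "\<not> vmem 4 x" "P x R0" by blast
    obtain g where g: "cmul (cmul (cinv g) M0) g = x" by (rule conj_refl[OF x(1)])
    show ?thesis
    proof (cases "\<exists>y. \<not> vmem 4 y \<and> P R0 y")
      case True
      then obtain y where y: "\<not> vmem 4 y" "P R0 y" by blast
      obtain h where h: "cmul (cmul (cinv h) M0) h = y" by (rule conj_refl[OF y(1)])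
      have "classified (cconj g h P)"
        by (rule closed_rel.classified_full[OF closed_rel_cconj]) (simp_all only: cconj_def g h c x y)
      then show ?thesis by (rule classified_cconj)
    next
      case False
      \<comment> \<open>A reflection y' could be isolated: multiply by (x, 1) if x' is a reflection
        too, then take the cube.\<close>
      have "vmem 4 y'" if "P x' y'" for x' y'
      proof (rule ccontr)
        assume y': "\<not> vmem 4 y'"
        have "P R0 y'"
        proof (cases "vmem 4 x'")
          case True then show ?thesis using cube_right \<open>P x' y'\<close> y' by blast
        next
          case x': False
          have "P (cmul x x') y'" using mult[OF x(2) \<open>P x' y'\<close>] by simp
          then show ?thesis using cube_right[of "cmul x x'" y'] x x' y' by (simp add: vmem_closed(4))
        qed
        then show False using False y' by blast
      qed
      then have "classified (cconj g R0 P)"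
        by (intro closed_rel.classified_left[OF closed_rel_cconj])
          (simp_all only: cconj_def g c x, metis vmem_4_conj)
      then show ?thesis by (rule classified_cconj)
    qed
  next
    case nl: False
    show ?thesis
    proof (cases "\<exists>y. \<not> vmem 4 y \<and> P R0 y")
      case True
      then obtain y where y: "\<not> vmem 4 y" "P R0 y" by blast
      obtain h where h: "cmul (cmul (cinv h) M0) h = y" by (rule conj_refl[OF y(1)])
      have "vmem 4 x'" if "P x' y'" for x' y'
      proof (rule ccontr)
        assume x': "\<not> vmem 4 x'"
        have "P x' R0"
        proof (cases "vmem 4 y'")
          case True then show ?thesis using cube_left \<open>P x' y'\<close> x' by blast
        next
          case y': False
          have "P x' (cmul y y')" using mult[OF y(2) \<open>P x' y'\<close>] by simp
          then show ?thesis using cube_left[of x' "cmul y y'"] y x' y' by (simp add: vmem_closed(4))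
        qed
        then show False using nl x' by blast
      qed
      then have "classified (cconj R0 h P)"
        by (intro closed_rel.classified_right[OF closed_rel_cconj])
          (simp_all only: cconj_def h c y, metis vmem_4_conj)
      then show ?thesis by (rule classified_cconj)
    next
      case nr: False
      have eq: "vmem 4 x = vmem 4 y" if "P x y" for x y
        using that nl nr cube_left cube_right by blast
      show ?thesis
      proof (cases "\<exists>x y. P x y \<and> \<not> vmem 4 x")
        case True
        then obtain x y where xy: "P x y" "\<not> vmem 4 x" "\<not> vmem 4 y" using eq by blast
        obtain g where g: "cmul (cmul (cinv g) M0) g = x" by (rule conj_refl[OF xy(2)])
        obtain h where h: "cmul (cmul (cinv h) M0) h = y" by (rule conj_refl[OF xy(3)])
        have "classified (cconj g h P)"
          by (intro closed_rel.classified_diag[OF closed_rel_cconj])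
            (simp_all only: cconj_def g h xy, metis vmem_4_conj eq)
        then show ?thesis by (rule classified_cconj)
      next
        case False
        then show ?thesis using classified_rot eq by blast
      qed
    qed
  qed
qed

definition type_rep :: "nat \<Rightarrow> ((nat \<Rightarrow> nat) \<times> (nat \<Rightarrow> nat)) set" where
  "type_rep i = rel_of (the (map_of creps i))"

definition types :: "nat list" where
  "types = map fst creps"

lemma distinct_types: "distinct types"
  by (simp add: types_def creps_def)

lemma type_rep_creps: "(i, P) \<in> set creps \<Longrightarrow> type_rep i = rel_of P"
  using distinct_types by (simp add: type_rep_def types_def)

interpretation S3: class_reps S3 "set types" type_rep
proof (intro class_reps.intro class_reps_axioms.intro)
  show "fin_group S3" ..
  show "finite (set types)" by simp
  show "subgroup (type_rep i) (S3 \<times>\<times> S3)" "rel_type S3 (type_rep i) = i" if "i \<in> set types" for i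
    using that subgroup_creps ctype_creps by (auto simp: types_def type_rep_creps rel_type_rel_of list_all_iff)
next
  fix U assume "subgroup U (S3 \<times>\<times> S3)"
  then obtain P where P: "U = rel_of P" "P R0 R0" "\<And>x y x' y'. P x y \<Longrightarrow> P x' y' \<Longrightarrow> P (cmul x x') (cmul y y')"
    by (rule subgroup_rel_ofE) blast
  then have "classified P"
    by (intro classified_closed_rel) (simp add: closed_rel_def)
  then obtain i Q g h where Q: "(i, Q) \<in> set creps" "P = cconj g h Q"
    unfolding classified_def by blast
  show "\<exists>i\<in>set types. \<exists>g\<in>carrier S3. \<exists>h\<in>carrier S3. U = conj_rel S3 g h (type_rep i)"
    by (intro bexI[of _ i] bexI[of _ "enc g"] bexI[of _ "enc h"])
      (use Q in \<open>force simp: P(1) type_rep_creps conj_rel_of types_def\<close>)+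
qed

text \<open>Tables of relations keep the evaluation of the Mackey sums by rewriting feasible.\<close>

fun pick :: "'a list \<Rightarrow> s3 \<Rightarrow> 'a" where
  "pick [a, b, c, d, e, f] x = (case x of R0 \<Rightarrow> a | R1 \<Rightarrow> b | R2 \<Rightarrow> c | M0 \<Rightarrow> d | M1 \<Rightarrow> e | M2 \<Rightarrow> f)"

definition tab :: "(s3 \<Rightarrow> s3 \<Rightarrow> bool) \<Rightarrow> bool list list" where
  "tab P = map (\<lambda>x. map (P x) els) els"

fun ors :: "bool list \<Rightarrow> bool list \<Rightarrow> bool list" where
  "ors (a # as) (b # bs) = (if a then True else b) # ors as bs"
| "ors as [] = []"
| "ors [] bs = []"

fun or_rows :: "bool list \<Rightarrow> bool list list \<Rightarrow> bool list" where
  "or_rows (a # as) (r # rs) = (if a then ors r (or_rows as rs) else or_rows as rs)"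
| "or_rows as [] = [False, False, False, False, False, False]"
| "or_rows [] rs = [False, False, False, False, False, False]"

fun count_true :: "bool list \<Rightarrow> nat" where
  "count_true [] = 0" | "count_true (a # as) = (if a then Suc (count_true as) else count_true as)"

text \<open>Matches the row of 1 in the left factor against the column of 1 in the right one, which
  gives the value of \<open>kernel_meet\<close>.\<close>

fun meet :: "bool list \<Rightarrow> bool list list \<Rightarrow> nat" where
  "meet (a # as) (r # rs) = (if a then if hd r then Suc (meet as rs) else meet as rs else meet as rs)"
| "meet as [] = 0"
| "meet [] rs = 0"

text \<open>The entries are the kernel weight, the order of the relation, and the orders of first
  projection, kernel and second projection that make up its type.\<close>

definition rel_data :: "bool list list \<Rightarrow> nat \<Rightarrow> nat \<times> nat \<times> nat \<times> nat \<times> nat" where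
  "rel_data C k = (k, count_true (concat C), count_true (map (list_ex id) C), count_true (map hd C),
     count_true (or_rows [True, True, True, True, True, True] C))"

text \<open>Only the first coordinate of the right factor is conjugated, so its table is changed by
  a permutation of rows: row x becomes the old row h^-1 x h.\<close>

definition mackey_table :: "bool list list \<Rightarrow> bool list list \<Rightarrow> (nat \<times> nat \<times> nat \<times> nat \<times> nat) list" where
  "mackey_table L B = map (\<lambda>h. (\<lambda>B'. rel_data (map (\<lambda>r. or_rows r B') L) (meet (hd L) B'))
     (map (\<lambda>x. pick B (cmul (cmul (cinv h) x) h)) els)) els"

lemma mackey_table_313:
  "map (\<lambda>(i, Q). (i, mackey_table (tab (\<lambda>x y. x = y \<and> vmem 4 x)) (tab Q))) creps = [
    (111, replicate 6 (1, 1, 1, 1, 1)),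
    (112, replicate 6 (1, 2, 1, 1, 2)),
    (113, replicate 6 (1, 3, 1, 1, 3)),
    (116, replicate 6 (1, 6, 1, 1, 6)),
    (221, replicate 6 (1, 1, 1, 1, 1)),
    (222, replicate 6 (1, 2, 1, 1, 2)),
    (223, replicate 6 (1, 3, 1, 1, 3)),
    (226, replicate 6 (1, 6, 1, 1, 6)),
    (331, replicate 6 (1, 3, 3, 3, 1)),
    (332, replicate 6 (1, 6, 3, 3, 2)),
    (333, replicate 6 (1, 9, 3, 3, 3)),
    (336, replicate 6 (1, 18, 3, 3, 6)),
    (661, replicate 6 (1, 3, 3, 3, 1)),
    (662, replicate 6 (1, 6, 3, 3, 2)),
    (663, replicate 6 (1, 9, 3, 3, 3)),
    (666, replicate 6 (1, 18, 3, 3, 6)),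
    (212, replicate 6 (1, 1, 1, 1, 1)),
    (313, replicate 6 (1, 3, 3, 1, 3)),
    (616, replicate 6 (1, 3, 3, 1, 3)),
    (216, replicate 6 (1, 3, 1, 1, 3)),
    (632, replicate 6 (1, 3, 3, 3, 1)),
    (636, replicate 6 (1, 9, 3, 3, 3))]"
  by code_simp

lemma mackey_table_216:
  "map (\<lambda>(i, Q). (i, mackey_table (tab (\<lambda>x y. vmem 1 x \<and> vmem 4 x = vmem 4 y)) (tab Q))) creps = [
    (111, replicate 6 (1, 1, 1, 1, 1)),
    (112, replicate 6 (1, 2, 1, 1, 2)),
    (113, replicate 6 (1, 3, 1, 1, 3)),
    (116, replicate 6 (1, 6, 1, 1, 6)),
    (221, replicate 6 (1, 2, 2, 2, 1)),
    (222, replicate 6 (1, 4, 2, 2, 2)),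
    (223, replicate 6 (1, 6, 2, 2, 3)),
    (226, replicate 6 (1, 12, 2, 2, 6)),
    (331, replicate 6 (3, 1, 1, 1, 1)),
    (332, replicate 6 (3, 2, 1, 1, 2)),
    (333, replicate 6 (3, 3, 1, 1, 3)),
    (336, replicate 6 (3, 6, 1, 1, 6)),
    (661, replicate 6 (3, 2, 2, 2, 1)),
    (662, replicate 6 (3, 4, 2, 2, 2)),
    (663, replicate 6 (3, 6, 2, 2, 3)),
    (666, replicate 6 (3, 12, 2, 2, 6)),
    (212, replicate 6 (1, 2, 2, 1, 2)),
    (313, replicate 6 (1, 3, 1, 1, 3)),
    (616, replicate 6 (1, 6, 2, 1, 6)),
    (216, replicate 6 (1, 6, 2, 1, 6)),
    (632, replicate 6 (3, 2, 2, 1, 2)),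
    (636, replicate 6 (3, 6, 2, 1, 6))]"
  by code_simp

text \<open>The left factor has second projection generated by a. Where the six terms differ, the
  right factor has the same group as first projection, and the first and fourth terms belong to h =
  1 and h = a, which normalize it. These are the two double cosets of that group.\<close>

lemma mackey_table_632:
  "map (\<lambda>(i, Q). (i, mackey_table (tab (\<lambda>x y. vmem 1 y \<and> vmem 4 x = vmem 4 y)) (tab Q))) creps = [
    (111, replicate 6 (1, 3, 3, 3, 1)),
    (112, replicate 6 (1, 6, 3, 3, 2)),
    (113, replicate 6 (1, 9, 3, 3, 3)),
    (116, replicate 6 (1, 18, 3, 3, 6)),
    (221, [(1, 6, 6, 6, 1), (1, 3, 3, 3, 1), (1, 3, 3, 3, 1), (1, 6, 6, 6, 1), (1, 3, 3, 3, 1), (1, 3, 3, 3, 1)]),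
    (222, [(1, 12, 6, 6, 2), (1, 6, 3, 3, 2), (1, 6, 3, 3, 2), (1, 12, 6, 6, 2), (1, 6, 3, 3, 2), (1, 6, 3, 3, 2)]),
    (223, [(1, 18, 6, 6, 3), (1, 9, 3, 3, 3), (1, 9, 3, 3, 3), (1, 18, 6, 6, 3), (1, 9, 3, 3, 3), (1, 9, 3, 3, 3)]),
    (226, [(1, 36, 6, 6, 6), (1, 18, 3, 3, 6), (1, 18, 3, 3, 6), (1, 36, 6, 6, 6), (1, 18, 3, 3, 6), (1, 18, 3, 3, 6)]),
    (331, replicate 6 (1, 3, 3, 3, 1)),
    (332, replicate 6 (1, 6, 3, 3, 2)),
    (333, replicate 6 (1, 9, 3, 3, 3)),
    (336, replicate 6 (1, 18, 3, 3, 6)),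
    (661, replicate 6 (1, 6, 6, 6, 1)),
    (662, replicate 6 (1, 12, 6, 6, 2)),
    (663, replicate 6 (1, 18, 6, 6, 3)),
    (666, replicate 6 (1, 36, 6, 6, 6)),
    (212, [(1, 6, 6, 3, 2), (1, 3, 3, 3, 1), (1, 3, 3, 3, 1), (1, 6, 6, 3, 2), (1, 3, 3, 3, 1), (1, 3, 3, 3, 1)]),
    (313, replicate 6 (1, 3, 3, 3, 1)),
    (616, replicate 6 (1, 6, 6, 3, 2)),
    (216, [(1, 18, 6, 3, 6), (1, 9, 3, 3, 3), (1, 9, 3, 3, 3), (1, 18, 6, 3, 6), (1, 9, 3, 3, 3), (1, 9, 3, 3, 3)]),
    (632, replicate 6 (1, 6, 6, 3, 2)),
    (636, replicate 6 (1, 18, 6, 3, 6))]"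
  by code_simp

lemma mackey_table_666:
  "map (\<lambda>(i, Q). (i, mackey_table (tab (\<lambda>x y. vmem 5 x \<and> vmem 5 y)) (tab Q))) creps = [
    (111, replicate 6 (1, 6, 6, 6, 1)),
    (112, replicate 6 (1, 12, 6, 6, 2)),
    (113, replicate 6 (1, 18, 6, 6, 3)),
    (116, replicate 6 (1, 36, 6, 6, 6)),
    (221, replicate 6 (2, 6, 6, 6, 1)),
    (222, replicate 6 (2, 12, 6, 6, 2)),
    (223, replicate 6 (2, 18, 6, 6, 3)),
    (226, replicate 6 (2, 36, 6, 6, 6)),
    (331, replicate 6 (3, 6, 6, 6, 1)),
    (332, replicate 6 (3, 12, 6, 6, 2)),
    (333, replicate 6 (3, 18, 6, 6, 3)),
    (336, replicate 6 (3, 36, 6, 6, 6)),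
    (661, replicate 6 (6, 6, 6, 6, 1)),
    (662, replicate 6 (6, 12, 6, 6, 2)),
    (663, replicate 6 (6, 18, 6, 6, 3)),
    (666, replicate 6 (6, 36, 6, 6, 6)),
    (212, replicate 6 (1, 12, 6, 6, 2)),
    (313, replicate 6 (1, 18, 6, 6, 3)),
    (616, replicate 6 (1, 36, 6, 6, 6)),
    (216, replicate 6 (1, 36, 6, 6, 6)),
    (632, replicate 6 (3, 12, 6, 6, 2)),
    (636, replicate 6 (3, 36, 6, 6, 6))]"
  by code_simp

section \<open>The algebra \<open>A\<close> in coordinates\<close>

text \<open>The 22 coordinates are numbered row by row with the zero entries skipped. The last
  column sits at 3, 7, 11, 13, the bottom row at 15 to 18, and 19, 20, 21 are the constant, \<eta>
  and \<xi> parts of the corner.\<close>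

definition amat :: "(nat \<Rightarrow> rat) \<Rightarrow> qex mat" where
  "amat v = mat_of_rows_list 6
    [[rat_qex (v 0), rat_qex (v 1), rat_qex (v 2), 0, 0, rat_qex (v 3)],
     [rat_qex (v 4), rat_qex (v 5), rat_qex (v 6), 0, 0, rat_qex (v 7)],
     [rat_qex (v 8), rat_qex (v 9), rat_qex (v 10), 0, 0, rat_qex (v 11)],
     [0, 0, 0, rat_qex (v 12), 0, rat_qex (v 13)],
     [0, 0, 0, 0, rat_qex (v 14), 0],
     [rat_qex (v 15), rat_qex (v 16), rat_qex (v 17), rat_qex (v 18), 0, Qex (v 19) (v 20) (v 21)]]"

definition coord :: "qex mat \<Rightarrow> nat \<Rightarrow> rat" where
  "coord X = (!) [
    const_part (X $$ (0, 0)), const_part (X $$ (0, 1)),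
    const_part (X $$ (0, 2)), const_part (X $$ (0, 5)),
    const_part (X $$ (1, 0)), const_part (X $$ (1, 1)),
    const_part (X $$ (1, 2)), const_part (X $$ (1, 5)),
    const_part (X $$ (2, 0)), const_part (X $$ (2, 1)),
    const_part (X $$ (2, 2)), const_part (X $$ (2, 5)),
    const_part (X $$ (3, 3)), const_part (X $$ (3, 5)),
    const_part (X $$ (4, 4)), const_part (X $$ (5, 0)),
    const_part (X $$ (5, 1)), const_part (X $$ (5, 2)),
    const_part (X $$ (5, 3)), const_part (X $$ (5, 5)),
    eta_part (X $$ (5, 5)), xi_part (X $$ (5, 5))]"

text \<open>The product of A in coordinates. Products of the last column with the bottom row are
  absent from entries 0 to 10 and 12, since the maps for (1,4,1) and (2,4,2) vanish. They return at
  20 and 21 in the opposite order; the -12 there stems from \<xi> - 12 \<eta>.\<close>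

definition amul :: "(nat \<Rightarrow> rat) \<Rightarrow> (nat \<Rightarrow> rat) \<Rightarrow> nat \<Rightarrow> rat" where
  "amul v w = (!) [
    v 0 * w 0 + v 1 * w 4 + v 2 * w 8,
    v 0 * w 1 + v 1 * w 5 + v 2 * w 9,
    v 0 * w 2 + v 1 * w 6 + v 2 * w 10,
    v 0 * w 3 + v 1 * w 7 + v 2 * w 11 + v 3 * w 19,
    v 4 * w 0 + v 5 * w 4 + v 6 * w 8,
    v 4 * w 1 + v 5 * w 5 + v 6 * w 9,
    v 4 * w 2 + v 5 * w 6 + v 6 * w 10,
    v 4 * w 3 + v 5 * w 7 + v 6 * w 11 + v 7 * w 19,
    v 8 * w 0 + v 9 * w 4 + v 10 * w 8,
    v 8 * w 1 + v 9 * w 5 + v 10 * w 9,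
    v 8 * w 2 + v 9 * w 6 + v 10 * w 10,
    v 8 * w 3 + v 9 * w 7 + v 10 * w 11 + v 11 * w 19,
    v 12 * w 12,
    v 12 * w 13 + v 13 * w 19,
    v 14 * w 14,
    v 15 * w 0 + v 16 * w 4 + v 17 * w 8 + v 19 * w 15,
    v 15 * w 1 + v 16 * w 5 + v 17 * w 9 + v 19 * w 16,
    v 15 * w 2 + v 16 * w 6 + v 17 * w 10 + v 19 * w 17,
    v 18 * w 12 + v 19 * w 18,
    v 19 * w 19,
    v 15 * w 3 + v 16 * w 7 + v 17 * w 11 - 12 * v 18 * w 13 + v 19 * w 20 + v 20 * w 19,
    v 18 * w 13 + v 19 * w 21 + v 21 * w 19]"

lemma lt_6_cases:
  assumes "(p::nat) < 6"
  obtains "p = 0" | "p = 1" | "p = 2" | "p = 3" | "p = 4" | "p = 5"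
  using assms by linarith

lemma lt_22_cases:
  assumes "(k::nat) < 22"
  shows "k \<in> {0, 1, 2, 3, 4, 5, 6, 7, 8, 9, 10, 11, 12, 13, 14, 15, 16, 17, 18, 19, 20, 21}"
  using assms by simp presburger

text \<open>Turns a vector given by a list into 22 separate rewrite rules, so that one coordinate
  can be expanded without the others.\<close>

lemma nth_coords:
  assumes "v = (!) [a0, a1, a2, a3, a4, a5, a6, a7, a8, a9, a10, a11, a12, a13, a14, a15, a16, a17, a18, a19, a20, a21]"
  shows "v 0 = a0" "v 1 = a1" "v 2 = a2" "v 3 = a3" "v 4 = a4" "v 5 = a5" "v 6 = a6" "v 7 = a7" "v 8 = a8" "v 9 = a9" "v 10 = a10" "v 11 = a11" "v 12 = a12" "v 13 = a13" "v 14 = a14" "v 15 = a15" "v 16 = a16" "v 17 = a17" "v 18 = a18" "v 19 = a19" "v 20 = a20" "v 21 = a21"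
  by (simp_all add: assms)

lemmas amul_nth = nth_coords[OF amul_def]

lemma dim_amat [simp]: "dim_row (amat v) = 6" "dim_col (amat v) = 6"
  by (simp_all add: amat_def mat_of_rows_list_def)

lemma rat_qex_simps [simp]:
  "const_part (rat_qex a) = a" "rat_qex 0 = 0" "rat_qex 1 = 1"
  "const_part 0 = 0" "eta_part 0 = 0" "xi_part 0 = 0"
  by (simp_all add: rat_qex_def zero_qex_def one_qex_def)

lemma amat_carrier [simp, intro]: "amat v \<in> carrier A"
proof -
  have "amat v $$ (p, q) \<in> A_entries (block p) (block q)" if "p < 6" "q < 6" for p q
    using that
    by (elim lt_6_cases; simp add: amat_def mat_of_rows_list_def A_entries_def A_support_def block_def)
      (auto simp: rat_qex_def)
  then show ?thesis
    by (auto simp: A_def intro!: carrier_matI)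
qed

lemma coord_amat: "k < 22 \<Longrightarrow> coord (amat v) k = v k"
  by (drule lt_22_cases) (auto simp: coord_def amat_def mat_of_rows_list_def)

lemma amat_coord:
  assumes "X \<in> carrier A"
  shows "amat (coord X) = X"
proof (rule eq_matI)
  fix p q assume "p < dim_row X" "q < dim_col X"
  then have pq: "p < 6" "q < 6"
    using assms by (auto simp: A_def)
  then have "X $$ (p, q) \<in> A_entries (block p) (block q)"
    using assms by (auto simp: A_def)
  then show "amat (coord X) $$ (p, q) = X $$ (p, q)"
    using pq
    by (elim lt_6_cases; simp add: amat_def coord_def mat_of_rows_list_def A_entries_def A_support_def block_def)
      (auto simp: rat_qex_def)
qed (use assms in \<open>auto simp: A_def\<close>)

lemma amat_eq_iff: "amat v = amat w \<longleftrightarrow> (\<forall>k<22. v k = w k)"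
proof
  show "amat v = amat w \<Longrightarrow> \<forall>k<22. v k = w k"
    by (metis coord_amat)
  show "\<forall>k<22. v k = w k \<Longrightarrow> amat v = amat w"
    by (simp add: amat_def)
qed

lemma amat_add: "amat v + amat w = amat (\<lambda>k. v k + w k)"
proof (rule eq_matI)
  fix p q assume "p < dim_row (amat (\<lambda>k. v k + w k))" "q < dim_col (amat (\<lambda>k. v k + w k))"
  then have "p < 6" "q < 6" by simp_all
  then show "(amat v + amat w) $$ (p, q) = amat (\<lambda>k. v k + w k) $$ (p, q)"
    by (elim lt_6_cases; simp; simp add: amat_def mat_of_rows_list_def rat_qex_def plus_qex_def zero_qex_def)
qed simp_all

lemma numeral_qex: "numeral n = Qex (numeral n) 0 0"
proof -
  have "of_nat k = Qex (of_nat k) 0 0" for k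
    by (induction k) (simp_all add: zero_qex_def one_qex_def plus_qex_def)
  from this[of "numeral n"] show ?thesis by simp
qed

lemma A_mult_amat: "A_mult (amat v) (amat w) = amat (amul v w)"
proof (rule eq_matI)
  fix p q assume "p < dim_row (amat (amul v w))" "q < dim_col (amat (amul v w))"
  then have pq: "p < 6" "q < 6" by simp_all
  have s: "(\<Sum>r<6. f r) = f 0 + f 1 + f 2 + f 3 + f 4 + f 5" for f :: "nat \<Rightarrow> qex"
    by (simp add: eval_nat_numeral)
  show "A_mult (amat v) (amat w) $$ (p, q) = amat (amul v w) $$ (p, q)"
    using pq
    by (elim lt_6_cases; simp add: A_mult_def s \<alpha>_def block_def A_support_def;
      simp add: amat_def amul_def mat_of_rows_list_def rat_qex_def plus_qex_def minus_qex_def zero_qex_def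
        times_qex_def \<eta>_def \<xi>_def numeral_qex algebra_simps)
qed (simp_all add: A_mult_def)


lemma A_simps:
  "X \<otimes>\<^bsub>A\<^esub> Y = A_mult X Y" "X \<oplus>\<^bsub>A\<^esub> Y = X + Y" "\<one>\<^bsub>A\<^esub> = 1\<^sub>m 6" "\<zero>\<^bsub>A\<^esub> = 0\<^sub>m 6 6"
  by (simp_all add: A_def)

lemma carrier_A: "carrier A = range amat"
proof
  show "carrier A \<subseteq> range amat"
    using amat_coord by (metis rangeI subsetI)
qed auto

definition one_coord :: "nat \<Rightarrow> rat" where
  "one_coord = (!) [1, 0, 0, 0, 0, 1, 0, 0, 0, 0, 1, 0, 1, 0, 1, 0, 0, 0, 0, 1, 0, 0]"

lemma one_amat: "1\<^sub>m 6 = amat one_coord"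
proof (rule eq_matI)
  fix p q assume "p < dim_row (amat one_coord)" "q < dim_col (amat one_coord)"
  then have "p < 6" "q < 6" by simp_all
  then show "1\<^sub>m 6 $$ (p, q) = amat one_coord $$ (p, q)"
    by (elim lt_6_cases; simp add: amat_def one_coord_def mat_of_rows_list_def; simp add: one_qex_def)
qed simp_all

lemma zero_amat: "0\<^sub>m 6 6 = amat (\<lambda>_. 0)"
proof (rule eq_matI)
  fix p q assume "p < dim_row (amat (\<lambda>_. 0))" "q < dim_col (amat (\<lambda>_. 0))"
  then have "p < 6" "q < 6" by simp_all
  then show "0\<^sub>m 6 6 $$ (p, q) = amat (\<lambda>_. 0) $$ (p, q)"
    by (elim lt_6_cases; simp add: amat_def mat_of_rows_list_def; simp add: zero_qex_def)
qed simp_all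

lemma amul_one:
  assumes "k < 22"
  shows "amul one_coord v k = v k" "amul v one_coord k = v k"
  using lt_22_cases[OF assms] by (auto simp: amul_def one_coord_def)

text \<open>Associativity of A is not inherited from a full matrix ring, because some of the
  bilinear maps are zero or twisted; it is verified in each coordinate.\<close>

lemma amul_assoc:
  assumes "k < 22"
  shows "amul (amul u v) w k = amul u (amul v w) k"
  using lt_22_cases[OF assms] by (elim insertE emptyE; simp only: amul_nth; simp add: algebra_simps)

lemma amul_add:
  assumes "k < 22"
  shows "amul (\<lambda>i. u i + v i) w k = amul u w k + amul v w k" "amul w (\<lambda>i. u i + v i) k = amul w u k + amul w v k"
  using lt_22_cases[OF assms] by (elim insertE emptyE; simp only: amul_nth; simp add: algebra_simps)+

lemma ring_A: "ring A"
proof (rule ringI)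
  show "abelian_group A"
  proof (rule abelian_groupI)
    fix X assume "X \<in> carrier A"
    then obtain v where "X = amat v" by (auto simp: carrier_A)
    then show "\<exists>Y\<in>carrier A. Y \<oplus>\<^bsub>A\<^esub> X = \<zero>\<^bsub>A\<^esub>"
      by (intro bexI[of _ "amat (\<lambda>k. - v k)"]) (simp_all add: A_simps amat_add zero_amat)
  qed (auto simp: carrier_A A_simps amat_add zero_amat amat_eq_iff)
  show "monoid A"
    by (rule monoidI) (auto simp: carrier_A A_simps A_mult_amat one_amat amat_eq_iff amul_one amul_assoc)
qed (auto simp: carrier_A A_simps A_mult_amat amat_add amat_eq_iff amul_add)

interpretation A: ring A
  by (rule ring_A)

definition c1_coord :: "nat \<Rightarrow> rat" where
  "c1_coord = (!) [0, -2, 0, 0, 6, 6, -4, 0, 0, 0, 1, 0, 1, 0, 1, 0, 0, 0, 0, 1, 0, 0]"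

definition c1_inv_coord :: "nat \<Rightarrow> rat" where
  "c1_inv_coord = (!) [1/2, 1/6, 2/3, 0, - (1/2), 0, 0, 0, 0, 0, 1, 0, 1, 0, 1, 0, 0, 0, 0, 1, 0, 0]"

definition c2_coord :: "nat \<Rightarrow> rat" where
  "c2_coord = (!) [1, 0, 0, 0, 0, 1, 0, 0, 0, 7, 1, 0, 1, 0, 1, 0, 0, 0, 0, 1, 0, 0]"

definition c2_inv_coord :: "nat \<Rightarrow> rat" where
  "c2_inv_coord = (!) [1, 0, 0, 0, 0, 1, 0, 0, 0, -7, 1, 0, 1, 0, 1, 0, 0, 0, 0, 1, 0, 0]"

definition c3_coord :: "nat \<Rightarrow> rat" where
  "c3_coord = (!) [1, 0, 0, 0, 0, 1, 0, 0, 0, 0, 1, 1, 1, 0, 1, 0, 0, 6, 0, 1, 0, 0]"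

text \<open>The 6 at index 20 cancels the -6 \<eta> that bottom row times last column contributes to
  the corner. The opposite product contributes nothing to the first block.\<close>

definition c3_inv_coord :: "nat \<Rightarrow> rat" where
  "c3_inv_coord = (!) [1, 0, 0, 0, 0, 1, 0, 0, 0, 0, 1, -1, 1, 0, 1, 0, 0, -6, 0, 1, 6, 0]"

lemmas c_coord_defs = c1_coord_def c2_coord_def c3_coord_def c1_inv_coord_def c2_inv_coord_def c3_inv_coord_def

lemma c_amat: "c\<^sub>1 = amat c1_coord" "c\<^sub>2 = amat c2_coord" "c\<^sub>3 = amat c3_coord"
  by (simp_all add: c\<^sub>1_def c\<^sub>2_def c\<^sub>3_def amat_def c_coord_defs rat_qex_def[symmetric])
    (simp_all add: rat_qex_def numeral_qex one_qex_def zero_qex_def uminus_qex_def)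

lemma c_inv:
  "inv\<^bsub>A\<^esub> c\<^sub>1 = amat c1_inv_coord" "inv\<^bsub>A\<^esub> c\<^sub>2 = amat c2_inv_coord" "inv\<^bsub>A\<^esub> c\<^sub>3 = amat c3_inv_coord"
proof -
  have m: "amat v \<otimes>\<^bsub>A\<^esub> amat w = \<one>\<^bsub>A\<^esub> \<longleftrightarrow> (\<forall>k<22. amul v w k = one_coord k)" for v w
    by (simp add: A_simps A_mult_amat one_amat amat_eq_iff)
  have 1: "\<forall>k<22. amul c1_coord c1_inv_coord k = one_coord k" "\<forall>k<22. amul c1_inv_coord c1_coord k = one_coord k"
    by (auto dest!: lt_22_cases simp: amul_def c_coord_defs one_coord_def)
  have 2: "\<forall>k<22. amul c2_coord c2_inv_coord k = one_coord k" "\<forall>k<22. amul c2_inv_coord c2_coord k = one_coord k"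
    by (auto dest!: lt_22_cases simp: amul_def c_coord_defs one_coord_def)
  have 3: "\<forall>k<22. amul c3_coord c3_inv_coord k = one_coord k" "\<forall>k<22. amul c3_inv_coord c3_coord k = one_coord k"
    by (auto dest!: lt_22_cases simp: amul_def c_coord_defs one_coord_def)
  have inv: "inv\<^bsub>A\<^esub> amat v = amat w"
    if "\<forall>k<22. amul v w k = one_coord k" "\<forall>k<22. amul w v k = one_coord k" for v w
    by (rule A.inv_unique'[symmetric]) (use that m in auto)
  show "inv\<^bsub>A\<^esub> c\<^sub>1 = amat c1_inv_coord" "inv\<^bsub>A\<^esub> c\<^sub>2 = amat c2_inv_coord" "inv\<^bsub>A\<^esub> c\<^sub>3 = amat c3_inv_coord"
    unfolding c_amat by (rule inv[OF 1] inv[OF 2] inv[OF 3])+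
qed

section \<open>Left multiplication by the four generators\<close>

lemma mackey_terms_table:
  "mackey_terms P Q = map (\<lambda>(k, s, p, r, q). (k * s, 100 * p + 10 * r + q)) (mackey_table (tab P) (tab Q))"
proof -
  have pick: "pick (map f els) x = f x" for f :: "s3 \<Rightarrow> bool list" and x
    by (cases x) (simp_all add: els_def)
  have ors: "ors (map f xs) (map g xs) = map (\<lambda>y. f y \<or> g y) xs" for f g :: "s3 \<Rightarrow> bool" and xs
    by (induction xs) auto
  have or_rows: "or_rows (map f xs) (map (\<lambda>z. map (g z) els) xs) = map (\<lambda>y. list_ex (\<lambda>z. f z \<and> g z y) xs) els"
    for f :: "s3 \<Rightarrow> bool" and g xs
  proof (induction xs)
    case Nil
    show ?case by (simp add: els_def)
  next
    case (Cons x xs)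
    then show ?case
      by (auto simp: ors[of "g x" els])
  qed
  have or_rows': "or_rows [True, True, True, True, True, True] (map (\<lambda>z. map (g z) els) els) = map (\<lambda>y. list_ex (\<lambda>z. g z y) els) els"
    for g
    using or_rows[of "\<lambda>_. True" els g] by (simp add: els_def)
  have ct: "count_true (map f xs) = length (filter f xs)" for f and xs :: "s3 list"
    by (induction xs) auto
  have ct_concat: "count_true (concat (map (\<lambda>x. map (g x) els) xs)) = sum_list (map (\<lambda>x. cnt (g x)) xs)" for g xs
  proof -
    have app: "count_true (as @ bs) = count_true as + count_true bs" for as bs
      by (induction as) auto
    show ?thesis
      by (induction xs) (auto simp: app ct cnt_def)
  qed
  have meet: "meet (map f xs) (map (\<lambda>z. map (g z) els) xs) = length (filter (\<lambda>z. f z \<and> g z R0) xs)" for f g and xs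
    by (induction xs) (auto simp: els_def)
  have tab_conj: "map (\<lambda>x. pick (tab Q) (cmul (cmul (cinv h) x) h)) els = map (\<lambda>x. map (cconj h R0 Q x) els) els" for h
    unfolding tab_def pick by (simp add: cconj_def)
  have tab_comp: "map (\<lambda>r. or_rows r (map (\<lambda>x. map (Q' x) els) els)) (tab P) = map (\<lambda>x. map (ccomp P Q' x) els) els" for Q'
    unfolding tab_def map_map comp_def or_rows by (simp add: ccomp_def)
  have hd: "hd (tab P) = map (P R0) els" "hd (map (g x) els) = g x R0" for g :: "s3 \<Rightarrow> s3 \<Rightarrow> bool" and x
    by (simp_all add: tab_def els_def)
  have ex: "list_ex id (map f xs) = list_ex f xs" for f and xs :: "s3 list"
    by (induction xs) auto
  show ?thesis
    unfolding mackey_terms_def mackey_table_def map_map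
  proof (rule map_cong[OF refl])
    fix h
    show "(let Q' = cconj h R0 Q; C = ccomp P Q' in (cnt (\<lambda>z. P R0 z \<and> Q' z R0) * csize C, ctype C)) =
      ((\<lambda>(k, s, p, r, q). (k * s, 100 * p + 10 * r + q)) \<circ>
       (\<lambda>h. (\<lambda>B'. rel_data (map (\<lambda>r. or_rows r B') (tab P)) (meet (hd (tab P)) B'))
         (map (\<lambda>x. pick (tab Q) (cmul (cmul (cinv h) x) h)) els))) h"
      unfolding comp_def tab_conj tab_comp hd(1) meet rel_data_def ct_concat or_rows' ct map_map ex hd(2)
      by (simp add: Let_def cnt_def csize_def ctype_def comp_def ex hd(2) ct)
  qed
qed

definition crep :: "nat \<Rightarrow> s3 \<Rightarrow> s3 \<Rightarrow> bool" where
  "crep i = the (map_of creps i)"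

lemma type_rep_crep: "type_rep i = rel_of (crep i)"
  by (simp add: type_rep_def crep_def)

text \<open>Reads one entry out of a table that was evaluated for all types at once.\<close>

lemma creps_lookup:
  assumes "map (\<lambda>(i, Q). (i, f Q)) creps = L" and i: "i \<in> set types"
  shows "f (crep i) = the (map_of L i)"
proof -
  have "map_of L i = map_option f (map_of creps i)"
    unfolding assms(1)[symmetric] by (simp add: map_of_map)
  moreover obtain Q where "map_of creps i = Some Q"
    using i by (auto simp: types_def) (metis map_of_eq_None_iff fst_conv image_eqI not_None_eq)
  ultimately show ?thesis
    by (simp add: crep_def)
qed

lemma set_types: "set types = {111, 112, 113, 116, 221, 222, 223, 226, 331, 332, 333, 336, 661, 662, 663, 666, 212, 313, 616, 216, 632, 636}"
  by (simp add: types_def creps_def insert_commute)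

lemma types_cases:
  assumes "i \<in> set types"
  shows "i = 111 \<or> i = 112 \<or> i = 113 \<or> i = 116 \<or> i = 221 \<or> i = 222 \<or> i = 223 \<or> i = 226 \<or> i = 331 \<or> i = 332 \<or> i = 333 \<or> i = 336 \<or> i = 661 \<or> i = 662 \<or> i = 663 \<or> i = 666 \<or> i = 212 \<or> i = 313 \<or> i = 616 \<or> i = 216 \<or> i = 632 \<or> i = 636"
  using assms by (simp add: types_def creps_def)

lemma csize_creps: "map (\<lambda>(i, Q). (i, csize Q)) creps = [(111, 1), (112, 2), (113, 3), (116, 6), (221, 2), (222, 4), (223, 6), (226, 12), (331, 3), (332, 6), (333, 9), (336, 18), (661, 6), (662, 12), (663, 18), (666, 36), (212, 2), (313, 3), (616, 6), (216, 6), (632, 6), (636, 18)]"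
  by code_simp

text \<open>For each type i, the product of \<open>H\<Delta> 4\<close> with the basis element of
  type i, as pairs of a multiplicity and a type. The three later tables do the same for
  \<open>H6\<close>, \<open>H7\<close> and \<open>H 5 5\<close>.\<close>

definition action_313 :: "(nat \<times> (nat \<times> nat) list) list" where
  "action_313 = [(111, [(2, 111)]), (112, [(2, 112)]), (113, [(2, 113)]), (116, [(2, 116)]), (221, [(1, 111)]), (222, [(1, 112)]), (223, [(1, 113)]), (226, [(1, 116)]), (331, [(2, 331)]), (332, [(2, 332)]), (333, [(2, 333)]), (336, [(2, 336)]), (661, [(1, 331)]), (662, [(1, 332)]), (663, [(1, 333)]), (666, [(1, 336)]), (212, [(1, 111)]), (313, [(2, 313)]), (616, [(1, 313)]), (216, [(1, 113)]), (632, [(1, 331)]), (636, [(1, 333)])]"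

lemma mackey_sum_313:
  assumes "i \<in> set types"
  shows "mackey_sum S3 F (type_rep 313) (type_rep i) / of_nat (card (type_rep 313) * card (type_rep i)) =
    (\<Sum>(c, t)\<leftarrow>the (map_of action_313 i). of_nat c * F t)"
proof -
  have "crep 313 = (\<lambda>x y. x = y \<and> vmem 4 x)"
    by (simp add: crep_def creps_def)
  then show ?thesis
    using types_cases[OF assms] creps_lookup[OF mackey_table_313 assms] creps_lookup[OF csize_creps assms]
      creps_lookup[OF csize_creps, of 313]
    unfolding type_rep_crep mackey_sum_rel_of mackey_terms_table card_rel_of action_313_def
    by (elim disjE) (simp_all add: set_types sum_list_replicate)
qed

definition action_216 :: "(nat \<times> (nat \<times> nat) list) list" where
  "action_216 = [(111, [(1, 111)]), (112, [(1, 112)]), (113, [(1, 113)]), (116, [(1, 116)]), (221, [(1, 221)]), (222, [(1, 222)]), (223, [(1, 223)]), (226, [(1, 226)]), (331, [(1, 111)]), (332, [(1, 112)]), (333, [(1, 113)]), (336, [(1, 116)]), (661, [(1, 221)]), (662, [(1, 222)]), (663, [(1, 223)]), (666, [(1, 226)]), (212, [(1, 212)]), (313, [(1, 113)]), (616, [(1, 216)]), (216, [(1, 216)]), (632, [(1, 212)]), (636, [(1, 216)])]"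

lemma mackey_sum_216:
  assumes "i \<in> set types"
  shows "mackey_sum S3 F (type_rep 216) (type_rep i) / of_nat (card (type_rep 216) * card (type_rep i)) =
    (\<Sum>(c, t)\<leftarrow>the (map_of action_216 i). of_nat c * F t)"
proof -
  have "crep 216 = (\<lambda>x y. vmem 1 x \<and> vmem 4 x = vmem 4 y)"
    by (simp add: crep_def creps_def)
  then show ?thesis
    using types_cases[OF assms] creps_lookup[OF mackey_table_216 assms] creps_lookup[OF csize_creps assms]
      creps_lookup[OF csize_creps, of 216]
    unfolding type_rep_crep mackey_sum_rel_of mackey_terms_table card_rel_of action_216_def
    by (elim disjE) (simp_all add: set_types sum_list_replicate)
qed

definition action_632 :: "(nat \<times> (nat \<times> nat) list) list" where
  "action_632 = [(111, [(3, 331)]), (112, [(3, 332)]), (113, [(3, 333)]), (116, [(3, 336)]), (221, [(1, 661), (1, 331)]), (222, [(1, 662), (1, 332)]), (223, [(1, 663), (1, 333)]), (226, [(1, 666), (1, 336)]), (331, [(1, 331)]), (332, [(1, 332)]), (333, [(1, 333)]), (336, [(1, 336)]), (661, [(1, 661)]), (662, [(1, 662)]), (663, [(1, 663)]), (666, [(1, 666)]), (212, [(1, 632), (1, 331)]), (313, [(1, 331)]), (616, [(1, 632)]), (216, [(1, 636), (1, 333)]), (632, [(1, 632)]), (636, [(1, 636)])]"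

lemma mackey_sum_632:
  assumes "i \<in> set types"
  shows "mackey_sum S3 F (type_rep 632) (type_rep i) / of_nat (card (type_rep 632) * card (type_rep i)) =
    (\<Sum>(c, t)\<leftarrow>the (map_of action_632 i). of_nat c * F t)"
proof -
  have "crep 632 = (\<lambda>x y. vmem 1 y \<and> vmem 4 x = vmem 4 y)"
    by (simp add: crep_def creps_def)
  then show ?thesis
    using types_cases[OF assms] creps_lookup[OF mackey_table_632 assms] creps_lookup[OF csize_creps assms]
      creps_lookup[OF csize_creps, of 632]
    unfolding type_rep_crep mackey_sum_rel_of mackey_terms_table card_rel_of action_632_def
    by (elim disjE) (simp_all add: set_types sum_list_replicate)
qed

definition action_666 :: "(nat \<times> (nat \<times> nat) list) list" where
  "action_666 = [(111, [(1, 661)]), (112, [(1, 662)]), (113, [(1, 663)]), (116, [(1, 666)]), (221, [(1, 661)]), (222, [(1, 662)]), (223, [(1, 663)]), (226, [(1, 666)]), (331, [(1, 661)]), (332, [(1, 662)]), (333, [(1, 663)]), (336, [(1, 666)]), (661, [(1, 661)]), (662, [(1, 662)]), (663, [(1, 663)]), (666, [(1, 666)]), (212, [(1, 662)]), (313, [(1, 663)]), (616, [(1, 666)]), (216, [(1, 666)]), (632, [(1, 662)]), (636, [(1, 666)])]"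

lemma mackey_sum_666:
  assumes "i \<in> set types"
  shows "mackey_sum S3 F (type_rep 666) (type_rep i) / of_nat (card (type_rep 666) * card (type_rep i)) =
    (\<Sum>(c, t)\<leftarrow>the (map_of action_666 i). of_nat c * F t)"
proof -
  have "crep 666 = (\<lambda>x y. vmem 5 x \<and> vmem 5 y)"
    by (simp add: crep_def creps_def)
  then show ?thesis
    using types_cases[OF assms] creps_lookup[OF mackey_table_666 assms] creps_lookup[OF csize_creps assms]
      creps_lookup[OF csize_creps, of 666]
    unfolding type_rep_crep mackey_sum_rel_of mackey_terms_table card_rel_of action_666_def
    by (elim disjE) (simp_all add: set_types sum_list_replicate)
qed

section \<open>The basis of the double Burnside algebra of \<open>S\<^sub>3\<close>\<close>

lemma V_eq: "i \<in> {0, 1, 4, 5} \<Longrightarrow> V i = {enc x | x. vmem i x}"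
proof -
  have sub: "subgroup {enc x | x. vmem i x} S3" for i
    using exI[of "vmem i", OF vmem_closed(1)]
    by (intro S3.subgroupI) (auto simp: vmem_closed simp del: enc.simps)
  have rot: "enc R1 \<otimes>\<^bsub>S3\<^esub> enc R1 = enc R2"
    by (simp del: enc.simps)
  have 1: "{enc x | x. vmem 1 x} = generate S3 {enc M0}"
  proof (rule S3.generateI[OF sub])
    fix K assume "subgroup K S3" "{enc M0} \<subseteq> K"
    then show "{enc x | x. vmem 1 x} \<subseteq> K"
      using subgroup.one_closed[of K S3] by (auto simp: vmem_def S3_one simp del: enc.simps)
  qed (auto simp: vmem_def simp del: enc.simps)
  have 4: "{enc x | x. vmem 4 x} = generate S3 {enc R1}"
  proof (rule S3.generateI[OF sub])
    fix K assume "subgroup K S3" "{enc R1} \<subseteq> K"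
    then show "{enc x | x. vmem 4 x} \<subseteq> K"
      using subgroup.one_closed[of K S3] subgroup.m_closed[of K S3 "enc R1" "enc R1"]
      by (auto simp: vmem_def S3_one rot simp del: enc.simps)
  qed (auto simp: vmem_def simp del: enc.simps)
  have 5: "{enc x | x. vmem 5 x} = carrier S3"
    using range_enc by (auto simp: vmem_def simp del: enc.simps)
  assume "i \<in> {0, 1, 4, 5}"
  then show "V i = {enc x | x. vmem i x}"
    using 1 4 5 by (auto simp: V_def vmem_def)
qed

lemma V_times_V: "i \<in> {0, 1, 4, 5} \<Longrightarrow> j \<in> {0, 1, 4, 5} \<Longrightarrow> V i \<times> V j = rel_of (\<lambda>x y. vmem i x \<and> vmem j y)"
  unfolding V_eq rel_of_def by blast

lemma V_diag: "i \<in> {0, 1, 4, 5} \<Longrightarrow> {(x, x) | x. x \<in> V i} = rel_of (\<lambda>x y. x = y \<and> vmem i x)"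
  unfolding V_eq rel_of_def by blast

text \<open>P is a subgroup containing the generators, and by the last assumption it lies in every
  closed relation containing them; minimality replaces a computation of the generated
  subgroup.\<close>

lemma generate_rel_of:
  assumes "(i, P) \<in> set creps" and "X = map_prod enc enc ` set Y" and "\<forall>(x, y)\<in>set Y. P x y"
    and "\<And>Q x y. closed_rel Q \<Longrightarrow> \<forall>(x, y)\<in>set Y. Q x y \<Longrightarrow> P x y \<Longrightarrow> Q x y"
  shows "generate (S3 \<times>\<times> S3) X = type_rep i"
proof -
  interpret GG: group "S3 \<times>\<times> S3" by (intro DirProd_group S3.is_group)
  have "rel_of P = generate (S3 \<times>\<times> S3) X"
  proof (rule GG.generateI[OF subgroup_creps[OF assms(1)]])
    show "X \<subseteq> rel_of P"
      using assms(2,3) by (auto simp del: enc.simps)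
    fix K assume K: "subgroup K (S3 \<times>\<times> S3)" "X \<subseteq> K"
    obtain Q where Q: "K = rel_of Q" "Q R0 R0" "\<And>x y x' y'. Q x y \<Longrightarrow> Q x' y' \<Longrightarrow> Q (cmul x x') (cmul y y')"
      by (rule subgroup_rel_ofE[OF K(1)]) blast
    have "\<forall>(x, y)\<in>set Y. Q x y"
      using K(2) assms(2) by (auto simp: Q(1) image_subset_iff simp del: enc.simps)
    moreover have "closed_rel Q"
      using Q(2,3) by unfold_locales
    ultimately have "P x y \<Longrightarrow> Q x y" for x y
      using assms(4)[of Q] by blast
    then show "rel_of P \<subseteq> K"
      by (auto simp: rel_of_def Q(1) simp del: enc.simps)
  qed
  then show ?thesis
    by (simp add: type_rep_creps[OF assms(1)])
qed

lemma rot_mul_refl: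
  assumes "closed_rel Q" "Q M0 M0"
  shows "Q R0 R0" "Q R0 R1 \<Longrightarrow> Q R0 R2" "Q R1 R0 \<Longrightarrow> Q R2 R0"
    "Q R0 R1 \<Longrightarrow> Q M0 M1" "Q R0 R1 \<Longrightarrow> Q M0 M2" "Q R1 R0 \<Longrightarrow> Q M1 M0" "Q R1 R0 \<Longrightarrow> Q M2 M0"
proof -
  interpret closed_rel Q by fact
  show "Q R0 R0" "Q R0 R1 \<Longrightarrow> Q R0 R2" "Q R1 R0 \<Longrightarrow> Q R2 R0"
    by (simp_all add: one rot)
  show "Q R0 R1 \<Longrightarrow> Q M0 M1" "Q R0 R1 \<Longrightarrow> Q M0 M2" "Q R1 R0 \<Longrightarrow> Q M1 M0" "Q R1 R0 \<Longrightarrow> Q M2 M0"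
    using mult[of R0 R1 M0 M0] mult[of R0 R2 M0 M0] mult[of R1 R0 M0 M0] mult[of R2 R0 M0 M0] assms(2)
    by (simp_all add: rot)
qed

lemma basis_reps:
  shows "H 0 0 = S3.rep_elt 111" "H 0 1 = S3.rep_elt 112" "H 0 4 = S3.rep_elt 113" "H 0 5 = S3.rep_elt 116"
  "H 1 0 = S3.rep_elt 221" "H 1 1 = S3.rep_elt 222" "H 1 4 = S3.rep_elt 223" "H 1 5 = S3.rep_elt 226"
  "H 4 0 = S3.rep_elt 331" "H 4 1 = S3.rep_elt 332" "H 4 4 = S3.rep_elt 333" "H 4 5 = S3.rep_elt 336"
  "H 5 0 = S3.rep_elt 661" "H 5 1 = S3.rep_elt 662" "H 5 4 = S3.rep_elt 663" "H 5 5 = S3.rep_elt 666"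
  "H\<Delta> 1 = S3.rep_elt 212" "H\<Delta> 4 = S3.rep_elt 313" "H\<Delta> 5 = S3.rep_elt 616" "H6 = S3.rep_elt 216"
  "H7 = S3.rep_elt 632" "H8 = S3.rep_elt 636"
proof -
  have H: "H i j = S3.rep_elt t" if "(t, \<lambda>x y. vmem i x \<and> vmem j y) \<in> set creps" "i \<in> {0, 1, 4, 5}" "j \<in> {0, 1, 4, 5}" for i j t
    using that by (simp only: H_def trans_elt_def S3.rep_elt_def V_times_V type_rep_creps)
  show "H 0 0 = S3.rep_elt 111" "H 0 1 = S3.rep_elt 112" "H 0 4 = S3.rep_elt 113" "H 0 5 = S3.rep_elt 116" "H 1 0 = S3.rep_elt 221" "H 1 1 = S3.rep_elt 222" "H 1 4 = S3.rep_elt 223" "H 1 5 = S3.rep_elt 226" "H 4 0 = S3.rep_elt 331" "H 4 1 = S3.rep_elt 332" "H 4 4 = S3.rep_elt 333" "H 4 5 = S3.rep_elt 336" "H 5 0 = S3.rep_elt 661" "H 5 1 = S3.rep_elt 662" "H 5 4 = S3.rep_elt 663" "H 5 5 = S3.rep_elt 666"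
    by (rule H; simp add: creps_def)+
  have D: "H\<Delta> i = S3.rep_elt t" if "type_rep t = rel_of (\<lambda>x y. x = y \<and> vmem i x)" "i \<in> {0, 1, 4, 5}" for i t
    using that by (simp only: H\<Delta>_def trans_elt_def S3.rep_elt_def V_diag)
  show "H\<Delta> 1 = S3.rep_elt 212" "H\<Delta> 4 = S3.rep_elt 313" "H\<Delta> 5 = S3.rep_elt 616"
    by (rule D; simp add: type_rep_def creps_def vmem_def)+
  have 6: "generate (S3 \<times>\<times> S3) {(perm_a, perm_a), (id, perm_b)} = type_rep 216"
  proof (rule generate_rel_of[where Y = "[(M0, M0), (R0, R1)]"])
    show "(216, \<lambda>x y. vmem 1 x \<and> vmem 4 x = vmem 4 y) \<in> set creps" by (simp add: creps_def)
    fix Q x y assume "closed_rel Q" "\<forall>(x, y)\<in>set [(M0, M0), (R0, R1)]. Q x y" "vmem 1 x \<and> vmem 4 x = vmem 4 y"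
    then show "Q x y"
      using rot_mul_refl[of Q] by (cases y) (auto simp: vmem_def)
  qed (auto simp: vmem_def)
  have 7: "generate (S3 \<times>\<times> S3) {(perm_a, perm_a), (perm_b, id)} = type_rep 632"
  proof (rule generate_rel_of[where Y = "[(M0, M0), (R1, R0)]"])
    show "(632, \<lambda>x y. vmem 1 y \<and> vmem 4 x = vmem 4 y) \<in> set creps" by (simp add: creps_def)
    fix Q x y assume "closed_rel Q" "\<forall>(x, y)\<in>set [(M0, M0), (R1, R0)]. Q x y" "vmem 1 y \<and> vmem 4 x = vmem 4 y"
    then show "Q x y"
      using rot_mul_refl[of Q] by (cases x) (auto simp: vmem_def)
  qed (auto simp: vmem_def)
  have 8: "generate (S3 \<times>\<times> S3) {(perm_a, perm_a), (perm_b, id), (id, perm_b)} = type_rep 636"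
  proof (rule generate_rel_of[where Y = "[(M0, M0), (R1, R0), (R0, R1)]"])
    show "(636, \<lambda>x y. vmem 4 x = vmem 4 y) \<in> set creps" by (simp add: creps_def)
    fix Q x y assume Q: "closed_rel Q" "\<forall>(x, y)\<in>set [(M0, M0), (R1, R0), (R0, R1)]. Q x y" "vmem 4 x = vmem 4 y"
    then have p: "Q M0 M0" "Q R1 R0" "Q R0 R1" by auto
    note r = rot_mul_refl[OF Q(1) p(1)]
    have rr: "Q u v" if "vmem 4 u" "vmem 4 v" for u v
    proof -
      have "Q u R0" "Q R0 v"
        using that r p by (auto simp: vmem_def)
      then show ?thesis
        using closed_rel.mult[OF Q(1), of u R0 R0 v] by simp
    qed
    show "Q x y"
    proof (cases "vmem 4 x")
      case True
      then show ?thesis using rr Q(3) by simp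
    next
      case False
      moreover have "\<not> vmem 4 M0" by (simp add: vmem_def)
      ultimately have "Q (cmul x M0) (cmul y M0)"
        using Q(3) by (intro rr) (simp_all add: vmem_closed(4))
      then show ?thesis
        using closed_rel.translate[OF Q(1) p(1)] by simp
    qed
  qed (auto simp: vmem_def)
  show "H6 = S3.rep_elt 216" "H7 = S3.rep_elt 632" "H8 = S3.rep_elt 636"
    by (simp_all add: H6_def H7_def H8_def trans_elt_def S3.rep_elt_def 6 7 8)
qed

text \<open>The group acts transitively on itself and the stabilizer of 1 is the diagonal, so the
  unit is \<open>H\<Delta> 5\<close>, of type 616.\<close>

lemma regular_rep: "basis_elt S3 (regular_biset S3) = S3.rep_elt 616"
proof -
  let ?R = "regular_biset S3"
  have "biset_isomorphic S3 ?R (coset_biset S3 (stab S3 ?R \<one>\<^bsub>S3\<^esub>))"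
  proof (rule S3.transitive_biset[OF S3.is_biset_regular])
    show "\<one>\<^bsub>S3\<^esub> \<in> bcarrier ?R" by (simp add: regular_biset_def)
    fix x assume "x \<in> bcarrier ?R"
    then show "\<exists>a\<in>carrier S3. \<exists>b\<in>carrier S3. x = lact ?R a (ract ?R \<one>\<^bsub>S3\<^esub> (inv\<^bsub>S3\<^esub> b))"
      by (intro bexI[of _ x] bexI[of _ "\<one>\<^bsub>S3\<^esub>"]) (simp_all add: regular_biset_def del: sym_group_inv_equality)
  qed
  moreover have "stab S3 ?R \<one>\<^bsub>S3\<^esub> = type_rep 616"
  proof -
    have "stab S3 ?R \<one>\<^bsub>S3\<^esub> = {(x, x) | x. x \<in> carrier S3}"
      by (auto simp: stab_def regular_biset_def)
    also have "\<dots> = type_rep 616"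
      by (auto simp: type_rep_def creps_def rel_of_def elim!: carrier_S3_E simp del: enc.simps)
    finally show ?thesis .
  qed
  ultimately show ?thesis
    unfolding S3.rep_elt_def by (metis basis_elt_eqI S3.is_biset_regular)
qed

section \<open>The coordinates of \<open>\<delta>\<close>\<close>

definition type_count :: "(s3_class \<Rightarrow>\<^sub>0 rat) \<Rightarrow> nat \<Rightarrow> rat" where
  "type_count f i = class_mark S3 (of_bool \<circ> (=) i) f"

lemma type_count_simps [simp]:
  "type_count 0 i = 0"
  "type_count (f + g) i = type_count f i + type_count g i"
  "type_count (f - g) i = type_count f i - type_count g i"
  "type_count (- f) i = - type_count f i"
  "type_count (r *\<^sub>b f) i = r * type_count f i"
  "type_count (\<Sum>j\<in>I. h j) i = (\<Sum>j\<in>I. type_count (h j) i)"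
  by (simp_all add: type_count_def)

lemma type_count_rep: "j \<in> set types \<Longrightarrow> type_count (S3.rep_elt j) i = of_bool (i = j)"
  by (simp add: type_count_def S3.class_mark_rep_elt)

lemma rel_iff_type_count:
  "f \<in> burnside_carrier S3 \<Longrightarrow> f \<in> burnside_rel S3 \<longleftrightarrow> (\<forall>i\<in>set types. type_count f i = 0)"
  by (simp add: S3.rel_iff_class_mark type_count_def)

lemma class_mark_type_count:
  assumes "f \<in> burnside_carrier S3"
  shows "class_mark S3 F f = (\<Sum>j\<in>set types. F j * type_count f j)"
proof -
  have "F i = (\<Sum>j\<in>set types. F j * (of_bool \<circ> (=) j) i)" if "i \<in> set types" for i
  proof -
    have "(\<Sum>j\<in>set types. F j * (of_bool \<circ> (=) j) i) = (\<Sum>j\<in>set types. if j = i then F j else 0)"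
      by (rule sum.cong) auto
    then show ?thesis using that by simp
  qed
  then have "class_mark S3 F f = class_mark S3 (\<lambda>i. \<Sum>j\<in>set types. F j * (of_bool \<circ> (=) j) i) f"
    using assms by (rule S3.class_mark_cong)
  then show ?thesis
    unfolding type_count_def class_mark_lincomb .
qed

text \<open>Turns a table of products into the matrix of left multiplication on type counts: its (k,
  j) entry is the multiplicity of type k in the product with the element of type j.\<close>

lemma type_count_rep_mult:
  assumes g: "g \<in> set types" and f: "f \<in> burnside_carrier S3"
    and act: "\<And>F i. i \<in> set types \<Longrightarrow> mackey_sum S3 F (type_rep g) (type_rep i) / of_nat (card (type_rep g) * card (type_rep i)) =
      (\<Sum>(c, t)\<leftarrow>the (map_of L i). of_nat c * F t)"
    and L: "map fst L = types"
  shows "type_count (bmult S3 (S3.rep_elt g) f) k =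
    (\<Sum>(j, l)\<leftarrow>L. (\<Sum>(c, t)\<leftarrow>l. of_nat c * of_bool (k = t)) * type_count f j)"
proof -
  have "type_count (bmult S3 (S3.rep_elt g) f) k = class_mark S3 (\<lambda>i. \<Sum>(c, t)\<leftarrow>the (map_of L i). of_nat c * (of_bool \<circ> (=) k) t) f"
    unfolding type_count_def S3.rep_elt_def S3.class_mark_coset_mult[OF S3.subgroup_rep[OF g] f]
    by (rule S3.class_mark_cong[OF act f])
  also have "\<dots> = (\<Sum>j\<in>set types. (\<Sum>(c, t)\<leftarrow>the (map_of L j). of_nat c * of_bool (k = t)) * type_count f j)"
    by (simp add: class_mark_type_count[OF f])
  also have "\<dots> = (\<Sum>j\<leftarrow>map fst L. (\<Sum>(c, t)\<leftarrow>the (map_of L j). of_nat c * of_bool (k = t)) * type_count f j)"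
    unfolding L by (rule sum_list_distinct_conv_sum_set[OF distinct_types, symmetric])
  also have "\<dots> = (\<Sum>(j, l)\<leftarrow>L. (\<Sum>(c, t)\<leftarrow>l. of_nat c * of_bool (k = t)) * type_count f j)"
    unfolding map_map using distinct_types
    by (intro arg_cong[of _ _ sum_list] map_cong refl) (auto simp: L)
  finally show ?thesis .
qed

text \<open>
  The coordinates of \<open>\<Sum>\<^sub>i n\<^sub>i \<delta>[S\<^sub>3 \<times> S\<^sub>3 / U\<^sub>i]\<close>, where \<open>U\<^sub>i\<close> is the
  representative of type \<open>i\<close>.
\<close>

definition ecoord :: "(nat \<Rightarrow> 'r::comm_ring_1) \<Rightarrow> nat \<Rightarrow> 'r" where
  "ecoord n = (!) [
    15 * n 112 + 20 * n 113 + 25 * n 116 + 6 * n 222 + 8 * n 223 + 10 * n 226 + 9 * n 332 + 12 * n 333 + 15 * n 336 + 3 * n 662 + 4 * n 663 + 5 * n 666 - 3 * n 212 + 8 * n 313 + n 616 + 7 * n 216 - 3 * n 632 + 3 * n 636,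
    - (5 * n 111) - 60 * n 112 - 55 * n 113 - 85 * n 116 - 2 * n 221 - 24 * n 222 - 22 * n 223 - 34 * n 226 - 3 * n 331 - 36 * n 332 - 33 * n 333 - 51 * n 336 - n 661 - 12 * n 662 - 11 * n 663 - 17 * n 666 + 9 * n 212 - 23 * n 313 - 16 * n 216 + 10 * n 632 - 5 * n 636,
    - (10 * n 112) - 10 * n 113 - 15 * n 116 - 4 * n 222 - 4 * n 223 - 6 * n 226 - 6 * n 332 - 6 * n 333 - 9 * n 336 - 2 * n 662 - 2 * n 663 - 3 * n 666 + 2 * n 212 - 4 * n 313 - 3 * n 216 + 2 * n 632 - n 636,
    - (10 * n 112) - 10 * n 113 - 10 * n 116 - 4 * n 222 - 4 * n 223 - 4 * n 226 - 6 * n 332 - 6 * n 333 - 6 * n 336 - 2 * n 662 - 2 * n 663 - 2 * n 666 + 2 * n 212 - 4 * n 313 - 4 * n 216 + 2 * n 632 - 2 * n 636,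
    - (18 * n 112) - 24 * n 113 - 30 * n 116 - 9 * n 222 - 12 * n 223 - 15 * n 226 - 6 * n 332 - 8 * n 333 - 10 * n 336 - 3 * n 662 - 4 * n 663 - 5 * n 666 - 12 * n 216 - 4 * n 636,
    6 * n 111 + 72 * n 112 + 66 * n 113 + 102 * n 116 + 3 * n 221 + 36 * n 222 + 33 * n 223 + 51 * n 226 + 2 * n 331 + 24 * n 332 + 22 * n 333 + 34 * n 336 + n 661 + 12 * n 662 + 11 * n 663 + 17 * n 666 + 3 * n 212 + 2 * n 313 + n 616 + 33 * n 216 + n 632 + 11 * n 636,
    12 * n 112 + 12 * n 113 + 18 * n 116 + 6 * n 222 + 6 * n 223 + 9 * n 226 + 4 * n 332 + 4 * n 333 + 6 * n 336 + 2 * n 662 + 2 * n 663 + 3 * n 666 + 6 * n 216 + 2 * n 636,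
    12 * n 112 + 12 * n 113 + 12 * n 116 + 6 * n 222 + 6 * n 223 + 6 * n 226 + 4 * n 332 + 4 * n 333 + 4 * n 336 + 2 * n 662 + 2 * n 663 + 2 * n 666 + 6 * n 216 + 2 * n 636,
    126 * n 112 + 168 * n 113 + 210 * n 116 + 60 * n 222 + 80 * n 223 + 100 * n 226 + 48 * n 332 + 64 * n 333 + 80 * n 336 + 21 * n 662 + 28 * n 663 + 35 * n 666 - 6 * n 212 + 12 * n 313 + 78 * n 216 - 6 * n 632 + 26 * n 636,
    - (42 * n 111) - 504 * n 112 - 462 * n 113 - 714 * n 116 - 20 * n 221 - 240 * n 222 - 220 * n 223 - 340 * n 226 - 16 * n 331 - 192 * n 332 - 176 * n 333 - 272 * n 336 - 7 * n 661 - 84 * n 662 - 77 * n 663 - 119 * n 666 + 2 * n 212 - 46 * n 313 - 208 * n 216 + 15 * n 632 - 65 * n 636,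
    - (84 * n 112) - 84 * n 113 - 126 * n 116 - 40 * n 222 - 40 * n 223 - 60 * n 226 - 32 * n 332 - 32 * n 333 - 48 * n 336 - 14 * n 662 - 14 * n 663 - 21 * n 666 + 4 * n 212 - 6 * n 313 + n 616 - 38 * n 216 + 4 * n 632 - 12 * n 636,
    - (84 * n 112) - 84 * n 113 - 84 * n 116 - 40 * n 222 - 40 * n 223 - 40 * n 226 - 32 * n 332 - 32 * n 333 - 32 * n 336 - 14 * n 662 - 14 * n 663 - 14 * n 666 + 4 * n 212 - 6 * n 313 - 40 * n 216 + 4 * n 632 - 14 * n 636,
    n 212 + n 616 + n 216 + n 632 + n 636,
    - (2 * n 216) - 2 * n 636,
    2 * n 313 + n 616,
    - (756 * n 112) - 1008 * n 113 - 1260 * n 116 - 360 * n 222 - 480 * n 223 - 600 * n 226 - 288 * n 332 - 384 * n 333 - 480 * n 336 - 108 * n 662 - 144 * n 663 - 180 * n 666 + 36 * n 212 - 72 * n 313 - 468 * n 216 + 72 * n 632 - 120 * n 636,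
    252 * n 111 + 3024 * n 112 + 2772 * n 113 + 4284 * n 116 + 120 * n 221 + 1440 * n 222 + 1320 * n 223 + 2040 * n 226 + 96 * n 331 + 1152 * n 332 + 1056 * n 333 + 1632 * n 336 + 36 * n 661 + 432 * n 662 + 396 * n 663 + 612 * n 666 - 12 * n 212 + 276 * n 313 + 1248 * n 216 - 228 * n 632 + 252 * n 636,
    504 * n 112 + 504 * n 113 + 756 * n 116 + 240 * n 222 + 240 * n 223 + 360 * n 226 + 192 * n 332 + 192 * n 333 + 288 * n 336 + 72 * n 662 + 72 * n 663 + 108 * n 666 - 24 * n 212 + 36 * n 313 + 228 * n 216 - 48 * n 632 + 48 * n 636,
    - (2 * n 632) - 2 * n 636,
    n 616,
    504 * n 112 + 504 * n 113 + 504 * n 116 + 240 * n 222 + 240 * n 223 + 240 * n 226 + 192 * n 332 + 192 * n 333 + 192 * n 336 + 72 * n 662 + 72 * n 663 + 72 * n 666 - 24 * n 212 + 36 * n 313 + 240 * n 216 - 48 * n 632 + 24 * n 636,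
    4 * n 636]"

lemmas ecoord_nth = nth_coords[OF ecoord_def]

text \<open>The rational linear extension of \<open>\<delta>\<close> to the free module, established
  in \<open>\<delta>_proj\<close>; it allows calculations without cosets.\<close>

definition emat :: "(s3_class \<Rightarrow>\<^sub>0 rat) \<Rightarrow> qex mat" where
  "emat f = amat (ecoord (type_count f))"

lemma types_action_313: "map fst action_313 = types"
  by (simp add: action_313_def types_def creps_def)

lemma type_count_mult_313:
  assumes "f \<in> burnside_carrier S3"
  shows "type_count (bmult S3 (S3.rep_elt 313) f) k =
    (\<Sum>(j, l)\<leftarrow>action_313. (\<Sum>(c, t)\<leftarrow>l. of_nat c * of_bool (k = t)) * type_count f j)"
  by (rule type_count_rep_mult[OF _ assms mackey_sum_313 types_action_313]) (simp_all add: set_types)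

text \<open>Both sides are linear in the type counts of f, so the claim amounts to 22 identities
  between linear forms.\<close>

lemma emat_mult_313:
  assumes "f \<in> burnside_carrier S3"
  shows "emat (bmult S3 (S3.rep_elt 313) f) = A_mult (emat (S3.rep_elt 313)) (emat f)"
proof -
  \<comment> \<open>The coefficients of \<open>n 313\<close> in the 22 entries of
    \<open>ecoord\<close>.\<close>
  define v :: "nat \<Rightarrow> rat" where "v = (!) [8, - 23, - 4, - 4, 0, 2, 0, 0, 12, - 46, - 6, - 6, 0, 0, 2, - 72, 276, 36, 0, 0, 36, 0]"
  have e: "amat (ecoord (type_count (S3.rep_elt 313))) = amat v"
    unfolding amat_eq_iff v_def by (auto dest!: lt_22_cases simp: ecoord_def type_count_rep set_types)
  note m = type_count_mult_313[OF assms, unfolded action_313_def, simplified]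
  show ?thesis
    unfolding emat_def e A_mult_amat amat_eq_iff
  proof (intro allI impI)
    fix k :: nat assume "k < 22"
    from lt_22_cases[OF this]
    show "ecoord (type_count (bmult S3 (S3.rep_elt 313) f)) k = amul v (ecoord (type_count f)) k"
      by (elim insertE emptyE; simp only: amul_nth ecoord_nth nth_coords[OF v_def] m; simp; linarith?)
  qed
qed

lemma types_action_216: "map fst action_216 = types"
  by (simp add: action_216_def types_def creps_def)

lemma type_count_mult_216:
  assumes "f \<in> burnside_carrier S3"
  shows "type_count (bmult S3 (S3.rep_elt 216) f) k =
    (\<Sum>(j, l)\<leftarrow>action_216. (\<Sum>(c, t)\<leftarrow>l. of_nat c * of_bool (k = t)) * type_count f j)"
  by (rule type_count_rep_mult[OF _ assms mackey_sum_216 types_action_216]) (simp_all add: set_types)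

lemma emat_mult_216:
  assumes "f \<in> burnside_carrier S3"
  shows "emat (bmult S3 (S3.rep_elt 216) f) = A_mult (emat (S3.rep_elt 216)) (emat f)"
proof -
  define v :: "nat \<Rightarrow> rat" where "v = (!) [7, - 16, - 3, - 4, - 12, 33, 6, 6, 78, - 208, - 38, - 40, 1, - 2, 0, - 468, 1248, 228, 0, 0, 240, 0]"
  have e: "amat (ecoord (type_count (S3.rep_elt 216))) = amat v"
    unfolding amat_eq_iff v_def by (auto dest!: lt_22_cases simp: ecoord_def type_count_rep set_types)
  note m = type_count_mult_216[OF assms, unfolded action_216_def, simplified]
  show ?thesis
    unfolding emat_def e A_mult_amat amat_eq_iff
  proof (intro allI impI)
    fix k :: nat assume "k < 22"
    from lt_22_cases[OF this]
    show "ecoord (type_count (bmult S3 (S3.rep_elt 216) f)) k = amul v (ecoord (type_count f)) k"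
      by (elim insertE emptyE; simp only: amul_nth ecoord_nth nth_coords[OF v_def] m; simp; linarith?)
  qed
qed

lemma types_action_632: "map fst action_632 = types"
  by (simp add: action_632_def types_def creps_def)

lemma type_count_mult_632:
  assumes "f \<in> burnside_carrier S3"
  shows "type_count (bmult S3 (S3.rep_elt 632) f) k =
    (\<Sum>(j, l)\<leftarrow>action_632. (\<Sum>(c, t)\<leftarrow>l. of_nat c * of_bool (k = t)) * type_count f j)"
  by (rule type_count_rep_mult[OF _ assms mackey_sum_632 types_action_632]) (simp_all add: set_types)

lemma emat_mult_632:
  assumes "f \<in> burnside_carrier S3"
  shows "emat (bmult S3 (S3.rep_elt 632) f) = A_mult (emat (S3.rep_elt 632)) (emat f)"
proof -
  define v :: "nat \<Rightarrow> rat" where "v = (!) [- 3, 10, 2, 2, 0, 1, 0, 0, - 6, 15, 4, 4, 1, 0, 0, 72, - 228, - 48, - 2, 0, - 48, 0]"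
  have e: "amat (ecoord (type_count (S3.rep_elt 632))) = amat v"
    unfolding amat_eq_iff v_def by (auto dest!: lt_22_cases simp: ecoord_def type_count_rep set_types)
  note m = type_count_mult_632[OF assms, unfolded action_632_def, simplified]
  show ?thesis
    unfolding emat_def e A_mult_amat amat_eq_iff
  proof (intro allI impI)
    fix k :: nat assume "k < 22"
    from lt_22_cases[OF this]
    show "ecoord (type_count (bmult S3 (S3.rep_elt 632) f)) k = amul v (ecoord (type_count f)) k"
      by (elim insertE emptyE; simp only: amul_nth ecoord_nth nth_coords[OF v_def] m; simp; linarith?)
  qed
qed

lemma types_action_666: "map fst action_666 = types"
  by (simp add: action_666_def types_def creps_def)

lemma type_count_mult_666:
  assumes "f \<in> burnside_carrier S3"
  shows "type_count (bmult S3 (S3.rep_elt 666) f) k =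
    (\<Sum>(j, l)\<leftarrow>action_666. (\<Sum>(c, t)\<leftarrow>l. of_nat c * of_bool (k = t)) * type_count f j)"
  by (rule type_count_rep_mult[OF _ assms mackey_sum_666 types_action_666]) (simp_all add: set_types)

lemma emat_mult_666:
  assumes "f \<in> burnside_carrier S3"
  shows "emat (bmult S3 (S3.rep_elt 666) f) = A_mult (emat (S3.rep_elt 666)) (emat f)"
proof -
  define v :: "nat \<Rightarrow> rat" where "v = (!) [5, - 17, - 3, - 2, - 5, 17, 3, 2, 35, - 119, - 21, - 14, 0, 0, 0, - 180, 612, 108, 0, 0, 72, 0]"
  have e: "amat (ecoord (type_count (S3.rep_elt 666))) = amat v"
    unfolding amat_eq_iff v_def by (auto dest!: lt_22_cases simp: ecoord_def type_count_rep set_types)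
  note m = type_count_mult_666[OF assms, unfolded action_666_def, simplified]
  show ?thesis
    unfolding emat_def e A_mult_amat amat_eq_iff
  proof (intro allI impI)
    fix k :: nat assume "k < 22"
    from lt_22_cases[OF this]
    show "ecoord (type_count (bmult S3 (S3.rep_elt 666) f)) k = amul v (ecoord (type_count f)) k"
      by (elim insertE emptyE; simp only: amul_nth ecoord_nth nth_coords[OF v_def] m; simp; linarith?)
  qed
qed

section \<open>Multiplicativity, reduced to generators\<close>

lemma emat_cong:
  assumes "\<And>i. i \<in> set types \<Longrightarrow> type_count f i = type_count g i"
  shows "emat f = emat g"
  by (auto simp: emat_def amat_eq_iff ecoord_def assms set_types)

lemma emat_rel_cong:
  assumes "f - g \<in> burnside_rel S3"
  shows "emat f = emat g"
proof (rule emat_cong)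
  fix i
  have "type_count (f - g) i = 0"
    unfolding type_count_def by (rule class_mark_rel[OF assms])
  then show "type_count f i = type_count g i" by simp
qed

lemma emat_add: "emat (f + g) = emat f + emat g"
  unfolding emat_def amat_add amat_eq_iff
  by (intro allI impI, drule lt_22_cases, elim insertE emptyE; simp only: ecoord_nth; simp add: algebra_simps)

lemma ecoord_scale:
  fixes n :: "nat \<Rightarrow> rat"
  assumes "k < 22"
  shows "ecoord (\<lambda>i. r * n i) k = r * ecoord n k"
  using lt_22_cases[OF assms] by (elim insertE emptyE; simp only: ecoord_nth; simp add: algebra_simps)

lemma amul_scale:
  assumes "k < 22"
  shows "amul (\<lambda>i. r * v i) w k = r * amul v w k"
  using lt_22_cases[OF assms] by (elim insertE emptyE; simp only: amul_nth; simp add: algebra_simps)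

text \<open>
  The set of elements on which \<^const>\<open>emat\<close> is multiplicative from the left is a subalgebra,
  so it is enough that it contains generators.
\<close>

definition left_mult :: "(s3_class \<Rightarrow>\<^sub>0 rat) \<Rightarrow> bool" where
  "left_mult x \<longleftrightarrow> x \<in> burnside_carrier S3 \<and> (\<forall>f\<in>burnside_carrier S3. emat (bmult S3 x f) = A_mult (emat x) (emat f))"

text \<open>The relations form an ideal on which \<open>emat\<close> vanishes, so neither side
  changes modulo relations.\<close>

lemma left_mult_rel_cong:
  assumes x: "left_mult x" and y: "y \<in> burnside_carrier S3" and xy: "x - y \<in> burnside_rel S3"
  shows "left_mult y"
proof -
  have "emat (bmult S3 y f) = emat (bmult S3 x f)" if "f \<in> burnside_carrier S3" for f
    using S3.bmult_rel(2)[OF xy that] by (intro emat_rel_cong[symmetric]) (simp add: bmult_diff_left)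
  then show ?thesis
    using x y emat_rel_cong[OF xy] by (simp add: left_mult_def)
qed

lemma emat_carrier: "emat f \<in> carrier A"
  by (simp add: emat_def)

lemma left_mult_mult:
  assumes x: "left_mult x" and y: "left_mult y"
  shows "left_mult (bmult S3 x y)"
proof -
  have "A_mult (A_mult (emat x) (emat y)) (emat f) = A_mult (emat x) (A_mult (emat y) (emat f))" for f
    using A.m_assoc[OF emat_carrier emat_carrier emat_carrier, of x y f] by (simp add: A_simps)
  then show ?thesis
    using x y by (simp add: left_mult_def S3.bmult_assoc)
qed

lemma left_mult_add:
  assumes "left_mult x" "left_mult y"
  shows "left_mult (x + y)"
  using assms A.l_distr[OF emat_carrier emat_carrier emat_carrier]
  by (auto simp: left_mult_def bmult_add_left emat_add A_simps)

lemma left_mult_scale: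
  assumes "left_mult x"
  shows "left_mult (r *\<^sub>b x)"
proof -
  have e: "emat (r *\<^sub>b f) = amat (\<lambda>k. r * ecoord (type_count f) k)" for f
  proof -
    have "type_count (r *\<^sub>b f) = (\<lambda>i. r * type_count f i)" by (rule ext) simp
    then show ?thesis
      by (simp add: emat_def amat_eq_iff ecoord_scale)
  qed
  have "emat (bmult S3 (r *\<^sub>b x) f) = A_mult (emat (r *\<^sub>b x)) (emat f)" if "f \<in> burnside_carrier S3" for f
  proof -
    have "emat (bmult S3 x f) = A_mult (emat x) (emat f)"
      using assms that by (simp add: left_mult_def)
    then show ?thesis
      by (simp add: bmult_scale_left e) (simp add: emat_def A_mult_amat amat_eq_iff amul_scale)
  qed
  then show ?thesis
    using assms by (simp add: left_mult_def)
qed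

lemma left_mult_sum: "(\<And>i. i \<in> I \<Longrightarrow> left_mult (f i)) \<Longrightarrow> left_mult (\<Sum>i\<in>I. f i)"
proof (induction I rule: infinite_finite_induct)
  case (insert i I)
  then show ?case by (auto intro: left_mult_add)
next
  case empty
  show ?case
    using left_mult_scale[of "S3.rep_elt 313" 0] emat_mult_313 by (simp add: left_mult_def set_types S3.rep_elt_carrier)
next
  case (infinite I)
  then show ?case
    using left_mult_scale[of "S3.rep_elt 313" 0] emat_mult_313 by (simp add: left_mult_def set_types S3.rep_elt_carrier)
qed

lemma emat_one: "emat (S3.rep_elt 616) = \<one>\<^bsub>A\<^esub>"
  by (auto dest!: lt_22_cases simp: emat_def A_simps one_amat amat_eq_iff ecoord_def one_coord_def type_count_rep set_types)

lemma left_mult_reps: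
  assumes "i \<in> set types"
  shows "left_mult (S3.rep_elt i)"
proof -
  have c: "S3.rep_elt t \<in> burnside_carrier S3" if "t \<in> set types" for t
    using that by (rule S3.rep_elt_carrier)
  have g: "left_mult (S3.rep_elt 313)" "left_mult (S3.rep_elt 216)" "left_mult (S3.rep_elt 632)" "left_mult (S3.rep_elt 666)"
    using emat_mult_313 emat_mult_216 emat_mult_632 emat_mult_666 by (simp_all add: left_mult_def c set_types)
  \<comment> \<open>If a product of two elements already covered has the type counts of a single
    basis element, it agrees with that element modulo relations.\<close>
  have step: "left_mult (S3.rep_elt t)"
    if "left_mult (S3.rep_elt g)" "left_mult (S3.rep_elt j)" "t \<in> set types"
      "\<And>i. i \<in> set types \<Longrightarrow> type_count (bmult S3 (S3.rep_elt g) (S3.rep_elt j)) i = of_bool (i = t)" for g j t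
  proof (rule left_mult_rel_cong[OF left_mult_mult[OF that(1,2)] c[OF that(3)]])
    have "bmult S3 (S3.rep_elt g) (S3.rep_elt j) - S3.rep_elt t \<in> (burnside_carrier S3 :: (s3_class \<Rightarrow>\<^sub>0 rat) set)"
      using that(1,2) c[OF that(3)]
      by (intro burnside_carrier_closed(5) S3.bmult_closed) (simp_all add: left_mult_def)
    then show "bmult S3 (S3.rep_elt g) (S3.rep_elt j) - S3.rep_elt t \<in> (burnside_rel S3 :: (s3_class \<Rightarrow>\<^sub>0 rat) set)"
      using that(3,4) by (simp add: rel_iff_type_count type_count_rep)
  qed
  note action_defs = action_313_def action_216_def action_632_def action_666_def
  note tc = type_count_mult_313[OF c] type_count_mult_216[OF c] type_count_mult_632[OF c] type_count_mult_666[OF c]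
  have one: "left_mult (S3.rep_elt 616)"
  proof -
    have "bmult S3 (S3.rep_elt 616) f = f" if "f \<in> burnside_carrier S3" for f :: "s3_class \<Rightarrow>\<^sub>0 rat"
      using S3.bmult_one(1)[OF that] by (simp add: regular_rep)
    then show ?thesis
      using emat_one A.l_one[OF emat_carrier] c[of 616]
      by (simp add: left_mult_def A_simps set_types S3.rep_elt_carrier)
  qed
  have t212: "left_mult (S3.rep_elt 212)"
    by (rule step[OF g(2) g(3)]; force simp: tc set_types type_count_rep action_defs)
  have t331: "left_mult (S3.rep_elt 331)"
    by (rule step[OF g(3) g(1)]; force simp: tc set_types type_count_rep action_defs)
  have t111: "left_mult (S3.rep_elt 111)"
    by (rule step[OF g(2) t331]; force simp: tc set_types type_count_rep action_defs)
  have t662: "left_mult (S3.rep_elt 662)"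
    by (rule step[OF g(4) t212]; force simp: tc set_types type_count_rep action_defs)
  have t663: "left_mult (S3.rep_elt 663)"
    by (rule step[OF g(4) g(1)]; force simp: tc set_types type_count_rep action_defs)
  have t661: "left_mult (S3.rep_elt 661)"
    by (rule step[OF g(4) t111]; force simp: tc set_types type_count_rep action_defs)
  have t221: "left_mult (S3.rep_elt 221)"
    by (rule step[OF g(2) t661]; force simp: tc set_types type_count_rep action_defs)
  have t222: "left_mult (S3.rep_elt 222)"
    by (rule step[OF g(2) t662]; force simp: tc set_types type_count_rep action_defs)
  have t223: "left_mult (S3.rep_elt 223)"
    by (rule step[OF g(2) t663]; force simp: tc set_types type_count_rep action_defs)
  have t226: "left_mult (S3.rep_elt 226)"
    by (rule step[OF g(2) g(4)]; force simp: tc set_types type_count_rep action_defs)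
  have t331: "left_mult (S3.rep_elt 331)"
    by (rule step[OF g(1) t661]; force simp: tc set_types type_count_rep action_defs)
  have t332: "left_mult (S3.rep_elt 332)"
    by (rule step[OF g(1) t662]; force simp: tc set_types type_count_rep action_defs)
  have t333: "left_mult (S3.rep_elt 333)"
    by (rule step[OF g(1) t663]; force simp: tc set_types type_count_rep action_defs)
  have t336: "left_mult (S3.rep_elt 336)"
    by (rule step[OF g(1) g(4)]; force simp: tc set_types type_count_rep action_defs)
  have t112: "left_mult (S3.rep_elt 112)"
    by (rule step[OF g(1) t222]; force simp: tc set_types type_count_rep action_defs)
  have t113: "left_mult (S3.rep_elt 113)"
    by (rule step[OF g(1) t223]; force simp: tc set_types type_count_rep action_defs)
  have t116: "left_mult (S3.rep_elt 116)"
    by (rule step[OF g(1) t226]; force simp: tc set_types type_count_rep action_defs)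
  have t636: "left_mult (S3.rep_elt 636)"
  proof (rule left_mult_rel_cong)
    \<comment> \<open>The product \<open>H7\<close> times \<open>H6\<close> is \<open>H8\<close>
      plus \<open>H 4 4\<close>, as the entry 216 of \<open>action_632\<close> shows; the second
      summand is subtracted.\<close>
    let ?x = "bmult S3 (S3.rep_elt 632) (S3.rep_elt 216) + (- 1) *\<^sub>b S3.rep_elt 333 :: s3_class \<Rightarrow>\<^sub>0 rat"
    show x: "left_mult ?x"
      by (intro left_mult_add left_mult_mult left_mult_scale g t333)
    show "S3.rep_elt 636 \<in> (burnside_carrier S3 :: (s3_class \<Rightarrow>\<^sub>0 rat) set)" by (simp add: c set_types)
    then have "?x - S3.rep_elt 636 \<in> burnside_carrier S3"
      using x by (simp add: left_mult_def)
    then show "?x - S3.rep_elt 636 \<in> burnside_rel S3"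
      by (simp add: rel_iff_type_count set_types tc type_count_rep action_defs del: pm.scale_minus_left)
  qed
  show ?thesis
    using types_cases[OF assms] g one t212 t331 t111 t662 t663 t661 t221 t222 t223 t226 t332 t333 t336 t112 t113 t116 t636
    by (elim disjE) simp_all
qed

lemma emat_bmult:
  assumes f: "f \<in> burnside_carrier S3" and g: "g \<in> burnside_carrier S3"
  shows "emat (bmult S3 f g) = A_mult (emat f) (emat g)"
proof -
  obtain c where c: "f - (\<Sum>i\<in>set types. c i *\<^sub>b S3.rep_elt i) \<in> burnside_rel S3"
    using S3.span_carrier[OF f] by blast
  have "left_mult (\<Sum>i\<in>set types. c i *\<^sub>b S3.rep_elt i)"
    by (intro left_mult_sum left_mult_scale left_mult_reps)
  then have "left_mult f"
    by (rule left_mult_rel_cong[OF _ f]) (use burnside_rel_closed(3)[OF c] in simp)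
  then show ?thesis
    using g by (simp add: left_mult_def)
qed

section \<open>The map gamma and its inverse in coordinates\<close>

definition gamma_elt :: "(nat \<Rightarrow> rat) \<Rightarrow> s3_class \<Rightarrow>\<^sub>0 rat" where
  "gamma_elt d = d 0 *\<^sub>b T l\<^sub>e f\<^sub>e + d 1 *\<^sub>b T l\<^sub>e f\<^sub>g + d 2 *\<^sub>b T l\<^sub>e f\<^sub>h + d 3 *\<^sub>b T l\<^sub>e f\<^sub>4 + d 4 *\<^sub>b T l\<^sub>g f\<^sub>e + d 5 *\<^sub>b T l\<^sub>g f\<^sub>g + d 6 *\<^sub>b T l\<^sub>g f\<^sub>h + d 7 *\<^sub>b T l\<^sub>g f\<^sub>4 + d 8 *\<^sub>b T l\<^sub>h f\<^sub>e + d 9 *\<^sub>b T l\<^sub>h f\<^sub>g + d 10 *\<^sub>b T l\<^sub>h f\<^sub>h + d 11 *\<^sub>b T l\<^sub>h f\<^sub>4 + d 12 *\<^sub>b \<epsilon>\<^sub>2 + d 13 *\<^sub>b b_\<epsilon>2_\<epsilon>4 + d 14 *\<^sub>b \<epsilon>\<^sub>3 + d 15 *\<^sub>b T l\<^sub>4 f\<^sub>e + d 16 *\<^sub>b T l\<^sub>4 f\<^sub>g + d 17 *\<^sub>b T l\<^sub>4 f\<^sub>h + d 18 *\<^sub>b b_\<epsilon>4_\<epsilon>2 + d 19 *\<^sub>b \<epsilon>\<^sub>4 + d 20 *\<^sub>b T l\<^sub>4 f\<^sub>4 + d 21 *\<^sub>b b''_\<epsilon>4_\<epsilon>4"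

lemma \<gamma>_eq: "\<gamma> X = burnside_proj S3 (gamma_elt (coord X))"
  by (simp add: \<gamma>_def gamma_elt_def coord_def Let_def algebra_simps)

lemma H_carrier:
  assumes "i \<in> {0, 1, 4, 5}" "j \<in> {0, 1, 4, 5}"
  shows "H i j \<in> burnside_carrier S3"
  using assms by (elim insertE emptyE) (simp_all only: basis_reps, simp_all add: S3.rep_elt_carrier set_types)

lemma gamma_elt_carrier: "gamma_elt d \<in> burnside_carrier S3"
proof -
  have D: "H\<Delta> 1 \<in> burnside_carrier S3" "H\<Delta> 4 \<in> burnside_carrier S3" "H\<Delta> 5 \<in> burnside_carrier S3"
    "H6 \<in> burnside_carrier S3" "H7 \<in> burnside_carrier S3" "H8 \<in> burnside_carrier S3"
    by (simp_all only: basis_reps, simp_all add: S3.rep_elt_carrier set_types)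
  have T: "T x y \<in> burnside_carrier S3" for x y
    unfolding T_def by (intro burnside_carrier_sum burnside_carrier_closed H_carrier)
  show ?thesis
    unfolding gamma_elt_def \<epsilon>\<^sub>2_def \<epsilon>\<^sub>3_def \<epsilon>\<^sub>4_def b_\<epsilon>2_\<epsilon>4_def b_\<epsilon>4_\<epsilon>2_def b''_\<epsilon>4_\<epsilon>4_def
    by (intro burnside_carrier_closed T D H_carrier; simp)
qed

lemma type_count_T:
  "type_count (T x y) 111 = x 0 * y 0"
  "type_count (T x y) 112 = x 0 * y 1"
  "type_count (T x y) 113 = x 0 * y 4"
  "type_count (T x y) 116 = x 0 * y 5"
  "type_count (T x y) 221 = x 1 * y 0"
  "type_count (T x y) 222 = x 1 * y 1"
  "type_count (T x y) 223 = x 1 * y 4"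
  "type_count (T x y) 226 = x 1 * y 5"
  "type_count (T x y) 331 = x 4 * y 0"
  "type_count (T x y) 332 = x 4 * y 1"
  "type_count (T x y) 333 = x 4 * y 4"
  "type_count (T x y) 336 = x 4 * y 5"
  "type_count (T x y) 661 = x 5 * y 0"
  "type_count (T x y) 662 = x 5 * y 1"
  "type_count (T x y) 663 = x 5 * y 4"
  "type_count (T x y) 666 = x 5 * y 5"
  "type_count (T x y) 212 = 0"
  "type_count (T x y) 313 = 0"
  "type_count (T x y) 616 = 0"
  "type_count (T x y) 216 = 0"
  "type_count (T x y) 632 = 0"
  "type_count (T x y) 636 = 0"
  by (simp_all add: T_def basis_reps[simplified] type_count_rep set_types)

lemma quad_simps:
  "quad p q r s 0 = p" "quad p q r s 1 = q" "quad p q r s 4 = r" "quad p q r s 5 = s"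
  by (simp_all add: quad_def)

lemma type_count_gamma_elt:
  "type_count (gamma_elt d) 111 = - (1 / 2 * d 0) + 1 / 2 * d 1 - 1 / 8 * d 2 - 1 / 8 * d 3 - 4 / 3 * d 4 + 4 / 3 * d 5 - 1 / 3 * d 6 - 1 / 3 * d 7 - 1 / 3 * d 8 + 1 / 3 * d 9 - 1 / 12 * d 10 - 1 / 12 * d 11 - d 12 - 1 / 2 * d 13 - 1 / 4 * d 14 + 1 / 6 * d 15 - 1 / 6 * d 16 + 1 / 24 * d 17 - 1 / 2 * d 18 + 1 / 2 * d 19 + 1 / 24 * d 20 + 1 / 4 * d 21"
  "type_count (gamma_elt d) 112 = - (1 / 2 * d 1) + 1 / 2 * d 2 + 1 / 4 * d 3 - 4 / 3 * d 5 + 4 / 3 * d 6 + 2 / 3 * d 7 - 1 / 3 * d 9 + 1 / 3 * d 10 + 1 / 6 * d 11 + d 12 + 1 / 2 * d 13 + 1 / 6 * d 16 - 1 / 6 * d 17 + 1 / 2 * d 18 - 1 / 12 * d 20 - 3 / 4 * d 21"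
  "type_count (gamma_elt d) 113 = - (3 / 8 * d 2) + 1 / 8 * d 3 - d 6 + 1 / 3 * d 7 - 1 / 4 * d 10 + 1 / 12 * d 11 + 1 / 2 * d 13 + 1 / 4 * d 14 + 1 / 8 * d 17 - 1 / 24 * d 20 - 1 / 4 * d 21"
  "type_count (gamma_elt d) 116 = - (1 / 4 * d 3) - 2 / 3 * d 7 - 1 / 6 * d 11 - 1 / 2 * d 13 + 1 / 12 * d 20 + 3 / 4 * d 21"
  "type_count (gamma_elt d) 221 = d 0 - d 1 + 1 / 4 * d 2 + 1 / 4 * d 3 + 2 * d 4 - 2 * d 5 + 1 / 2 * d 6 + 1 / 2 * d 7 + d 12 + 1 / 2 * d 13 - 1 / 3 * d 15 + 1 / 3 * d 16 - 1 / 12 * d 17 + 1 / 2 * d 18 - 1 / 12 * d 20 - 3 / 4 * d 21"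
  "type_count (gamma_elt d) 222 = d 1 - d 2 - 1 / 2 * d 3 + 2 * d 5 - 2 * d 6 - d 7 - 2 * d 12 - d 13 - 1 / 3 * d 16 + 1 / 3 * d 17 - d 18 + 1 / 6 * d 20 + 3 / 2 * d 21"
  "type_count (gamma_elt d) 223 = 3 / 4 * d 2 - 1 / 4 * d 3 + 3 / 2 * d 6 - 1 / 2 * d 7 - 1 / 2 * d 13 - 1 / 4 * d 17 + 1 / 12 * d 20 + 3 / 4 * d 21"
  "type_count (gamma_elt d) 226 = 1 / 2 * d 3 + d 7 + d 13 - 1 / 6 * d 20 - 3 / 2 * d 21"
  "type_count (gamma_elt d) 331 = 1 / 2 * d 0 - 1 / 2 * d 1 + 1 / 8 * d 2 + 1 / 8 * d 3 + d 4 - d 5 + 1 / 4 * d 6 + 1 / 4 * d 7 + d 8 - d 9 + 1 / 4 * d 10 + 1 / 4 * d 11 + 1 / 4 * d 14 - 1 / 6 * d 15 + 1 / 6 * d 16 - 1 / 24 * d 17 + 1 / 2 * d 18 - 1 / 24 * d 20 - 1 / 4 * d 21"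
  "type_count (gamma_elt d) 332 = 1 / 2 * d 1 - 1 / 2 * d 2 - 1 / 4 * d 3 + d 5 - d 6 - 1 / 2 * d 7 + d 9 - d 10 - 1 / 2 * d 11 - 1 / 6 * d 16 + 1 / 6 * d 17 - 1 / 2 * d 18 + 1 / 12 * d 20 + 3 / 4 * d 21"
  "type_count (gamma_elt d) 333 = 3 / 8 * d 2 - 1 / 8 * d 3 + 3 / 4 * d 6 - 1 / 4 * d 7 + 3 / 4 * d 10 - 1 / 4 * d 11 - 3 / 4 * d 14 - 1 / 8 * d 17 + 1 / 24 * d 20 + 1 / 4 * d 21"
  "type_count (gamma_elt d) 336 = 1 / 4 * d 3 + 1 / 2 * d 7 + 1 / 2 * d 11 - 1 / 12 * d 20 - 3 / 4 * d 21"
  "type_count (gamma_elt d) 661 = 1 / 3 * d 15 - 1 / 3 * d 16 + 1 / 12 * d 17 - 1 / 2 * d 18 + 1 / 12 * d 20 + 3 / 4 * d 21"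
  "type_count (gamma_elt d) 662 = 1 / 3 * d 16 - 1 / 3 * d 17 + d 18 - 1 / 6 * d 20 - 3 / 2 * d 21"
  "type_count (gamma_elt d) 663 = 1 / 4 * d 17 - 1 / 12 * d 20 - 3 / 4 * d 21"
  "type_count (gamma_elt d) 666 = 1 / 6 * d 20 + 3 / 2 * d 21"
  "type_count (gamma_elt d) 212 = d 12 + 1 / 2 * d 13 + 1 / 2 * d 18 - d 19 + 1 / 4 * d 21"
  "type_count (gamma_elt d) 313 = 1 / 2 * d 14 - 1 / 2 * d 19"
  "type_count (gamma_elt d) 616 = d 19"
  "type_count (gamma_elt d) 216 = - (1 / 2 * d 13) - 1 / 4 * d 21"
  "type_count (gamma_elt d) 632 = - (1 / 2 * d 18) - 1 / 4 * d 21"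
  "type_count (gamma_elt d) 636 = 1 / 4 * d 21"
  by (simp_all only: gamma_elt_def type_count_simps type_count_T l\<^sub>e_def l\<^sub>g_def l\<^sub>h_def l\<^sub>4_def
      f\<^sub>e_def f\<^sub>g_def f\<^sub>h_def f\<^sub>4_def quad_simps \<epsilon>\<^sub>2_def \<epsilon>\<^sub>3_def \<epsilon>\<^sub>4_def b_\<epsilon>2_\<epsilon>4_def b_\<epsilon>4_\<epsilon>2_def
      b''_\<epsilon>4_\<epsilon>4_def basis_reps)
    (simp_all add: type_count_rep set_types field_simps)

text \<open>The inverse of the \<open>22 \<times> 22\<close> matrix in \<open>type_count_gamma_elt\<close>.\<close>

definition dcoord :: "(nat \<Rightarrow> rat) \<Rightarrow> nat \<Rightarrow> rat" where
  "dcoord n = (!) [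
    6 * n 111 + 6 * n 112 + 6 * n 113 + 6 * n 116 + 3 * n 221 + 3 * n 222 + 3 * n 223 + 3 * n 226 + 2 * n 331 + 2 * n 332 + 2 * n 333 + 2 * n 336 + n 661 + n 662 + n 663 + n 666 + 3 * n 212 + 2 * n 313 + n 616 + 3 * n 216 + n 632 + n 636,
    6 * n 112 + 8 * n 113 + 10 * n 116 + 3 * n 222 + 4 * n 223 + 5 * n 226 + 2 * n 332 + 8 / 3 * n 333 + 10 / 3 * n 336 + n 662 + 4 / 3 * n 663 + 5 / 3 * n 666 + 4 * n 216 + 4 / 3 * n 636,
    8 * n 113 + 4 * n 116 + 4 * n 223 + 2 * n 226 + 8 / 3 * n 333 + 4 / 3 * n 336 + 4 / 3 * n 663 + 2 / 3 * n 666 + 4 * n 216 + 4 / 3 * n 636,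
    12 * n 116 + 6 * n 226 + 4 * n 336 + 2 * n 666,
    - (3 * n 111) - 3 * n 112 - 3 * n 113 - 3 * n 116 - n 221 - n 222 - n 223 - n 226 - n 331 - n 332 - n 333 - n 336 - n 212 - n 313 - n 216,
    - (3 * n 112) - 4 * n 113 - 5 * n 116 - n 222 - 4 / 3 * n 223 - 5 / 3 * n 226 - n 332 - 4 / 3 * n 333 - 5 / 3 * n 336 + n 212 + n 616 - n 216 + n 632 + 1 / 3 * n 636,
    - (4 * n 113) - 2 * n 116 - 4 / 3 * n 223 - 2 / 3 * n 226 - 4 / 3 * n 333 - 2 / 3 * n 336 - 2 * n 216 - 2 / 3 * n 636,
    - (6 * n 116) - 2 * n 226 - 2 * n 336 + 2 * n 216 + 2 * n 636,
    - (1 / 2 * n 221) - 1 / 2 * n 222 - 1 / 2 * n 223 - 1 / 2 * n 226 + n 331 + n 332 + n 333 + n 336 - 1 / 2 * n 212 + n 313 - 1 / 2 * n 216,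
    - (1 / 2 * n 222) - 2 / 3 * n 223 - 5 / 6 * n 226 + n 332 + 4 / 3 * n 333 + 5 / 3 * n 336 - n 212 + 2 * n 313 - n 216 - n 632 - 1 / 3 * n 636,
    - (2 / 3 * n 223) - 1 / 3 * n 226 + 4 / 3 * n 333 + 2 / 3 * n 336 + 2 * n 313 + n 616 + 2 / 3 * n 636,
    - n 226 + 2 * n 336 - 2 * n 216 - 2 * n 636,
    n 212 + n 616 + n 216 + n 632 + n 636,
    - (2 * n 216) - 2 * n 636,
    2 * n 313 + n 616,
    3 * n 661 + 3 * n 662 + 3 * n 663 + 3 * n 666 + 3 * n 632 + 3 * n 636,
    3 * n 662 + 4 * n 663 + 5 * n 666 + 6 * n 632 + 6 * n 636,
    4 * n 663 + 2 * n 666,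
    - (2 * n 632) - 2 * n 636,
    n 616,
    6 * n 666 - 36 * n 636,
    4 * n 636]"

lemmas dcoord_nth = nth_coords[OF dcoord_def]

text \<open>This composite gives surjectivity of \<open>\<gamma>\<close>, the opposite one in
  \<open>dcoord_gamma_elt\<close> gives injectivity; together they evaluate the
  \<open>inv_into\<close> in \<open>\<delta>\<close>.\<close>

lemma type_count_gamma_elt_dcoord:
  assumes "i \<in> set types"
  shows "type_count (gamma_elt (dcoord n)) i = n i"
  using types_cases[OF assms]
  by (elim disjE; simp only: type_count_gamma_elt dcoord_nth distrib_left right_diff_distrib mult_minus_right; simp; linarith?)

lemma dcoord_gamma_elt:
  assumes "k < 22"
  shows "dcoord (type_count (gamma_elt d)) k = d k"
  using lt_22_cases[OF assms]
  by (elim insertE emptyE; simp only: type_count_gamma_elt dcoord_nth distrib_left right_diff_distrib mult_minus_right; simp; linarith?)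

lemma type_count_rel_cong:
  assumes "burnside_proj S3 f = burnside_proj S3 g"
  shows "type_count f i = type_count g i"
proof -
  have "type_count (f - g) i = 0"
    using assms unfolding type_count_def burnside_proj_eq_iff by (rule class_mark_rel)
  then show ?thesis by simp
qed

lemma inj_on_\<gamma>: "inj_on \<gamma> (carrier A)"
proof (rule inj_onI)
  fix X Y assume X: "X \<in> carrier A" and Y: "Y \<in> carrier A" and eq: "\<gamma> X = \<gamma> Y"
  have "type_count (gamma_elt (coord X)) = type_count (gamma_elt (coord Y))"
    using eq by (intro ext type_count_rel_cong) (simp add: \<gamma>_eq)
  then have "\<forall>k<22. coord X k = coord Y k"
    by (metis dcoord_gamma_elt)
  then show "X = Y"
    by (metis amat_coord[OF X] amat_coord[OF Y] amat_eq_iff)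
qed

lemma gamma_amat_dcoord:
  assumes f: "f \<in> burnside_carrier S3"
  shows "\<gamma> (amat (dcoord (type_count f))) = burnside_proj S3 f"
proof -
  let ?d = "coord (amat (dcoord (type_count f)))"
  have "gamma_elt ?d = gamma_elt (dcoord (type_count f))"
    by (simp add: gamma_elt_def coord_amat)
  moreover have "gamma_elt (dcoord (type_count f)) - f \<in> burnside_rel S3"
    using f gamma_elt_carrier by (simp add: rel_iff_type_count type_count_gamma_elt_dcoord)
  ultimately show ?thesis
    by (simp add: \<gamma>_eq burnside_proj_eq_iff)
qed

lemma inv_into_\<gamma>:
  assumes "f \<in> burnside_carrier S3"
  shows "inv_into (carrier A) \<gamma> (burnside_proj S3 f) = amat (dcoord (type_count f))"
  using inv_into_f_f[OF inj_on_\<gamma> amat_carrier, of "dcoord (type_count f)"] gamma_amat_dcoord[OF assms] by simp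

text \<open>The product c_1 c_2 c_3, so that \<open>\<delta>\<close> becomes a single conjugation;
  its inverse follows.\<close>

definition c_coord :: "nat \<Rightarrow> rat" where
  "c_coord = (!) [0, - (2), 0, 0, 6, - (22), - (4), - (4), 0, 7, 1, 1, 1, 0, 1, 0, 0, 6, 0, 1, 0, 0]"

definition c_inv_coord :: "nat \<Rightarrow> rat" where
  "c_inv_coord = (!) [1 / 2, 1 / 6, 2 / 3, 0, - (1 / 2), 0, 0, 0, 7 / 2, 0, 1, - (1), 1, 0, 1, - (21), 0, - (6), 0, 1, 6, 0]"

lemma amat_c_inverse:
  "amat c_inv_coord \<otimes>\<^bsub>A\<^esub> amat c_coord = \<one>\<^bsub>A\<^esub>" "amat c_coord \<otimes>\<^bsub>A\<^esub> amat c_inv_coord = \<one>\<^bsub>A\<^esub>"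
  unfolding A_simps A_mult_amat one_amat amat_eq_iff
  by (auto simp: amul_nth c_coord_def c_inv_coord_def one_coord_def dest!: lt_22_cases simp del: One_nat_def)

lemma conj_c:
  assumes X: "X \<in> carrier A"
  shows "inv\<^bsub>A\<^esub> c\<^sub>3 \<otimes>\<^bsub>A\<^esub> inv\<^bsub>A\<^esub> c\<^sub>2 \<otimes>\<^bsub>A\<^esub> inv\<^bsub>A\<^esub> c\<^sub>1 \<otimes>\<^bsub>A\<^esub> X \<otimes>\<^bsub>A\<^esub> c\<^sub>1 \<otimes>\<^bsub>A\<^esub> c\<^sub>2 \<otimes>\<^bsub>A\<^esub> c\<^sub>3 =
    amat c_inv_coord \<otimes>\<^bsub>A\<^esub> X \<otimes>\<^bsub>A\<^esub> amat c_coord"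
proof -
  have "amat (amul (amul c3_inv_coord c2_inv_coord) c1_inv_coord) = amat c_inv_coord"
    "amat (amul c1_coord (amul c2_coord c3_coord)) = amat c_coord"
    unfolding amat_eq_iff
    by (auto simp: amul_nth c_coord_defs c_coord_def c_inv_coord_def dest!: lt_22_cases simp del: One_nat_def)
  then have "amat c_inv_coord = inv\<^bsub>A\<^esub> c\<^sub>3 \<otimes>\<^bsub>A\<^esub> inv\<^bsub>A\<^esub> c\<^sub>2 \<otimes>\<^bsub>A\<^esub> inv\<^bsub>A\<^esub> c\<^sub>1" "amat c_coord = c\<^sub>1 \<otimes>\<^bsub>A\<^esub> (c\<^sub>2 \<otimes>\<^bsub>A\<^esub> c\<^sub>3)"
    unfolding c_inv unfolding c_amat by (simp_all add: A_simps A_mult_amat)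
  moreover have "c\<^sub>1 \<in> carrier A" "c\<^sub>2 \<in> carrier A" "c\<^sub>3 \<in> carrier A"
    "inv\<^bsub>A\<^esub> c\<^sub>1 \<in> carrier A" "inv\<^bsub>A\<^esub> c\<^sub>2 \<in> carrier A" "inv\<^bsub>A\<^esub> c\<^sub>3 \<in> carrier A"
    unfolding c_inv unfolding c_amat by simp_all
  ultimately show ?thesis
    using X by (simp add: A.m_assoc)
qed

text \<open>The origin of \<open>ecoord\<close>: apply the inverse of \<open>\<gamma>\<close>, then
  conjugate. All denominators of \<open>dcoord\<close> and \<open>c_inv_coord\<close>
  cancel.\<close>

lemma conj_dcoord:
  "amat c_inv_coord \<otimes>\<^bsub>A\<^esub> amat (dcoord n) \<otimes>\<^bsub>A\<^esub> amat c_coord = amat (ecoord n)"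
proof -
  \<comment> \<open>The left product with \<open>c_inv_coord\<close>, simplified for general v
    before the long linear forms of \<open>dcoord\<close> are substituted.\<close>
  define w where "w v = (!) [
    1 / 2 * v 0 + 1 / 6 * v 4 + 2 / 3 * v 8,
    1 / 2 * v 1 + 1 / 6 * v 5 + 2 / 3 * v 9,
    1 / 2 * v 2 + 1 / 6 * v 6 + 2 / 3 * v 10,
    1 / 2 * v 3 + 1 / 6 * v 7 + 2 / 3 * v 11,
    - (1 / 2 * v 0),
    - (1 / 2 * v 1),
    - (1 / 2 * v 2),
    - (1 / 2 * v 3),
    7 / 2 * v 0 + v 8,
    7 / 2 * v 1 + v 9,
    7 / 2 * v 2 + v 10,
    7 / 2 * v 3 + v 11 - v 19,
    v 12,
    v 13,
    v 14,
    - (21 * v 0) - 6 * v 8 + v 15,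
    - (21 * v 1) - 6 * v 9 + v 16,
    - (21 * v 2) - 6 * v 10 + v 17,
    v 18,
    v 19,
    - (21 * v 3) - 6 * v 11 + 6 * v 19 + v 20,
    v 21]" for v :: "nat \<Rightarrow> rat"
  have "amat (amul c_inv_coord v) = amat (w v)" for v
    unfolding amat_eq_iff
    by (auto simp: amul_nth c_inv_coord_def w_def dest!: lt_22_cases simp del: One_nat_def)
  moreover have "amul (w (dcoord n)) c_coord k = ecoord n k" if "k < 22" for k
    using lt_22_cases[OF that]
    by (elim insertE emptyE; simp only: amul_nth nth_coords[OF c_coord_def] nth_coords[OF w_def] dcoord_nth ecoord_nth
        distrib_left distrib_right left_diff_distrib right_diff_distrib mult_minus_right mult_minus_left; simp; linarith?)
  ultimately show ?thesis
    by (simp add: A_simps A_mult_amat) (metis A_mult_amat amat_eq_iff)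
qed

lemma \<delta>_proj:
  assumes f: "f \<in> burnside_carrier S3"
  shows "\<delta> (burnside_proj S3 f) = emat (Poly_Mapping.map rat_of_int f)"
  unfolding \<delta>_def burnside_incl_proj inv_into_\<gamma>[OF map_of_int_carrier[OF f]] conj_c[OF amat_carrier] conj_dcoord
  by (simp add: emat_def)

text \<open>Undoing the conjugation recovers \<open>dcoord n\<close>, and the type counts of
  \<open>gamma_elt (dcoord n)\<close> are the values of n.\<close>

lemma ecoord_inj:
  assumes "amat (ecoord n) = amat (ecoord m)" and i: "i \<in> set types"
  shows "n i = m i"
proof -
  note c = amat_carrier[of c_coord] amat_carrier[of c_inv_coord]
  have "amat (dcoord n) = amat c_coord \<otimes>\<^bsub>A\<^esub> amat (ecoord n) \<otimes>\<^bsub>A\<^esub> amat c_inv_coord" for n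
  proof -
    have "amat c_coord \<otimes>\<^bsub>A\<^esub> (amat c_inv_coord \<otimes>\<^bsub>A\<^esub> amat (dcoord n) \<otimes>\<^bsub>A\<^esub> amat c_coord) \<otimes>\<^bsub>A\<^esub> amat c_inv_coord
      = (amat c_coord \<otimes>\<^bsub>A\<^esub> amat c_inv_coord) \<otimes>\<^bsub>A\<^esub> amat (dcoord n) \<otimes>\<^bsub>A\<^esub> (amat c_coord \<otimes>\<^bsub>A\<^esub> amat c_inv_coord)"
      by (simp only: A.m_assoc c amat_carrier A.m_closed)
    then show ?thesis
      by (simp add: amat_c_inverse conj_dcoord)
  qed
  then have "amat (dcoord n) = amat (dcoord m)"
    using assms(1) by simp
  then have "gamma_elt (dcoord n) = gamma_elt (dcoord m)"
    by (simp add: gamma_elt_def amat_eq_iff)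
  then show ?thesis
    using type_count_gamma_elt_dcoord[OF i] by metis
qed

lemma inj_on_\<delta>: "inj_on \<delta> (carrier B\<^sub>Z)"
proof (rule inj_onI)
  fix X Y assume "X \<in> carrier B\<^sub>Z" "Y \<in> carrier B\<^sub>Z" and eq: "\<delta> X = \<delta> Y"
  then obtain f g where f: "f \<in> burnside_carrier S3" "X = burnside_proj S3 f"
    and g: "g \<in> burnside_carrier S3" "Y = burnside_proj S3 g"
    by (auto simp: B\<^sub>Z_def S3.burnside_simps)
  let ?f = "Poly_Mapping.map rat_of_int f" and ?g = "Poly_Mapping.map rat_of_int g"
  have "amat (ecoord (type_count ?f)) = amat (ecoord (type_count ?g))"
    using eq by (simp add: f g \<delta>_proj emat_def)
  then have "\<forall>i\<in>set types. type_count (Poly_Mapping.map rat_of_int (f - g)) i = 0"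
    by (auto simp: map_of_int_simps dest: ecoord_inj)
  moreover have "f - g \<in> burnside_carrier S3"
    using f g by simp
  \<comment> \<open>The rational counts decide the rational relation, which descends to the integers
    by \<open>S3.int_rel_iff_class_mark\<close>.\<close>
  ultimately have "f - g \<in> burnside_rel S3"
    by (simp add: S3.int_rel_iff_class_mark rel_iff_type_count map_of_int_carrier)
  then show "X = Y"
    by (simp add: f g burnside_proj_eq_iff)
qed

lemma ring_hom_\<delta>: "ring_hom_ring B\<^sub>Z A \<delta>"
proof (rule ring_hom_ringI)
  show "ring B\<^sub>Z"
    unfolding B\<^sub>Z_def by (rule S3.ring_burnside)
  show "ring A"
    by (rule ring_A)
  show "\<delta> X \<in> carrier A" if "X \<in> carrier B\<^sub>Z" for X
    using that by (auto simp: B\<^sub>Z_def S3.burnside_simps \<delta>_proj emat_carrier)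
  show "\<delta> (X \<otimes>\<^bsub>B\<^sub>Z\<^esub> Y) = \<delta> X \<otimes>\<^bsub>A\<^esub> \<delta> Y" if "X \<in> carrier B\<^sub>Z" "Y \<in> carrier B\<^sub>Z" for X Y
    using that by (auto simp: B\<^sub>Z_def S3.burnside_simps \<delta>_proj A_simps S3.bmult_closed map_of_int_bmult
        emat_bmult map_of_int_carrier)
  show "\<delta> (X \<oplus>\<^bsub>B\<^sub>Z\<^esub> Y) = \<delta> X \<oplus>\<^bsub>A\<^esub> \<delta> Y" if "X \<in> carrier B\<^sub>Z" "Y \<in> carrier B\<^sub>Z" for X Y
    using that by (auto simp: B\<^sub>Z_def S3.burnside_simps \<delta>_proj A_simps map_of_int_simps emat_add)
  have "\<delta> \<one>\<^bsub>B\<^sub>Z\<^esub> = emat (Poly_Mapping.map rat_of_int (S3.rep_elt 616))"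
    unfolding B\<^sub>Z_def S3.burnside_simps(2) regular_rep
    by (rule \<delta>_proj) (simp add: S3.rep_elt_carrier set_types)
  also have "\<dots> = emat (S3.rep_elt 616)"
    by (simp add: S3.rep_elt_def)
  also have "\<dots> = \<one>\<^bsub>A\<^esub>"
    by (rule emat_one)
  finally show "\<delta> \<one>\<^bsub>B\<^sub>Z\<^esub> = \<one>\<^bsub>A\<^esub>" .
qed

section \<open>The image of \<open>\<delta>\<close>\<close>

text \<open>The forms in \<open>ecoord\<close> have integer coefficients and are polymorphic in the
  ring, so one list serves over the integers and the rationals.\<close>

lemma ecoord_of_int:
  assumes "k < 22"
  shows "ecoord (\<lambda>i. of_int (n i)) k = (of_int (ecoord n k) :: rat)"
  using lt_22_cases[OF assms] by (elim insertE emptyE; simp only: ecoord_nth; simp)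

lemma ecoord_cong:
  assumes "\<And>i. i \<in> set types \<Longrightarrow> n i = m i"
  shows "ecoord n = ecoord m"
  by (simp add: ecoord_def assms set_types)

lemma emat_sum:
  "emat (\<Sum>i\<in>set types. of_int (n i) *\<^sub>b S3.rep_elt i) = amat (\<lambda>k. of_int (ecoord n k))"
proof -
  have "type_count (\<Sum>i\<in>set types. of_int (n i) *\<^sub>b S3.rep_elt i) i = of_int (n i)" if i: "i \<in> set types" for i
  proof -
    have "(\<Sum>j\<in>set types. of_int (n j) * type_count (S3.rep_elt j) i) = (\<Sum>j\<in>set types. if j = i then of_int (n j) else 0)"
      by (rule sum.cong) (auto simp: type_count_rep)
    then show ?thesis using i by simp
  qed
  then have "emat (\<Sum>i\<in>set types. of_int (n i) *\<^sub>b S3.rep_elt i) = amat (ecoord (\<lambda>i. rat_of_int (n i)))"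
    unfolding emat_def by (intro arg_cong[of _ _ amat] ecoord_cong)
  then show ?thesis
    by (simp add: amat_eq_iff ecoord_of_int)
qed

text \<open>The representatives span modulo relations over the integers as well, so the image is the
  set of integral combinations of their 22 images.\<close>

lemma \<Lambda>_eq: "\<Lambda> = {amat (\<lambda>k. of_int (ecoord n k)) | n. True}"
proof (intro equalityI subsetI)
  fix X assume "X \<in> \<Lambda>"
  then obtain f where f: "f \<in> burnside_carrier S3" "X = emat (Poly_Mapping.map rat_of_int f)"
    by (auto simp: \<Lambda>_def B\<^sub>Z_def S3.burnside_simps \<delta>_proj)
  obtain n where n: "f - (\<Sum>i\<in>set types. n i *\<^sub>b S3.rep_elt i) \<in> burnside_rel S3"
    using S3.span_carrier[OF f(1)] by blast
  have m: "Poly_Mapping.map rat_of_int (S3.rep_elt i) = S3.rep_elt i" for i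
    by (simp add: S3.rep_elt_def)
  have "X = emat (\<Sum>i\<in>set types. of_int (n i) *\<^sub>b S3.rep_elt i)"
    unfolding f(2) using map_of_int_rel[OF n]
    by (intro emat_rel_cong) (simp add: map_of_int_simps map_of_int_sum m)
  also have "\<dots> = amat (\<lambda>k. of_int (ecoord n k))"
    by (rule emat_sum)
  finally show "X \<in> {amat (\<lambda>k. of_int (ecoord n k)) | n. True}" by blast
next
  fix X assume "X \<in> {amat (\<lambda>k. of_int (ecoord n k)) | n. True}"
  then obtain n where n: "X = amat (\<lambda>k. of_int (ecoord n k))" by blast
  let ?f = "\<Sum>i\<in>set types. n i *\<^sub>b S3.rep_elt i"
  have f: "?f \<in> burnside_carrier S3"
    by (intro burnside_carrier_sum burnside_carrier_closed S3.rep_elt_carrier)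
  have m: "Poly_Mapping.map rat_of_int (S3.rep_elt i) = S3.rep_elt i" for i
    by (simp add: S3.rep_elt_def)
  have "X = \<delta> (burnside_proj S3 ?f)"
    unfolding \<delta>_proj[OF f] n emat_sum[symmetric] by (simp add: map_of_int_simps map_of_int_sum m)
  then show "X \<in> \<Lambda>"
    using f by (auto simp: \<Lambda>_def B\<^sub>Z_def S3.burnside_simps)
qed

lemma rat_qex_of_int: "rat_qex (of_int a) = of_int a"
proof -
  have n: "of_nat k = rat_qex (of_nat k)" for k
    by (induction k) (simp_all add: rat_qex_def zero_qex_def one_qex_def plus_qex_def)
  show ?thesis
  proof (cases a)
    case (nonneg k)
    then show ?thesis using n[of k, symmetric] by simp
  next
    case (neg k)
    have "rat_qex (- x) = - rat_qex x" for x
      by (simp add: rat_qex_def uminus_qex_def)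
    then show ?thesis using neg n[of "Suc k", symmetric] by (simp del: of_nat_Suc)
  qed
qed

lemma amat_of_int:
  "amat (\<lambda>k. of_int (e k)) = mat_of_rows_list 6
    [[of_int (e 0), of_int (e 1), of_int (e 2), 0, 0, of_int (e 3)],
     [of_int (e 4), of_int (e 5), of_int (e 6), 0, 0, of_int (e 7)],
     [of_int (e 8), of_int (e 9), of_int (e 10), 0, 0, of_int (e 11)],
     [0, 0, 0, of_int (e 12), 0, of_int (e 13)],
     [0, 0, 0, 0, of_int (e 14), 0],
     [of_int (e 15), of_int (e 16), of_int (e 17), of_int (e 18), 0,
        of_int (e 19) + of_int (e 20) * \<eta> + of_int (e 21) * \<xi>]]"
  by (simp only: amat_def Qex_eq rat_qex_of_int)

lemma amat_of_int_A\<^sub>Z: "amat (\<lambda>k. of_int (e k)) \<in> A\<^sub>Z"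
proof -
  have z: "0 = (of_int 0 :: qex)" by simp
  have "amat (\<lambda>k. of_int (e k)) $$ (p, q) \<in> (if (p, q) = (5, 5)
      then {of_int a + of_int b * \<eta> + of_int c * \<xi> | a b c. True} else {of_int a | a. True})" if "p < 6" "q < 6" for p q
    using that unfolding amat_of_int
    by (elim lt_6_cases; simp add: mat_of_rows_list_def) (metis z)+
  then show ?thesis
    by (simp add: A\<^sub>Z_def)
qed

text \<open>Apart from the first, each congruence holds because both sides are divisible by the
  modulus: the x_i and z_2 by 12, z_3 by 4, the t_i, v and y by 2.\<close>

lemma \<Lambda>_congruences:
  fixes n :: "nat \<Rightarrow> int"
  defines "e \<equiv> ecoord n"
  shows "[2 * e 14 - 2 * e 19 = e 20] (mod 8)" "[e 20 = e 21] (mod 4)" "[e 21 = 0] (mod 4)"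
    "[e 15 = e 16] (mod 4)" "[e 16 = e 17] (mod 4)" "[e 17 = 0] (mod 4)"
    "[e 18 = e 3] (mod 2)" "[e 3 = e 7] (mod 2)" "[e 7 = e 11] (mod 2)" "[e 11 = e 13] (mod 2)" "[e 13 = 0] (mod 2)"
    "[e 15 = e 16] (mod 3)" "[e 16 = e 17] (mod 3)" "[e 17 = e 20] (mod 3)" "[e 20 = 0] (mod 3)"
proof -
  have "2 * e 14 - 2 * e 19 - e 20 = 8 * (- (63 * n 112) - 63 * n 113 - 63 * n 116 - 30 * n 222 - 30 * n 223 - 30 * n 226 - 24 * n 332 - 24 * n 333 - 24 * n 336 - 9 * n 662 - 9 * n 663 - 9 * n 666 + 3 * n 212 - 4 * n 313 - 30 * n 216 + 6 * n 632 - 3 * n 636)"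
    unfolding e_def ecoord_nth by (simp add: algebra_simps)
  then show "[2 * e 14 - 2 * e 19 = e 20] (mod 8)"
    by (simp add: cong_iff_dvd_diff)
  have d: "12 dvd e 15" "12 dvd e 16" "12 dvd e 17" "12 dvd e 20" "4 dvd e 21"
    "2 dvd e 3" "2 dvd e 7" "2 dvd e 11" "2 dvd e 13" "2 dvd e 18"
    unfolding e_def ecoord_nth by (intro dvd_add dvd_diff dvd_mult2 dvd_minus_iff[THEN iffD2]; simp)+
  have c: "[x = y] (mod m)" if "m dvd x" "m dvd y" for m x y :: int
    using that by (simp add: cong_iff_dvd_diff)
  have t: "12 dvd x \<Longrightarrow> 4 dvd x" "12 dvd x \<Longrightarrow> 3 dvd x" for x :: int
    by (rule dvd_trans[of _ 12]; simp)+
  show "[e 20 = e 21] (mod 4)" "[e 21 = 0] (mod 4)"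
    "[e 15 = e 16] (mod 4)" "[e 16 = e 17] (mod 4)" "[e 17 = 0] (mod 4)"
    "[e 18 = e 3] (mod 2)" "[e 3 = e 7] (mod 2)" "[e 7 = e 11] (mod 2)" "[e 11 = e 13] (mod 2)" "[e 13 = 0] (mod 2)"
    "[e 15 = e 16] (mod 3)" "[e 16 = e 17] (mod 3)" "[e 17 = e 20] (mod 3)" "[e 20 = 0] (mod 3)"
    by (rule c; simp add: t d)+
qed

lemma ex_types_fun:
  obtains n :: "nat \<Rightarrow> int" where "n 111 = a0" "n 112 = a1" "n 113 = a2" "n 116 = a3" "n 221 = a4" "n 222 = a5" "n 223 = a6" "n 226 = a7" "n 331 = a8" "n 332 = a9" "n 333 = a10" "n 336 = a11" "n 661 = a12" "n 662 = a13" "n 663 = a14" "n 666 = a15" "n 212 = a16" "n 313 = a17" "n 616 = a18" "n 216 = a19" "n 632 = a20" "n 636 = a21"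
  by (rule that[of "\<lambda>i. the (map_of [(111, a0), (112, a1), (113, a2), (116, a3), (221, a4), (222, a5), (223, a6), (226, a7), (331, a8), (332, a9), (333, a10), (336, a11), (661, a12), (662, a13), (663, a14), (666, a15), (212, a16), (313, a17), (616, a18), (216, a19), (632, a20), (636, a21)] i)"]) simp_all

text \<open>Divide the x_i and z_2 by 12, z_3 by 4, the t_i, v and y by 2, and replace w by the
  quotient q of the congruence modulo 8. In these integers and the remaining entries, the equations
  for the multiplicities have an integral solution.\<close>

lemma \<Lambda>_surj:
  fixes e :: "nat \<Rightarrow> int"
  assumes "[2 * e 14 - 2 * e 19 = e 20] (mod 8)" "[e 20 = e 21] (mod 4)" "[e 21 = 0] (mod 4)"
    "[e 15 = e 16] (mod 4)" "[e 16 = e 17] (mod 4)" "[e 17 = 0] (mod 4)"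
    "[e 18 = e 3] (mod 2)" "[e 3 = e 7] (mod 2)" "[e 7 = e 11] (mod 2)" "[e 11 = e 13] (mod 2)" "[e 13 = 0] (mod 2)"
    "[e 15 = e 16] (mod 3)" "[e 16 = e 17] (mod 3)" "[e 17 = e 20] (mod 3)" "[e 20 = 0] (mod 3)"
  shows "amat (\<lambda>k. of_int (e k)) \<in> \<Lambda>"
proof -
  note m16 = cong_trans[OF assms(5) assms(6)] and m17 = cong_trans[OF assms(14) assms(15)]
  note m16' = cong_trans[OF assms(13) m17] and m11 = cong_trans[OF assms(10) assms(11)]
  note m7 = cong_trans[OF assms(9) m11]
  note m3 = cong_trans[OF assms(8) m7]
  have 4: "4 dvd e 21" "4 dvd e 20" "4 dvd e 15" "4 dvd e 16" "4 dvd e 17"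
    and 3: "3 dvd e 20" "3 dvd e 15" "3 dvd e 16" "3 dvd e 17"
    and 2: "2 dvd e 3" "2 dvd e 7" "2 dvd e 11" "2 dvd e 13" "2 dvd e 18"
    using assms(3) cong_trans[OF assms(2) assms(3)] cong_trans[OF assms(4) m16] m16 assms(6)
      assms(15) cong_trans[OF assms(12) m16'] m16' m17 m3 m7 m11 assms(11) cong_trans[OF assms(7) m3]
    by (simp_all only: cong_0_iff)
  have 12: "12 dvd x" if "4 dvd x" "3 dvd x" for x :: int
    using that by presburger
  have "2 * e 14 - 2 * e 19 - e 20 = 8 * ((2 * e 14 - 2 * e 19 - e 20) div 8)"
    using assms(1) by (simp add: cong_iff_dvd_diff)
  moreover obtain x1' x2' x3' z2' z3' t1' t2' t3' v' y' where r: "e 15 = 12 * x1'" "e 16 = 12 * x2'" "e 17 = 12 * x3'"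
    "e 20 = 12 * z2'" "e 21 = 4 * z3'" "e 3 = 2 * t1'" "e 7 = 2 * t2'" "e 11 = 2 * t3'" "e 13 = 2 * v'" "e 18 = 2 * y'"
    using 12[OF 4(3) 3(2)] 12[OF 4(4) 3(3)] 12[OF 4(5) 3(4)] 12[OF 4(2) 3(1)] 4(1) 2 by (auto elim!: dvdE)
  \<comment> \<open>Half of 2 w - 2 z_1 - 12 z2' = 8 q; so w is expressed by z_1, z2' and q.\<close>
  ultimately have w: "e 14 = e 19 + 6 * z2' + 4 * q"
    if "q = (2 * e 14 - 2 * e 19 - e 20) div 8" for q
    using that by simp
  define q where "q = (2 * e 14 - 2 * e 19 - e 20) div 8"
  note w = w[OF q_def]
  \<comment> \<open>The inverse of the linear system \<open>ecoord n = e\<close>, written in the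
    divided coordinates. For instance w = 2 n_313 + n_616 and z_1 = n_616 give n_313 = 3 z2' + 2
    q.\<close>
  obtain n :: "nat \<Rightarrow> int" where n:
    "n 111 = - (4 * e 0) + 4 * e 1 - 28 * e 2 - 4 * t1' + 14 * e 4 - 14 * e 5 + 98 * e 6 + 14 * t2' + 3 * e 8 - 3 * e 9 + 21 * e 10 + 3 * t3' - e 12 - v' - 2 * e 19 - z2' - q + x1' - x2' + 7 * x3' - y' + z3'"
    "n 112 = 4 * e 0 + 4 * e 2 + 8 * t1' - 14 * e 4 - 14 * e 6 - 28 * t2' - 3 * e 8 - 3 * e 10 - 6 * t3' + e 12 + v' - 2 * e 19 - z2' - x1' - x3' + y' - 3 * z3'"
    "n 113 = - (4 * e 0) - 8 * e 2 + 4 * t1' + 14 * e 4 + 28 * e 6 - 14 * t2' + 3 * e 8 + 6 * e 10 - 3 * t3' + v' - 2 * e 19 + z2' + q + x1' + 2 * x3' - z3'"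
    "n 116 = 4 * e 2 - 8 * t1' - 14 * e 6 + 28 * t2' - 3 * e 10 + 6 * t3' - v' + 3 * e 19 + z2' - x3' + 3 * z3'"
    "n 221 = 6 * e 0 - 6 * e 1 + 42 * e 2 + 6 * t1' - 23 * e 4 + 23 * e 5 - 161 * e 6 - 23 * t2' - 5 * e 8 + 5 * e 9 - 35 * e 10 - 5 * t3' + e 12 + v' + 5 * e 19 - z2' - 2 * x1' + 2 * x2' - 14 * x3' + y' - 3 * z3'"
    "n 222 = - (6 * e 0) - 6 * e 2 - 12 * t1' + 23 * e 4 + 23 * e 6 + 46 * t2' + 5 * e 8 + 5 * e 10 + 10 * t3' - 2 * e 12 - 2 * v' + 3 * e 19 + 2 * z2' + 2 * x1' + 2 * x3' - 2 * y' + 6 * z3'"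
    "n 223 = 6 * e 0 + 12 * e 2 - 6 * t1' - 23 * e 4 - 46 * e 6 + 23 * t2' - 5 * e 8 - 10 * e 10 + 5 * t3' - v' + 4 * e 19 + z2' - 2 * x1' - 4 * x3' + 3 * z3'"
    "n 226 = - (6 * e 2) + 12 * t1' + 23 * e 6 - 46 * t2' + 5 * e 10 - 10 * t3' + 2 * v' - 5 * e 19 - 2 * z2' + 2 * x3' - 6 * z3'"
    "n 331 = 3 * e 0 - 3 * e 1 + 21 * e 2 + 3 * t1' - 8 * e 4 + 8 * e 5 - 56 * e 6 - 8 * t2' - 2 * e 8 + 2 * e 9 - 14 * e 10 - 2 * t3' + 3 * e 19 + z2' + q - x1' + x2' - 7 * x3' + y' - z3'"
    "n 332 = - (3 * e 0) - 3 * e 2 - 6 * t1' + 8 * e 4 + 8 * e 6 + 16 * t2' + 2 * e 8 + 2 * e 10 + 4 * t3' + e 19 + z2' + x1' + x3' - y' + 3 * z3'"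
    "n 333 = 3 * e 0 + 6 * e 2 - 3 * t1' - 8 * e 4 - 16 * e 6 + 8 * t2' - 2 * e 8 - 4 * e 10 + 2 * t3' + e 19 - 4 * z2' - 3 * q - x1' - 2 * x3' + z3'"
    "n 336 = - (3 * e 2) + 6 * t1' + 8 * e 6 - 16 * t2' + 2 * e 10 - 4 * t3' - 2 * e 19 - z2' + x3' - 3 * z3'"
    "n 661 = e 8 - e 9 + 7 * e 10 + t3' - 7 * e 19 + z2' + 2 * x1' - 2 * x2' + 14 * x3' - y' + 3 * z3'"
    "n 662 = - e 8 - e 10 - 2 * t3' + e 19 - 2 * z2' - 2 * x1' - 2 * x3' + 2 * y' - 6 * z3'"
    "n 663 = e 8 + 2 * e 10 - t3' - 2 * e 19 - z2' + 2 * x1' + 4 * x3' - 3 * z3'"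
    "n 666 = - e 10 + 2 * t3' + e 19 + 2 * z2' - 2 * x3' + 6 * z3'"
    "n 212 = e 12 + v' - e 19 + y' + z3'"
    "n 313 = 3 * z2' + 2 * q"
    "n 616 = e 19"
    "n 216 = - v' - z3'"
    "n 632 = - y' - z3'"
    "n 636 = z3'"
    by (rule ex_types_fun) (rule that)
  have "ecoord n k = e k" if "k < 22" for k
    using lt_22_cases[OF that]
    by (elim insertE emptyE; simp only: ecoord_nth n r w distrib_left right_diff_distrib mult_minus_right; linarith)
  then have "amat (\<lambda>k. of_int (e k)) = amat (\<lambda>k. of_int (ecoord n k))"
    by (simp add: amat_eq_iff)
  then show ?thesis
    unfolding \<Lambda>_eq by blast
qed

lemma \<Lambda>_subset: "\<Lambda> \<subseteq> A\<^sub>Z"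
  by (auto simp: \<Lambda>_eq amat_of_int_A\<^sub>Z)

lemma B\<^sub>Z_iso: "B\<^sub>Z \<simeq> A\<lparr>carrier := \<Lambda>\<rparr>"
proof -
  interpret h: ring_hom_ring B\<^sub>Z A \<delta>
    by (rule ring_hom_\<delta>)
  have "\<delta> \<in> ring_iso B\<^sub>Z (A\<lparr>carrier := \<Lambda>\<rparr>)"
    using inj_on_\<delta> h.hom_add h.hom_mult h.hom_one
    by (auto simp: ring_iso_def bij_betw_def \<Lambda>_def intro!: ring_hom_memI)
  then show "B\<^sub>Z \<simeq> A\<lparr>carrier := \<Lambda>\<rparr>"
    by (auto simp: is_ring_iso_def)
qed

theorem theorem8:
  shows "ring_hom_ring B\<^sub>Z A \<delta> \<and> inj_on \<delta> (carrier B\<^sub>Z) \<and>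
    \<Lambda> \<subseteq> A\<^sub>Z \<and>
    \<Lambda> = {X \<in> A\<^sub>Z. \<exists>(s11::int) (s12::int) (s13::int) (s21::int) (s22::int) (s23::int)
             (s31::int) (s32::int) (s33::int) (t1::int) (t2::int) (t3::int)
             (u::int) (v::int) (w::int) (x1::int) (x2::int) (x3::int) (y::int)
             (z1::int) (z2::int) (z3::int).
           X = mat_of_rows_list 6
             [[of_int s11, of_int s12, of_int s13, 0, 0, of_int t1],
              [of_int s21, of_int s22, of_int s23, 0, 0, of_int t2],
              [of_int s31, of_int s32, of_int s33, 0, 0, of_int t3],
              [0, 0, 0, of_int u, 0, of_int v],
              [0, 0, 0, 0, of_int w, 0],
              [of_int x1, of_int x2, of_int x3, of_int y, 0,
                 of_int z1 + of_int z2 * \<eta> + of_int z3 * \<xi>]] \<and>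
           [2 * w - 2 * z1 = z2] (mod 8) \<and> [z2 = z3] (mod 4) \<and> [z3 = 0] (mod 4) \<and>
           [x1 = x2] (mod 4) \<and> [x2 = x3] (mod 4) \<and> [x3 = 0] (mod 4) \<and>
           [y = t1] (mod 2) \<and> [t1 = t2] (mod 2) \<and> [t2 = t3] (mod 2) \<and>
           [t3 = v] (mod 2) \<and> [v = 0] (mod 2) \<and>
           [x1 = x2] (mod 3) \<and> [x2 = x3] (mod 3) \<and> [x3 = z2] (mod 3) \<and> [z2 = 0] (mod 3)} \<and>
    B\<^sub>Z \<simeq> A\<lparr>carrier := \<Lambda>\<rparr>"
    (is "_ \<and> _ \<and> _ \<and> _ = ?S \<and> _")
proof (intro conjI ring_hom_\<delta> inj_on_\<delta> \<Lambda>_subset B\<^sub>Z_iso)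
  show "\<Lambda> = ?S"
  proof (intro equalityI subsetI)
    fix X assume X: "X \<in> \<Lambda>"
    then obtain n where n: "X = amat (\<lambda>k. of_int (ecoord n k))"
      by (auto simp: \<Lambda>_eq)
    show "X \<in> ?S"
      by (rule CollectI, rule conjI[OF subsetD[OF \<Lambda>_subset X]], unfold n amat_of_int)
        (intro exI conjI, rule refl, (rule \<Lambda>_congruences)+)
  next
    fix X assume "X \<in> ?S"
    then obtain s11 s12 s13 s21 s22 s23 s31 s32 s33 t1 t2 t3 u v w x1 x2 x3 y z1 z2 z3 :: int where
      X: "X = mat_of_rows_list 6
           [[of_int s11, of_int s12, of_int s13, 0, 0, of_int t1],
            [of_int s21, of_int s22, of_int s23, 0, 0, of_int t2],
            [of_int s31, of_int s32, of_int s33, 0, 0, of_int t3],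
            [0, 0, 0, of_int u, 0, of_int v],
            [0, 0, 0, 0, of_int w, 0],
            [of_int x1, of_int x2, of_int x3, of_int y, 0,
               of_int z1 + of_int z2 * \<eta> + of_int z3 * \<xi>]]"
      and c: "[2 * w - 2 * z1 = z2] (mod 8)" "[z2 = z3] (mod 4)" "[z3 = 0] (mod 4)"
        "[x1 = x2] (mod 4)" "[x2 = x3] (mod 4)" "[x3 = 0] (mod 4)"
        "[y = t1] (mod 2)" "[t1 = t2] (mod 2)" "[t2 = t3] (mod 2)" "[t3 = v] (mod 2)" "[v = 0] (mod 2)"
        "[x1 = x2] (mod 3)" "[x2 = x3] (mod 3)" "[x3 = z2] (mod 3)" "[z2 = 0] (mod 3)"
      by (elim CollectE conjE exE) (rule that)
    define e where "e = (!) [s11, s12, s13, t1, s21, s22, s23, t2, s31, s32, s33, t3, u, v, w, x1, x2, x3, y, z1, z2, z3]"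
    have "X = amat (\<lambda>k. of_int (e k))"
      unfolding X amat_of_int by (simp add: e_def)
    moreover have "amat (\<lambda>k. of_int (e k)) \<in> \<Lambda>"
      by (rule \<Lambda>_surj) (use c in \<open>simp_all add: e_def\<close>)
    ultimately show "X \<in> \<Lambda>" by simp
  qed
qed

end
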